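(* Let $m\ge 3$ and let $A_m$ be an $m$-prism all of whose side edges are parallel. (1) The maximal size of a triangulation of $A_m$ satisfies $$\left\lceil\frac{m^2+6m-16}{4}\right\rceil\le \max_{T\text{ triangulation of }A_m}|T|\le \frac{m^2+m-6}{2}.$$ (2) The upper bound is achieved if the two caps ($m$-gon facets) of $A_m$ are parallel and there is a direction in which the whole prism projects onto one of its side quadrangular facets. (For a concrete example, let one of the $m$-gon facets have its vertices on a parabola and let $A_m$ be the product of it with a segment.)
   Context: An $m$-prism is any convex $3$-polytope with the combinatorial type of the product of a convex $m$-gon with a line segment; its caps are the two $m$-gon facets corresponding to the $m$-gon times the endpoints of the segment, its side edges are the $m$ edges joining the two caps, and its side facets are the $m$ remaining quadrangular facets. "The prism projects in a direction onto a side facet $F$" means that there is a parallel projection of $\mathbb{R}^3$ onto the plane of $F$ under which the image of the prism is $F$. A triangulation of a convex $3$-polytope $P$ is a set of tetrahedra whose vertices are among the vertices of $P$, with union $P$, such that no two of them share an interior point and any two of them intersect in a common face (possibly empty); $|T|$ is the number of tetrahedra of $T$.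
   Formalization: Part (2) fails as written (a cube projects onto a side facet but has at most 6 tetrahedra, not 7); it is proved with the added condition that some vertex of the side facet is the image of no other vertex of the prism, so the two adjacent side facets do not both collapse onto edges. *)

theory Defs
  imports "HOL-Analysis.Analysis"
begin

section \<open>Prisms\<close>

definition face_lattice_iso ::
  "('a::euclidean_space set \<Rightarrow> 'b::euclidean_space set) \<Rightarrow> 'a set \<Rightarrow> 'b set \<Rightarrow> bool" where
  "face_lattice_iso f S T \<longleftrightarrow>
     bij_betw f {G. G face_of S} {G. G face_of T} \<and>
     (\<forall>G H. G face_of S \<longrightarrow> H face_of S \<longrightarrow> (G \<subseteq> H \<longleftrightarrow> f G \<subseteq> f H))"

text \<open>The caps \<open>C\<close>, \<open>D\<close> are part of the data: for \<open>m = 4\<close> the combinatorial type of the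
  polytope does not determine which pair of opposite facets is the pair of caps.\<close>

definition prism :: "nat \<Rightarrow> (real^3) set \<Rightarrow> (real^3) set \<Rightarrow> (real^3) set \<Rightarrow> bool" where
  "prism m P C D \<longleftrightarrow>
     polytope P \<and> aff_dim P = 3 \<and>
     (\<exists>(Q :: (real^2) set) f.
        polytope Q \<and> aff_dim Q = 2 \<and> card {v. v extreme_point_of Q} = m \<and>
        face_lattice_iso f (Q \<times> {0..1::real}) P \<and>
        f (Q \<times> {0}) = C \<and> f (Q \<times> {1}) = D)"

text \<open>The caps of a prism are disjoint, so an edge that meets both of them joins them.\<close>

definition side_edge :: "(real^3) set \<Rightarrow> (real^3) set \<Rightarrow> (real^3) set \<Rightarrow> (real^3) set \<Rightarrow> bool" where
  "side_edge P C D E \<longleftrightarrow> E edge_of P \<and> E \<inter> C \<noteq> {} \<and> E \<inter> D \<noteq> {}"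

definition side_facet :: "(real^3) set \<Rightarrow> (real^3) set \<Rightarrow> (real^3) set \<Rightarrow> (real^3) set \<Rightarrow> bool" where
  "side_facet P C D F \<longleftrightarrow> F facet_of P \<and> F \<noteq> C \<and> F \<noteq> D"

definition parallel_sets :: "(real^3) set \<Rightarrow> (real^3) set \<Rightarrow> bool" where
  "parallel_sets S T \<longleftrightarrow> affine_parallel (affine hull S) (affine hull T)"

definition side_edges_parallel :: "(real^3) set \<Rightarrow> (real^3) set \<Rightarrow> (real^3) set \<Rightarrow> bool" where
  "side_edges_parallel P C D \<longleftrightarrow>
     (\<forall>E E'. side_edge P C D E \<longrightarrow> side_edge P C D E' \<longrightarrow> parallel_sets E E')"


section \<open>Projections onto a side facet\<close>

text \<open>\<open>\<pi>\<close> is the projection of space onto \<open>H\<close> along the direction \<open>d\<close>: the line through \<open>x\<close>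
  in direction \<open>d\<close> meets \<open>H\<close> in exactly one point, namely \<open>\<pi> x\<close>.  For a plane \<open>H\<close> this
  forces \<open>d\<close> to be nonzero and transversal to \<open>H\<close>.\<close>

definition parallel_projection ::
  "real^3 \<Rightarrow> (real^3) set \<Rightarrow> (real^3 \<Rightarrow> real^3) \<Rightarrow> bool" where
  "parallel_projection d H \<pi> \<longleftrightarrow> (\<forall>x. {x + t *\<^sub>R d | t. True} \<inter> H = {\<pi> x})"

definition projects_onto :: "(real^3 \<Rightarrow> real^3) \<Rightarrow> (real^3) set \<Rightarrow> (real^3) set \<Rightarrow> bool" where
  "projects_onto \<pi> P F \<longleftrightarrow> (\<exists>d. parallel_projection d (affine hull F) \<pi>) \<and> \<pi> ` P = F"

text \<open>Some vertex of \<open>F\<close> is the image of no other vertex of \<open>P\<close>; for a prism projecting onto a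
  side facet \<open>F\<close> this says that the two side facets adjacent to \<open>F\<close> do not both collapse onto
  edges of \<open>F\<close>.  Without this requirement the upper bound need not be attained: a cube
  projects orthogonally onto each of its facets, but its triangulations have at most 6
  tetrahedra, while the bound for \<open>m = 4\<close> is 7.\<close>

definition nondegenerate_projection ::
  "(real^3 \<Rightarrow> real^3) \<Rightarrow> (real^3) set \<Rightarrow> (real^3) set \<Rightarrow> bool" where
  "nondegenerate_projection \<pi> P F \<longleftrightarrow>
     (\<exists>w. w extreme_point_of F \<and> (\<forall>v. v extreme_point_of P \<and> \<pi> v = w \<longrightarrow> v = w))"


section \<open>Triangulations\<close>

text \<open>The library predicate \<^const>\<open>triangulation\<close> supplies the condition that any two
  simplices intersect in a common, possibly empty, face.\<close>

definition triangulation_of :: "(real^3) set \<Rightarrow> (real^3) set set \<Rightarrow> bool" where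
  "triangulation_of P T \<longleftrightarrow>
     triangulation T \<and>
     (\<forall>t\<in>T. 3 simplex t \<and> {v. v extreme_point_of t} \<subseteq> {v. v extreme_point_of P}) \<and>
     \<Union>T = P \<and>
     (\<forall>s\<in>T. \<forall>t\<in>T. s \<noteq> t \<longrightarrow> interior s \<inter> interior t = {})"

definition max_triangulation_size :: "(real^3) set \<Rightarrow> nat" where
  "max_triangulation_size P = Max {card T | T. triangulation_of P T}"


section \<open>The product of a segment and a polygon inscribed in a parabola\<close>

text \<open>In the plane with origin \<open>a\<close> and orthonormal axes \<open>u\<close>, \<open>v\<close>, the parabola with equation
  \<open>y = c * x\<^sup>2\<close>.\<close>

definition parabola :: "real^3 \<Rightarrow> real^3 \<Rightarrow> real^3 \<Rightarrow> real \<Rightarrow> (real^3) set" where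
  "parabola a u v c = {a + x *\<^sub>R u + (c * x\<^sup>2) *\<^sub>R v | x. True}"

definition product_with_segment :: "(real^3) set \<Rightarrow> real^3 \<Rightarrow> (real^3) set" where
  "product_with_segment C w = {x + t *\<^sub>R w | x t. x \<in> C \<and> 0 \<le> t \<and> t \<le> 1}"

end

(* Upper bound.  A plane between the caps meets a tetrahedron with two vertices on each cap in a
   quadrangle and every other tetrahedron in a triangle; the vertices of these cells are points of
   the edges a_i b_j.  Fix a generic direction in the plane.  Its line through a vertex of a cell
   enters the cell unless that vertex is extreme in the transverse direction, so a quadrangle uses
   two and a triangle at least one of the two sides of its vertices.  The tetrahedra with a facet in
   a given cap have different middle vertices, so there are at most m - 2 of them.  Since a_i b_j
   and a_j b_i cross, each of the m (m - 1) / 2 pairs {i, j} provides at most one vertex; the m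
   vertices on side facets and the m vertices on side edges have only one usable side, and two of
   the latter none.

   Lower bound.  A projective transformation makes the caps parallel.  A generic linear function X
   splits the polygon into two chains with k and m - k edges from its minimum lo to its maximum hi.
   Lifting one cap to height 0 and the other one to height - X induces the regular subdivision into
   the join of a_lo with the second cap, the join of b_hi with the first cap, and the joins of an
   edge of the first cap with a later edge of the same chain in the second cap.  Refining the first
   two cells by fans gives 2 (m - 2) + C(k, 2) + C(m - k, 2) tetrahedra, which is smallest for
   k = m / 2.  If the prism projects onto a side facet, X can be chosen with k = m - 1. *)
theory Submission
  imports Defs
begin

section \<open>Regular triangulations\<close>

text \<open>The projective transformation is never applied to the prism. Signs and zeros at the
  vertices settle most questions (independence, heights, walls, boundary), and they survive
  multiplication by the positive lengths \<open>l\<close> of the side edges. So they are computed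
  with the functions \<alpha> + \<beta> * X + \<gamma> * Y + \<delta> * z of the product and carried
  over to affine functions on space, even when the caps are not parallel. For the upper bound the
  slice is the middle one of the product, where \<open>a i\<close> \<open>b j\<close> and
  \<open>a j\<close> \<open>b i\<close> cross at abscissa (X i + X j) / 2. Genericity of the
  direction is only the injectivity of \<open>X\<close>: every comparison of slice vertices changes
  a single end of a diagonal, so ties between sums do no harm. Adding up, 2 * |T| is at most m * (m
  - 1) - 2 for the usable sides plus 2 * (m - 2) for the two caps, that is m^2 + m - 6. For the
  exact value the direction of projection need not be generic: one side facet next to F may collapse
  onto an edge of F. A small shear of the right sign restores injectivity and keeps both ends of the
  polygon on F.\<close>

lemma convex_hull_image_weights:
  assumes "finite S" "inj_on pt S" "x \<in> convex hull (pt ` S)"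
  obtains u where "\<forall>i\<in>S. 0 \<le> u i" "sum u S = (1::real)" "(\<Sum>i\<in>S. u i *\<^sub>R pt i) = x"
proof -
  obtain u where "\<forall>y\<in>pt ` S. 0 \<le> u y" "sum u (pt ` S) = 1" "(\<Sum>y\<in>pt ` S. u y *\<^sub>R y) = x"
    using assms by (auto simp: convex_hull_finite)
  then show thesis
    using that[of "u \<circ> pt"] assms(2) by (auto simp: sum.reindex)
qed

lemma affine_hull_image_weights:
  assumes "finite S" "inj_on pt S" "x \<in> affine hull (pt ` S)"
  obtains u where "sum u S = (1::real)" "(\<Sum>i\<in>S. u i *\<^sub>R pt i) = x"
proof -
  obtain u where "sum u (pt ` S) = 1" "(\<Sum>y\<in>pt ` S. u y *\<^sub>R y) = x"
    using assms by (auto simp: affine_hull_finite)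
  then show thesis
    using that[of "u \<circ> pt"] assms(2) by (auto simp: sum.reindex)
qed

lemma weights_in_convex_hull_image:
  assumes "finite S" "\<And>i. i \<in> S \<Longrightarrow> 0 \<le> u i" "sum u S = (1::real)"
    "\<And>i. i \<in> S \<Longrightarrow> u i \<noteq> 0 \<Longrightarrow> pt i \<in> C" "convex C"
  shows "(\<Sum>i\<in>S. u i *\<^sub>R pt i) \<in> C"
proof -
  let ?S = "{i\<in>S. u i \<noteq> 0}"
  have "(\<Sum>i\<in>S. u i *\<^sub>R pt i) = (\<Sum>i\<in>?S. u i *\<^sub>R pt i)"
    using assms(1) by (intro sum.mono_neutral_right) auto
  also have "\<dots> \<in> C"
  proof (rule convex_sum)
    show "sum u ?S = 1" using assms by (subst assms(3)[symmetric], intro sum.mono_neutral_left) auto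
  qed (use assms in auto)
  finally show ?thesis .
qed

lemma affine_fun_weights:
  fixes pt :: "'i \<Rightarrow> 'a::real_inner"
  assumes "sum u S = (1::real)"
  shows "k + d \<bullet> (\<Sum>i\<in>S. u i *\<^sub>R pt i) = (\<Sum>i\<in>S. u i * (k + d \<bullet> pt i))"
  using assms by (simp add: inner_sum_right algebra_simps sum.distrib flip: sum_distrib_left)

lemma sum_delta_weights:
  assumes "finite S" "v \<in> S" "\<And>s. s \<in> S \<Longrightarrow> s \<noteq> v \<Longrightarrow> g s = (0::real)"
  shows "(\<Sum>s\<in>S. u s * g s) = u v * g v"
  using sum.remove[OF assms(1,2), of "\<lambda>s. u s * g s"] assms(3) by (simp add: sum.neutral)

text \<open>The affine functions \<open>f S\<close> are the pieces of the lower convex envelope of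
  the heights \<open>h\<close>. Covering needs no volume: at a point x of the polytope take the
  piece with the largest value. A negative barycentric coordinate at v would either put x beyond a
  boundary facet or make the piece across the wall opposite v larger at x.\<close>

lemma regular_triangulation:
  fixes pt :: "'i \<Rightarrow> real^3" and h :: "'i \<Rightarrow> real"
  assumes J: "finite J" "inj_on pt J"
    and ext: "{v. v extreme_point_of convex hull (pt ` J)} = pt ` J"
    and F: "F \<noteq> {}" "\<And>S. S \<in> F \<Longrightarrow> S \<subseteq> J" "\<And>S. S \<in> F \<Longrightarrow> card S = 4"
      "\<And>S. S \<in> F \<Longrightarrow> \<not> affine_dependent (pt ` S)"
    and reg: "\<And>S. S \<in> F \<Longrightarrow> \<exists>k d. \<forall>i\<in>J. k + d \<bullet> pt i \<le> h i \<and> (k + d \<bullet> pt i = h i \<longleftrightarrow> i \<in> S)"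
    and wall: "\<And>S v. S \<in> F \<Longrightarrow> v \<in> S \<Longrightarrow>
      (\<exists>k d. (\<forall>i\<in>J. 0 \<le> k + d \<bullet> pt i) \<and> (\<forall>i\<in>S - {v}. k + d \<bullet> pt i = 0) \<and> 0 < k + d \<bullet> pt v)
      \<or> (\<exists>S'\<in>F. S - {v} \<subseteq> S' \<and> v \<notin> S')"
  shows "triangulation_of (convex hull (pt ` J)) ((\<lambda>S. convex hull (pt ` S)) ` F)" (is ?tri)
    and "card ((\<lambda>S. convex hull (pt ` S)) ` F) = card F" (is ?card)
proof -
  have finF: "finite F" using F(2) J(1) by (metis PowI finite_Pow_iff finite_subset subsetI)
  have finS: "finite S" and injS: "inj_on pt S" if "S \<in> F" for S
    using F(2)[OF that] J finite_subset inj_on_subset by blast+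
  have cardS: "card (pt ` S) = 4" if "S \<in> F" for S
    using F(3) that injS card_image by metis
  have "\<forall>S. \<exists>k d. S \<in> F \<longrightarrow> (\<forall>i\<in>J. k + d \<bullet> pt i \<le> h i \<and> (k + d \<bullet> pt i = h i \<longleftrightarrow> i \<in> S))"
    using reg by blast
  then obtain k d where kd: "\<And>S i. S \<in> F \<Longrightarrow> i \<in> J \<Longrightarrow> k S + d S \<bullet> pt i \<le> h i"
    and kd_eq: "\<And>S i. S \<in> F \<Longrightarrow> i \<in> J \<Longrightarrow> k S + d S \<bullet> pt i = h i \<longleftrightarrow> i \<in> S"
    by metis
  define f where "f S x = k S + d S \<bullet> x" for S x
  have f_sum: "f S (\<Sum>i\<in>R. u i *\<^sub>R pt i) = (\<Sum>i\<in>R. u i * f S (pt i))" if "sum u R = 1" for S R u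
    unfolding f_def by (rule affine_fun_weights[OF that])
  have f_le: "f S (pt i) \<le> h i" and f_eq: "f S (pt i) = h i \<longleftrightarrow> i \<in> S" if "S \<in> F" "i \<in> J" for S i
    using kd kd_eq that by (auto simp: f_def)
  \<comment> \<open>\<open>f S\<close> interpolates \<open>h\<close> at the vertices of S, and every
    other piece stays below \<open>h\<close> there, so \<open>f S\<close> is the largest piece on
    its own simplex.\<close>
  have hull_le: "f S' x \<le> f S x" if h: "S \<in> F" "S' \<in> F" "x \<in> convex hull (pt ` S)" for S S' x
  proof -
    obtain u where u: "\<forall>i\<in>S. 0 \<le> u i" "sum u S = 1" "(\<Sum>i\<in>S. u i *\<^sub>R pt i) = x"
      by (rule convex_hull_image_weights[OF finS[OF h(1)] injS[OF h(1)] h(3)])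
    have "(\<Sum>i\<in>S. u i * f S' (pt i)) \<le> (\<Sum>i\<in>S. u i * f S (pt i))"
    proof (intro sum_mono mult_left_mono)
      fix i assume "i \<in> S"
      then show "f S' (pt i) \<le> f S (pt i)"
        using f_le[OF that(2), of i] f_eq[OF that(1), of i] F(2)[OF that(1)] by auto
    qed (use u in auto)
    then show ?thesis using f_sum[OF u(2)] u(3) by simp
  qed
  have Int: "convex hull (pt ` S) \<inter> convex hull (pt ` S') = convex hull (pt ` (S \<inter> S'))"
    if h: "S \<in> F" "S' \<in> F" for S S'
  proof
    show "convex hull (pt ` (S \<inter> S')) \<subseteq> convex hull (pt ` S) \<inter> convex hull (pt ` S')"
      by (simp add: hull_mono image_mono)
    show "convex hull (pt ` S) \<inter> convex hull (pt ` S') \<subseteq> convex hull (pt ` (S \<inter> S'))"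
    proof
      fix x assume x: "x \<in> convex hull (pt ` S) \<inter> convex hull (pt ` S')"
      obtain u where u: "\<forall>i\<in>S. 0 \<le> u i" "sum u S = 1" "(\<Sum>i\<in>S. u i *\<^sub>R pt i) = x"
        by (rule convex_hull_image_weights[OF finS[OF h(1)] injS[OF h(1)] IntD1[OF x]])
      \<comment> \<open>At a common point both pieces are largest. Equality leaves weight only on
        vertices where \<open>f S'\<close> also reaches \<open>h\<close>, and these belong to
        S'.\<close>
      have "f S x = f S' x" using hull_le that x by (simp add: antisym)
      then have "(\<Sum>i\<in>S. u i * (f S (pt i) - f S' (pt i))) = 0"
        using f_sum[OF u(2), of S] f_sum[OF u(2), of S'] u(3) by (simp add: algebra_simps sum_subtractf)
      moreover have nn: "0 \<le> u i * (f S (pt i) - f S' (pt i))" if "i \<in> S" for i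
        using f_le[OF \<open>S' \<in> F\<close>, of i] f_eq[OF \<open>S \<in> F\<close>, of i] F(2)[OF \<open>S \<in> F\<close>] that u(1)
        by (intro mult_nonneg_nonneg) auto
      ultimately have z: "u i * (f S (pt i) - f S' (pt i)) = 0" if "i \<in> S" for i
        using that sum_nonneg_eq_0_iff[OF finS[OF h(1)], of "\<lambda>i. u i * (f S (pt i) - f S' (pt i))"]
        by fastforce
      have "(\<Sum>i\<in>S. u i *\<^sub>R pt i) \<in> convex hull (pt ` (S \<inter> S'))"
      proof (rule weights_in_convex_hull_image)
        fix i assume i: "i \<in> S" "u i \<noteq> 0"
        then have "f S' (pt i) = h i"
          using z[OF i(1)] f_eq[OF that(1), of i] F(2)[OF that(1)] by auto
        then have "i \<in> S'" using f_eq[OF that(2), of i] i F(2)[OF that(1)] by auto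
        then show "pt i \<in> convex hull (pt ` (S \<inter> S'))" using i by (simp add: hull_inc)
      qed (use u finS that in auto)
      then show "x \<in> convex hull (pt ` (S \<inter> S'))" using u by simp
    qed
  qed
  have ext_S: "{v. v extreme_point_of convex hull (pt ` S)} = pt ` S" if "S \<in> F" for S
    using extreme_point_of_convex_hull_affine_independent[OF F(4)[OF that]] by blast
  have inj: "inj_on (\<lambda>S. convex hull (pt ` S)) F"
  proof (rule inj_onI)
    fix S S' assume S: "S \<in> F" "S' \<in> F" "convex hull (pt ` S) = convex hull (pt ` S')"
    then have "pt ` S = pt ` S'" using ext_S by metis
    then show "S = S'" using F(2) S J(2) inj_on_image_eq_iff by metis
  qed
  then show ?card by (rule card_image)
  have cover: "\<exists>S\<in>F. x \<in> convex hull (pt ` S)" if x: "x \<in> convex hull (pt ` J)" for x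
  proof -
    have "Max ((\<lambda>S. f S x) ` F) \<in> (\<lambda>S. f S x) ` F" using finF F(1) by (intro Max_in) auto
    then obtain S where S: "S \<in> F" and Max: "Max ((\<lambda>S. f S x) ` F) = f S x" by auto
    have max: "f S' x \<le> f S x" if "S' \<in> F" for S'
      using Max_ge[of "(\<lambda>S. f S x) ` F" "f S' x"] finF that unfolding Max by simp
    have "aff_dim (pt ` S) = 3"
      using affine_independent_iff_card[of "pt ` S"] F(4)[OF S] cardS[OF S] by auto
    then have "x \<in> affine hull (pt ` S)"
      using aff_dim_eq_full[of "pt ` S"] by simp
    then obtain u where u: "sum u S = 1" "(\<Sum>i\<in>S. u i *\<^sub>R pt i) = x"
      by (rule affine_hull_image_weights[OF finS[OF S] injS[OF S]])
    have "0 \<le> u v" if v: "v \<in> S" for v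
    proof (rule ccontr)
      assume neg: "\<not> 0 \<le> u v"
      from wall[OF S v] consider
        (bd) k' d' where "\<forall>i\<in>J. 0 \<le> k' + d' \<bullet> pt i" "\<forall>i\<in>S - {v}. k' + d' \<bullet> pt i = 0" "0 < k' + d' \<bullet> pt v"
      | (nb) S' where "S' \<in> F" "S - {v} \<subseteq> S'" "v \<notin> S'" by blast
      then show False
      proof cases
        case bd
        obtain c where c: "\<forall>i\<in>J. 0 \<le> c i" "sum c J = 1" "(\<Sum>i\<in>J. c i *\<^sub>R pt i) = x"
          by (rule convex_hull_image_weights[OF J x])
        have "0 \<le> k' + d' \<bullet> x"
          unfolding c(3)[symmetric] affine_fun_weights[OF c(2)]
          using bd(1) c(1) by (intro sum_nonneg mult_nonneg_nonneg) auto
        moreover have "k' + d' \<bullet> x = u v * (k' + d' \<bullet> pt v)"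
          unfolding u(2)[symmetric] affine_fun_weights[OF u(1)]
          using bd(2) finS[OF S] v by (intro sum_delta_weights) auto
        ultimately show False using neg bd(3) by (simp add: zero_le_mult_iff)
      next
        case nb
        have "f S' x - f S x = (\<Sum>i\<in>S. u i * (f S' (pt i) - f S (pt i)))"
          unfolding u(2)[symmetric] f_sum[OF u(1)] by (simp add: algebra_simps sum_subtractf)
        also have "\<dots> = u v * (f S' (pt v) - f S (pt v))"
        proof (rule sum_delta_weights)
          fix s assume "s \<in> S" "s \<noteq> v"
          then have "s \<in> J" "s \<in> S'" using nb(2) F(2)[OF S] by auto
          then show "f S' (pt s) - f S (pt s) = 0"
            using f_eq[OF S, of s] f_eq[OF nb(1), of s] \<open>s \<in> S\<close> by simp
        qed (use finS S v in auto)
        finally have *: "f S' x - f S x = u v * (f S' (pt v) - f S (pt v))" .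
        have "f S' (pt v) < f S (pt v)"
          using f_eq[OF S, of v] f_eq[OF nb(1), of v] f_le[OF nb(1), of v] nb(3) F(2)[OF S] v by auto
        then have "0 < f S' x - f S x" unfolding * using neg by (simp add: mult_neg_neg)
        then show False using max[OF nb(1)] by simp
      qed
    qed
    then have "(\<Sum>i\<in>S. u i *\<^sub>R pt i) \<in> convex hull (pt ` S)"
      using u finS[OF S] by (intro weights_in_convex_hull_image) (auto intro: hull_inc)
    then show ?thesis using S u by auto
  qed
  have sub: "convex hull (pt ` S) \<subseteq> convex hull (pt ` J)" if "S \<in> F" for S
    using F(2) that by (intro hull_mono image_mono) auto
  show ?tri
    unfolding triangulation_of_def triangulation_def
  proof (intro conjI ballI allI impI)
    show "finite ((\<lambda>S. convex hull (pt ` S)) ` F)" using finF by simp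
  next
    fix t assume "t \<in> (\<lambda>S. convex hull (pt ` S)) ` F"
    then obtain S where S: "S \<in> F" "t = convex hull (pt ` S)" by auto
    show s: "3 simplex t" unfolding S(2) using F(4)[OF S(1)] cardS[OF S(1)]
      by (intro simplex_convex_hull) auto
    then show "\<exists>n. n simplex t" ..
    show "{v. v extreme_point_of t} \<subseteq> {v. v extreme_point_of convex hull (pt ` J)}"
      unfolding S(2) ext ext_S[OF S(1)] using F(2)[OF S(1)] by (rule image_mono)
  next
    fix t t' assume "t \<in> (\<lambda>S. convex hull (pt ` S)) ` F \<and> t' \<in> (\<lambda>S. convex hull (pt ` S)) ` F"
    then obtain S S' where S: "S \<in> F" "t = convex hull (pt ` S)" "S' \<in> F" "t' = convex hull (pt ` S')"
      by auto
    show "t \<inter> t' face_of t"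
      unfolding S(2,4) Int[OF S(1,3)] face_of_convex_hull_affine_independent[OF F(4)[OF S(1)]]
      by (intro exI[of _ "pt ` (S \<inter> S')"]) auto
  next
    show "\<Union> ((\<lambda>S. convex hull (pt ` S)) ` F) = convex hull (pt ` J)"
    proof
      show "\<Union> ((\<lambda>S. convex hull (pt ` S)) ` F) \<subseteq> convex hull (pt ` J)" using sub by (rule UN_least)
      show "convex hull (pt ` J) \<subseteq> \<Union> ((\<lambda>S. convex hull (pt ` S)) ` F)"
      proof
        fix x assume "x \<in> convex hull (pt ` J)"
        from cover[OF this] show "x \<in> \<Union> ((\<lambda>S. convex hull (pt ` S)) ` F)" by auto
      qed
    qed
  next
    fix t t' assume "t \<in> (\<lambda>S. convex hull (pt ` S)) ` F" "t' \<in> (\<lambda>S. convex hull (pt ` S)) ` F" "t \<noteq> t'"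
    then obtain S S' where S: "S \<in> F" "t = convex hull (pt ` S)" "S' \<in> F" "t' = convex hull (pt ` S')" "S \<noteq> S'"
      by auto
    have "S \<inter> S' \<noteq> S" using S F(3) finS by (metis Int_lower2 card_subset_eq)
    then have "card (S \<inter> S') < 4" using S F(3) finS by (metis inf.cobounded1 psubsetI psubset_card_mono)
    then have "card (pt ` (S \<inter> S')) \<le> 3"
      using card_image_le[of "S \<inter> S'" pt] finS[OF S(1)] by auto
    then have "interior (convex hull (pt ` (S \<inter> S'))) = {}"
      using finS[OF S(1)] by (intro empty_interior_convex_hull) auto
    then show "interior t \<inter> interior t' = {}"
      unfolding S(2,4) interior_Int[symmetric] Int[OF S(1,3)] .
  qed
qed

section \<open>Chains of a convex polygon\<close>

locale convex_polygon =
  fixes I :: "'i set" and X Y :: "'i \<Rightarrow> real"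
  assumes finite_I: "finite I" and card_I: "3 \<le> card I" and inj_X: "inj_on X I"
    and convex_position: "\<And>v. v \<in> I \<Longrightarrow> (X v, Y v) \<notin> convex hull ((\<lambda>u. (X u, Y u)) ` (I - {v}))"
begin

definition lo :: 'i where "lo = arg_min_on X I"
definition hi :: 'i where "hi = arg_min_on (\<lambda>v. - X v) I"

text \<open>Twice the signed area of the triangle u v w. For \<open>X u < X v\<close> it is positive
  exactly when w lies above the line through u and v.\<close>

definition turn :: "'i \<Rightarrow> 'i \<Rightarrow> 'i \<Rightarrow> real" where
  "turn u v w = (X v - X u) * (Y w - Y u) - (Y v - Y u) * (X w - X u)"

definition upper :: "'i set" where "upper = {v \<in> I. 0 \<le> turn lo hi v}"

lemma I_ne: "I \<noteq> {}"
  using card_I by auto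

lemma lo: "lo \<in> I" and lo_le: "v \<in> I \<Longrightarrow> X lo \<le> X v"
  unfolding lo_def using arg_min_if_finite[OF finite_I I_ne, of X] by force+

lemma hi: "hi \<in> I" and le_hi: "v \<in> I \<Longrightarrow> X v \<le> X hi"
  unfolding hi_def using arg_min_if_finite[OF finite_I I_ne, of "\<lambda>v. - X v"] by force+

lemma X_eq_iff: "u \<in> I \<Longrightarrow> v \<in> I \<Longrightarrow> X u = X v \<longleftrightarrow> u = v"
  using inj_X by (auto dest: inj_onD)

lemma lo_less: "v \<in> I \<Longrightarrow> v \<noteq> lo \<Longrightarrow> X lo < X v"
  using lo_le lo X_eq_iff by (metis less_eq_real_def)

lemma less_hi: "v \<in> I \<Longrightarrow> v \<noteq> hi \<Longrightarrow> X v < X hi"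
  using le_hi hi X_eq_iff by (metis less_eq_real_def)

lemma lo_neq_hi: "lo \<noteq> hi"
proof
  assume "lo = hi"
  then have "I \<subseteq> {lo}" using X_eq_iff lo_le le_hi lo by (metis antisym insertI1 subsetI)
  then show False using card_I card_mono[of "{lo}" I] by simp
qed

lemma lo_less_hi: "X lo < X hi"
  using lo_less[OF hi] lo_neq_hi by auto

text \<open>Otherwise j would lie on the vertical segment between two chords, and that segment is
  contained in the hull of the other points. In this form convex position enters the study of the
  chains.\<close>

lemma between_chords:
  assumes I: "j \<in> I" "u \<in> I" "v \<in> I" "u' \<in> I" "v' \<in> I"
    and X: "X u < X j" "X j < X v" "X u' < X j" "X j < X v'"
    and "0 \<le> turn u v j"
  shows "0 < turn u' v' j"
proof (rule ccontr)
  assume "\<not> 0 < turn u' v' j"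
  define H where "H = convex hull ((\<lambda>u. (X u, Y u)) ` (I - {j}))"
  \<comment> \<open>The point of the chord p q at the abscissa of j. As p and q differ from j, it
    lies in the hull of the other points.\<close>
  have seg: "(X j, Y p + (Y q - Y p) * ((X j - X p) / (X q - X p))) \<in> H" (is "(_, ?y p q) \<in> H")
    if "p \<in> I" "q \<in> I" "X p < X j" "X j < X q" for p q
  proof -
    define r where "r = (X j - X p) / (X q - X p)"
    have r: "0 \<le> r" "r \<le> 1" "r * (X q - X p) = X j - X p" using that by (auto simp: r_def)
    have "(1 - r) *\<^sub>R (X p, Y p) + r *\<^sub>R (X q, Y q) \<in> H"
      unfolding H_def
    proof (rule convexD[OF convex_convex_hull])
      show "(X p, Y p) \<in> convex hull ((\<lambda>u. (X u, Y u)) ` (I - {j}))"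
        using that by (intro hull_inc) auto
      show "(X q, Y q) \<in> convex hull ((\<lambda>u. (X u, Y u)) ` (I - {j}))"
        using that by (intro hull_inc) auto
    qed (use r in auto)
    moreover have "(1 - r) *\<^sub>R (X p, Y p) + r *\<^sub>R (X q, Y q) = (X j, Y p + (Y q - Y p) * r)"
      using r(3) by (auto simp: algebra_simps)
    ultimately show ?thesis unfolding r_def by simp
  qed
  have "?y u v \<le> Y j"
    using assms(6,7,10) unfolding turn_def by (simp add: field_simps)
  moreover have "Y j \<le> ?y u' v'"
    using assms(8,9) \<open>\<not> 0 < turn u' v' j\<close> unfolding turn_def by (simp add: field_simps)
  ultimately have "(X j, Y j) \<in> closed_segment (X j, ?y u v) (X j, ?y u' v')"
    by (auto simp: closed_segment_same_fst closed_segment_eq_real_ivl)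
  moreover have "closed_segment (X j, ?y u v) (X j, ?y u' v') \<subseteq> H"
    using seg[OF I(2,3) X(1,2)] seg[OF I(4,5) X(3,4)] unfolding H_def
    by (intro closed_segment_subset) auto
  ultimately show False using convex_position[OF I(1)] unfolding H_def by auto
qed

lemma turn_rotate: "turn u v w = turn v w u"
  by (simp add: turn_def algebra_simps)

lemma turn_swap: "turn u v w = - turn u w v"
  by (simp add: turn_def algebra_simps)

lemma turn_upper:
  assumes "u \<in> upper" "v \<in> upper" "w \<in> upper" "X u < X v" "X v < X w"
  shows "turn u v w < 0"
proof -
  have "0 < turn u w v"
  proof (rule between_chords)
    show "0 \<le> turn lo hi v" using assms by (auto simp: upper_def)
    show "X lo < X v" using assms lo_le[of u] by (auto simp: upper_def)
    show "X v < X hi" using assms le_hi[of w] by (auto simp: upper_def)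
  qed (use assms lo hi in \<open>auto simp: upper_def\<close>)
  then show ?thesis using turn_swap[of u v w] by simp
qed

text \<open>For increasing abscissae a zero turn puts the middle point on the chord, hence weakly
  but not strictly above it, against \<open>between_chords\<close>. The symmetries of
  \<open>turn\<close> reduce the other orders to this one.\<close>

lemma turn_neq_0:
  assumes I: "u \<in> I" "v \<in> I" "w \<in> I" and ne: "u \<noteq> v" "v \<noteq> w" "u \<noteq> w"
  shows "turn u v w \<noteq> 0"
proof -
  have *: "turn u v w \<noteq> 0" if "u \<in> I" "v \<in> I" "w \<in> I" "X u < X v" "X v < X w" for u v w
  proof
    assume "turn u v w = 0"
    then have "turn u w v = 0" using turn_swap[of u w v] by simp
    then show False using between_chords[of v u w u w] that by simp
  qed
  have "X u \<noteq> X v" "X v \<noteq> X w" "X u \<noteq> X w" using assms X_eq_iff by auto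
  then consider "X u < X v" "X v < X w" | "X u < X w" "X w < X v" | "X v < X u" "X u < X w"
    | "X v < X w" "X w < X u" | "X w < X u" "X u < X v" | "X w < X v" "X v < X u" by linarith
  then show ?thesis
  proof cases
    case 1 then show ?thesis using *[of u v w] I by simp
  next
    case 2 then show ?thesis using *[of u w v] I turn_swap[of u v w] by simp
  next
    case 3 then show ?thesis using *[of v u w] I turn_swap[of v u w] turn_rotate[of u v w] by simp
  next
    case 4 then show ?thesis using *[of v w u] I turn_rotate[of u v w] by simp
  next
    case 5 then show ?thesis using *[of w u v] I turn_rotate[of w u v] by simp
  next
    case 6 then show ?thesis
      using *[of w v u] I turn_rotate[of w v u] turn_rotate[of u v w] turn_swap[of v w u] turn_rotate[of v u w] by simp
  qed
qed

lemma turn_endpoints: "turn lo hi lo = 0" "turn lo hi hi = 0"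
  by (simp_all add: turn_def)

text \<open>A strictly concave chain from \<open>lo\<close> to \<open>hi\<close>. The line through
  its i-th edge is the graph of \<open>t i + s i * X\<close>; it supports the whole polygon from
  above and passes through no vertex but the ends of the edge.\<close>

definition chain :: "'i set \<Rightarrow> nat \<Rightarrow> (nat \<Rightarrow> 'i) \<Rightarrow> (nat \<Rightarrow> real) \<Rightarrow> (nat \<Rightarrow> real) \<Rightarrow> bool" where
  "chain U k c s t \<longleftrightarrow>
     1 \<le> k \<and> bij_betw c {..k} U \<and> c 0 = lo \<and> c k = hi \<and>
     (\<forall>i j. i < j \<and> j \<le> k \<longrightarrow> X (c i) < X (c j)) \<and>
     (\<forall>i<k. \<forall>v\<in>I. 0 \<le> t i + s i * X v - Y v) \<and>
     (\<forall>i<k. \<forall>v\<in>I. t i + s i * X v - Y v = 0 \<longleftrightarrow> v = c i \<or> v = c (Suc i)) \<and>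
     (\<forall>i j. i < j \<and> j < k \<longrightarrow> s j < s i)"

text \<open>The chain is \<open>upper\<close> sorted by \<open>X\<close>. For vertices of the chain
  \<open>turn_upper\<close> gives the supporting lines; a vertex below the chord from
  \<open>lo\<close> to \<open>hi\<close> is compared with the point of that chord at its
  abscissa.\<close>

lemma upper_chain: "\<exists>k c s t. chain upper k c s t"
proof -
  have finU: "finite upper" and UI: "upper \<subseteq> I" using finite_I by (auto simp: upper_def)
  have injU: "inj_on X upper" using inj_X UI inj_on_subset by blast
  have lohiU: "lo \<in> upper" "hi \<in> upper" using lo hi turn_endpoints by (auto simp: upper_def)
  have "card {lo, hi} \<le> card upper" using lohiU finU by (intro card_mono) auto
  then have card2: "2 \<le> card upper" using lo_neq_hi by simp
  define xs where "xs = sorted_list_of_set (X ` upper)"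
  define k where "k = card upper - 1"
  define c where "c i = the_inv_into upper X (xs ! i)" for i
  have xs: "set xs = X ` upper" "distinct xs" "sorted_wrt (<) xs" "length xs = Suc k"
    unfolding xs_def k_def using finU injU card2 by (simp_all add: card_image)
  have nth: "bij_betw ((!) xs) {..k} (X ` upper)"
    using bij_betw_nth[OF xs(2), of "{..k}" "X ` upper"] xs by (simp add: lessThan_Suc_atMost)
  have "bij_betw (the_inv_into upper X) (X ` upper) upper"
    using injU by (intro bij_betw_the_inv_into) (simp add: bij_betw_def)
  with nth have "bij_betw (the_inv_into upper X \<circ> (!) xs) {..k} upper" by (rule bij_betw_trans)
  then have bij: "bij_betw c {..k} upper" by (simp add: c_def[abs_def] o_def)
  have Xc: "X (c i) = xs ! i" if "i \<le> k" for i
    unfolding c_def using bij_betwE[OF nth] that by (intro f_the_inv_into_f[OF injU]) auto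
  have mono: "X (c i) < X (c j)" if "i < j" "j \<le> k" for i j
    using that xs(3,4) by (simp add: Xc sorted_wrt_nth_less)
  have cU: "c i \<in> upper" if "i \<le> k" for i using bij that by (auto simp: bij_betw_def)
  have cI: "c i \<in> I" if "i \<le> k" for i using cU UI that by auto
  have surj: "\<exists>i\<le>k. v = c i" if "v \<in> upper" for v
    using bij that by (auto simp: bij_betw_def image_iff)
  have k1: "1 \<le> k" using card2 by (simp add: k_def)
  have c0: "c 0 = lo"
  proof -
    obtain i where i: "i \<le> k" "lo = c i" using surj lohiU by blast
    have "i = 0" using mono[of 0 i] i lo_le[OF cI[of 0]] by (cases i) auto
    then show ?thesis using i by simp
  qed
  have ck: "c k = hi"
  proof -
    obtain i where i: "i \<le> k" "hi = c i" using surj lohiU by blast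
    have "i = k" using mono[of i k] i le_hi[OF cI[of k]] by (cases "i = k") auto
    then show ?thesis using i by simp
  qed
  define s where "s i = (Y (c (Suc i)) - Y (c i)) / (X (c (Suc i)) - X (c i))" for i
  define t where "t i = Y (c i) - s i * X (c i)" for i
  have N: "t i + s i * X v - Y v = - turn (c i) (c (Suc i)) v / (X (c (Suc i)) - X (c i))"
    if "i < k" for i v
  proof -
    define d where "d = X (c (Suc i)) - X (c i)"
    have d: "d \<noteq> 0" using mono[of i "Suc i"] that by (simp add: d_def)
    then have "s i * d = Y (c (Suc i)) - Y (c i)" by (simp add: s_def d_def)
    then have "(t i + s i * X v - Y v) * d = - turn (c i) (c (Suc i)) v"
      unfolding t_def turn_def d_def[symmetric] by algebra
    then show ?thesis using d unfolding d_def[symmetric] by (metis nonzero_mult_div_cancel_right)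
  qed
  have turn0: "turn u v w = 0 \<longleftrightarrow> w = u \<or> w = v" if "u \<in> I" "v \<in> I" "w \<in> I" "u \<noteq> v" for u v w
    using turn_neq_0[of u v w] that by (auto simp: turn_def)
  have turn_upper_edge: "turn (c i) (c (Suc i)) v \<le> 0" if i: "i < k" and v: "v \<in> upper" for i v
  proof -
    obtain j where j: "j \<le> k" "v = c j" using surj v by blast
    consider "j < i" | "j = i" | "j = Suc i" | "Suc i < j" by linarith
    then show ?thesis
    proof cases
      case 1
      then have "turn (c j) (c i) (c (Suc i)) < 0"
        using i j by (intro turn_upper cU mono) auto
      then show ?thesis using j(2) turn_rotate[of "c j" "c i" "c (Suc i)"] by simp
    next
      case 4
      then have "turn (c i) (c (Suc i)) (c j) < 0"
        using i j by (intro turn_upper cU mono) auto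
      then show ?thesis using j(2) by simp
    qed (auto simp: turn_def j(2))
  qed
  have turn_edge: "turn (c i) (c (Suc i)) v \<le> 0" if i: "i < k" and v: "v \<in> I" for i v
  proof (cases "v \<in> upper")
    case False
    then have neg: "turn lo hi v < 0" using v by (auto simp: upper_def)
    have le: "X lo \<le> X v" "X v \<le> X hi" using lo_le le_hi v by auto
    have e: "turn (c i) (c (Suc i)) lo \<le> 0" "turn (c i) (c (Suc i)) hi \<le> 0"
      using turn_upper_edge[OF i] lohiU by auto
    \<comment> \<open>The turn is affine in the position of v. Its value is interpolated between
      \<open>lo\<close> and \<open>hi\<close> along the chord and then corrected by the vertical
      offset of v from the chord, which is negative here.\<close>
    have "turn (c i) (c (Suc i)) v * (X hi - X lo)
       = turn (c i) (c (Suc i)) lo * (X hi - X v) + turn (c i) (c (Suc i)) hi * (X v - X lo)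
         + (X (c (Suc i)) - X (c i)) * turn lo hi v"
      by (simp add: turn_def algebra_simps)
    also have "\<dots> \<le> 0"
      using e le neg mono[of i "Suc i"] i
      by (intro add_nonpos_nonpos) (auto simp: mult_nonpos_nonneg mult_nonneg_nonpos)
    finally show ?thesis using lo_less_hi by (simp add: mult_le_0_iff)
  qed (use turn_upper_edge i in auto)
  have nonneg: "0 \<le> t i + s i * X v - Y v" if "i < k" "v \<in> I" for i v
    unfolding N[OF that(1)] using turn_edge[OF that] mono[of i "Suc i"] that(1)
    by (simp add: divide_nonpos_pos)
  have zero: "t i + s i * X v - Y v = 0 \<longleftrightarrow> v = c i \<or> v = c (Suc i)" if "i < k" "v \<in> I" for i v
  proof -
    have lt: "X (c i) < X (c (Suc i))" using mono[of i "Suc i"] that by simp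
    then have "c i \<noteq> c (Suc i)" by auto
    then show ?thesis
      unfolding N[OF that(1)] using lt turn0[of "c i" "c (Suc i)" v] that cI[of i] cI[of "Suc i"] by auto
  qed
  have slopes: "s j < s i" if ij: "i < j" "j < k" for i j
  proof -
    have lt: "X (c i) < X (c (Suc j))" using mono ij by simp
    have ne: "c (Suc j) \<noteq> c i" "c (Suc j) \<noteq> c (Suc i)" "c i \<noteq> c j"
      using mono[of i "Suc j"] mono[of "Suc i" "Suc j"] mono[of i j] ij by auto
    have I: "c i \<in> I" "c (Suc j) \<in> I" and k: "i < k" using cI ij by auto
    have "t i + s i * X (c i) - Y (c i) = 0" "t j + s j * X (c (Suc j)) - Y (c (Suc j)) = 0"
      using zero[OF k I(1)] zero[OF ij(2) I(2)] by simp_all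
    moreover have "0 \<le> t j + s j * X (c i) - Y (c i)" by (rule nonneg[OF ij(2) I(1)])
    moreover have "0 < t i + s i * X (c (Suc j)) - Y (c (Suc j))"
      using nonneg[OF k I(2)] zero[OF k I(2)] ne by linarith
    \<comment> \<open>Compare the two edge lines at the outer ends \<open>c i\<close> and
      \<open>c (Suc j)\<close>: each line passes through one of them and does not run below the
      polygon at the other.\<close>
    moreover have "(s i - s j) * (X (c (Suc j)) - X (c i))
      = (t i + s i * X (c (Suc j)) - Y (c (Suc j))) - (t j + s j * X (c (Suc j)) - Y (c (Suc j)))
        - (t i + s i * X (c i) - Y (c i)) + (t j + s j * X (c i) - Y (c i))"
      by (simp add: algebra_simps)
    ultimately have "0 < (s i - s j) * (X (c (Suc j)) - X (c i))" by linarith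
    then show ?thesis using lt by (simp add: zero_less_mult_iff)
  qed
  have "chain upper k c s t"
    unfolding chain_def by (intro conjI allI impI ballI) (use k1 bij c0 ck mono nonneg zero slopes in auto)
  then show ?thesis by blast
qed

end

section \<open>Both chains of a polygon and its edges\<close>

definition sg :: "bool \<Rightarrow> real" where "sg e = (if e then 1 else - 1)"

text \<open>The index \<open>True\<close> stands for the upper chain and \<open>False\<close> for
  the lower one. The factor \<open>sg e\<close> reflects the lower chain, so that both are concave
  with decreasing slopes and every argument is made once. Each chain contains \<open>lo\<close> and
  \<open>hi\<close>.\<close>

locale chained_polygon = convex_polygon I X Y for I :: "'i set" and X Y +
  fixes k :: "bool \<Rightarrow> nat" and c :: "bool \<Rightarrow> nat \<Rightarrow> 'i" and s t :: "bool \<Rightarrow> nat \<Rightarrow> real"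
  assumes k_pos: "1 \<le> k e"
    and c_bij: "bij_betw (c e) {..k e} {v \<in> I. 0 \<le> sg e * turn lo hi v}"
    and c_0: "c e 0 = lo" and c_k: "c e (k e) = hi"
    and c_mono: "\<lbrakk>i < j; j \<le> k e\<rbrakk> \<Longrightarrow> X (c e i) < X (c e j)"
    and edge_nonneg: "\<lbrakk>i < k e; v \<in> I\<rbrakk> \<Longrightarrow> 0 \<le> t e i + s e i * X v - sg e * Y v"
    and edge_zero: "\<lbrakk>i < k e; v \<in> I\<rbrakk> \<Longrightarrow>
      t e i + s e i * X v - sg e * Y v = 0 \<longleftrightarrow> v = c e i \<or> v = c e (Suc i)"
    and slope: "\<lbrakk>i < j; j < k e\<rbrakk> \<Longrightarrow> s e j < s e i"
begin

definition edge_fun :: "bool \<Rightarrow> nat \<Rightarrow> 'i \<Rightarrow> real" where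
  "edge_fun e i v = t e i + s e i * X v - sg e * Y v"

lemma edge_fun_nonneg: "\<lbrakk>i < k e; v \<in> I\<rbrakk> \<Longrightarrow> 0 \<le> edge_fun e i v"
  and edge_fun_zero: "\<lbrakk>i < k e; v \<in> I\<rbrakk> \<Longrightarrow> edge_fun e i v = 0 \<longleftrightarrow> v = c e i \<or> v = c e (Suc i)"
  using edge_nonneg edge_zero by (auto simp: edge_fun_def)

lemma edge_fun_pos: "\<lbrakk>i < k e; v \<in> I; v \<noteq> c e i; v \<noteq> c e (Suc i)\<rbrakk> \<Longrightarrow> 0 < edge_fun e i v"
  using edge_fun_nonneg[of i e v] edge_fun_zero[of i e v] by linarith

lemma c_in: "i \<le> k e \<Longrightarrow> c e i \<in> I"
  using c_bij[of e] by (auto simp: bij_betw_def)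

lemma c_eq_iff: "\<lbrakk>i \<le> k e; j \<le> k e\<rbrakk> \<Longrightarrow> c e i = c e j \<longleftrightarrow> i = j"
  using c_mono[of i j e] c_mono[of j i e] by (metis less_irrefl linorder_neqE_nat)

lemma c_eq_lo: "i \<le> k e \<Longrightarrow> c e i = lo \<longleftrightarrow> i = 0"
  using c_eq_iff[of i e 0] by (simp add: c_0)

lemma c_eq_hi: "i \<le> k e \<Longrightarrow> c e i = hi \<longleftrightarrow> i = k e"
  using c_eq_iff[of i e "k e"] by (simp add: c_k)

lemma turn_lo_hi_zero: "v \<in> I \<Longrightarrow> turn lo hi v = 0 \<longleftrightarrow> v = lo \<or> v = hi"
  using turn_neq_0[OF lo hi, of v] lo_neq_hi turn_endpoints by auto

lemma c_both:
  assumes "i \<le> k e" "j \<le> k (\<not> e)" "c e i = c (\<not> e) j"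
  shows "c e i = lo \<or> c e i = hi"
proof -
  have "0 \<le> sg e * turn lo hi (c e i)" "0 \<le> sg (\<not> e) * turn lo hi (c e i)"
    using bij_betwE[OF c_bij[of e], rule_format, of i] bij_betwE[OF c_bij[of "\<not> e"], rule_format, of j]
      assms by auto
  then have "turn lo hi (c e i) = 0" by (cases e) (auto simp: sg_def)
  then show ?thesis using turn_lo_hi_zero c_in assms by simp
qed

text \<open>Chain e has k e + 1 vertices, and the chains share exactly \<open>lo\<close> and
  \<open>hi\<close>, so the two surplus vertices cancel.\<close>

lemma k_sum: "k True + k False = card I"
proof -
  let ?U = "\<lambda>e. {v \<in> I. 0 \<le> sg e * turn lo hi v}"
  have fin: "finite (?U e)" for e using finite_I by simp
  have card: "card (?U e) = Suc (k e)" for e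
    using bij_betw_same_card[OF c_bij[of e]] by simp
  have "?U True \<union> ?U False = I" by (auto simp: sg_def)
  moreover have "?U True \<inter> ?U False = {lo, hi}"
    using turn_lo_hi_zero lo hi turn_endpoints by (fastforce simp: sg_def)
  moreover have "card {lo, hi} = 2" using lo_neq_hi by simp
  ultimately show ?thesis using card_Un_Int[OF fin[of True] fin[of False]] card by simp
qed

lemma k_other: "k e = 1 \<Longrightarrow> 2 \<le> k (\<not> e)"
  using k_sum card_I by (cases e) auto

text \<open>The source of the extremal value: when one chain is reduced to the chord from
  \<open>lo\<close> to \<open>hi\<close>, the other one has all the remaining card I - 1
  edges.\<close>

lemma k_False_1:
  assumes "\<And>v. v \<in> I \<Longrightarrow> 0 \<le> turn lo hi v"
  shows "k False = 1"
proof -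
  have "{v \<in> I. 0 \<le> sg False * turn lo hi v} = {lo, hi}"
    using assms turn_lo_hi_zero lo hi turn_endpoints by (fastforce simp: sg_def)
  then show ?thesis using bij_betw_same_card[OF c_bij[of False]] lo_neq_hi by simp
qed

definition edges :: "(bool \<times> nat) set" where "edges = {(e, i). i < k e}"

definition edge :: "bool \<times> nat \<Rightarrow> 'i set" where "edge = (\<lambda>(e, i). {c e i, c e (Suc i)})"

lemma card_edges: "card edges = card I"
proof -
  have *: "edges = Sigma UNIV (\<lambda>e. {..<k e})" by (auto simp: edges_def)
  show ?thesis
    unfolding * using k_sum by (subst card_SigmaI) (auto simp: UNIV_bool)
qed

text \<open>A common edge of different chains could only join \<open>lo\<close> to
  \<open>hi\<close>. Then both chains would consist of that edge alone, and the polygon would have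
  two vertices.\<close>

lemma edge_eqD:
  assumes "i < k e" "j < k e'" "{c e i, c e (Suc i)} = {c e' j, c e' (Suc j)}"
  shows "e = e' \<and> i = j"
proof -
  have lt: "X (c e i) < X (c e (Suc i))" "X (c e' j) < X (c e' (Suc j))"
    using c_mono assms by auto
  then have eq: "c e i = c e' j" "c e (Suc i) = c e' (Suc j)"
    using assms(3) by (auto simp: doubleton_eq_iff)
  show ?thesis
  proof (cases "e' = e")
    case True
    then show ?thesis using eq c_eq_iff[of i e j] assms by simp
  next
    case False
    then have e': "e' = (\<not> e)" by simp
    have "c e i = lo \<or> c e i = hi" "c e (Suc i) = lo \<or> c e (Suc i) = hi"
      using c_both[of i e j] c_both[of "Suc i" e "Suc j"] eq assms unfolding e' by auto
    then have "i = 0" "Suc i = k e"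
      using c_eq_lo[of i e] c_eq_hi[of i e] c_eq_lo[of "Suc i" e] c_eq_hi[of "Suc i" e] assms by auto
    moreover from this have "c e' j = lo" "c e' (Suc j) = hi" using eq c_0 c_k by metis+
    then have "j = 0" "Suc j = k e'" using c_eq_lo[of j e'] c_eq_hi[of "Suc j" e'] assms by auto
    ultimately show ?thesis using k_other[of e] unfolding e' by simp
  qed
qed

lemma inj_edge: "inj_on edge edges"
  by (auto simp: inj_on_def edge_def edges_def dest: edge_eqD)

end

lemma (in convex_polygon) flip: "convex_polygon I X (\<lambda>v. - Y v)"
proof (unfold_locales)
  fix v assume v: "v \<in> I"
  show "(X v, - Y v) \<notin> convex hull ((\<lambda>u. (X u, - Y u)) ` (I - {v}))"
  proof
    assume "(X v, - Y v) \<in> convex hull ((\<lambda>u. (X u, - Y u)) ` (I - {v}))"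
    then have "(\<lambda>(x, y). (x, - y)) (X v, - Y v)
        \<in> (\<lambda>(x, y). (x, - y)) ` (convex hull ((\<lambda>u. (X u, - Y u)) ` (I - {v})))" by blast
    also have "\<dots> = convex hull ((\<lambda>(x, y). (x, - y)) ` (\<lambda>u. (X u, - Y u)) ` (I - {v}))"
      by (intro convex_hull_linear_image linearI) auto
    also have "\<dots> = convex hull ((\<lambda>u. (X u, Y u)) ` (I - {v}))"
      by (simp add: image_image)
    finally show False using convex_position[OF v] by simp
  qed
qed (use finite_I card_I inj_X in auto)

text \<open>The lower chain is the upper chain of the polygon reflected by
  \<open>flip\<close>.\<close>

lemma (in convex_polygon) chains: "\<exists>k c s t. chained_polygon I X Y k c s t"
proof -
  interpret F: convex_polygon I X "\<lambda>v. - Y v" by (rule flip)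
  obtain kT cT sT tT where T: "chain upper kT cT sT tT" using upper_chain by blast
  obtain kF cF sF tF where F: "F.chain F.upper kF cF sF tF" using F.upper_chain by blast
  have turnF: "F.turn u v w = - turn u v w" for u v w
    by (simp add: F.turn_def turn_def algebra_simps)
  have "chained_polygon I X Y (\<lambda>e. if e then kT else kF) (\<lambda>e. if e then cT else cF)
    (\<lambda>e. if e then sT else sF) (\<lambda>e. if e then tT else tF)"
  proof (unfold_locales, goal_cases)
    case (1 e) then show ?case using T F by (auto simp: chain_def F.chain_def)
  next
    case (2 e) then show ?case using T F
      by (auto simp: chain_def F.chain_def upper_def F.upper_def turnF sg_def)
  next
    case (3 e) then show ?case using T F by (auto simp: chain_def F.chain_def)
  next
    case (4 e) then show ?case using T F by (auto simp: chain_def F.chain_def)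
  next
    case (5 i j e) then show ?case using T F by (auto simp: chain_def F.chain_def split: if_splits)
  next
    case (6 i e v)
    show ?case
    proof (cases e)
      case True then show ?thesis using T 6 by (simp add: chain_def sg_def)
    next
      case False
      then have "0 \<le> tF i + sF i * X v - - Y v" using F 6 unfolding F.chain_def by simp
      then show ?thesis using False by (simp add: sg_def)
    qed
  next
    case (7 i e v)
    show ?case
    proof (cases e)
      case True then show ?thesis using T 7 by (simp add: chain_def sg_def)
    next
      case False
      then have "tF i + sF i * X v - - Y v = 0 \<longleftrightarrow> v = cF i \<or> v = cF (Suc i)"
        using F 7 unfolding F.chain_def by simp
      then show ?thesis using False by (simp add: sg_def)
    qed
  next
    case (8 i j e) then show ?case using T F by (auto simp: chain_def F.chain_def split: if_splits)
  qed
  then show ?thesis by blast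
qed

section \<open>Coordinates for a prism with parallel side edges\<close>

text \<open>A projective transformation that sends the intersection line of the two cap planes to
  infinity turns the prism into the product of a polygon with a segment.  \<open>X\<close> and \<open>Y\<close> are
  the coordinates of the vertices of that polygon, and the lengths \<open>l\<close> of the side edges are the
  homogeneous weights of the vertices of the prism.\<close>

locale prism_frame = chained_polygon I X Y k c s t for I :: "'i set" and X Y k c s t +
  fixes l :: "'i \<Rightarrow> real" and a b :: "'i \<Rightarrow> real^3" and w :: "real^3" and P :: "(real^3) set"
  assumes l_pos: "v \<in> I \<Longrightarrow> 0 < l v"
    and b_eq: "v \<in> I \<Longrightarrow> b v = a v + l v *\<^sub>R w"
    and frame: "\<And>\<alpha> \<beta> \<gamma> \<delta>. \<exists>\<kappa> d. \<forall>v\<in>I. \<kappa> + d \<bullet> a v = l v * (\<alpha> + \<beta> * X v + \<gamma> * Y v)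
                                  \<and> \<kappa> + d \<bullet> b v = l v * (\<alpha> + \<beta> * X v + \<gamma> * Y v + \<delta>)"
    and P_eq: "P = convex hull (a ` I \<union> b ` I)"
    and ext_P: "{v. v extreme_point_of P} = a ` I \<union> b ` I"
begin

definition pt :: "'i \<times> bool \<Rightarrow> real^3" where "pt = (\<lambda>(v, z). if z then b v else a v)"

definition J :: "('i \<times> bool) set" where "J = I \<times> UNIV"

text \<open>After multiplication by the weights \<open>l\<close>, these are the restrictions to the vertices of the
  affine functions on space.\<close>

definition prism_affine :: "('i \<times> bool \<Rightarrow> real) \<Rightarrow> bool" where
  "prism_affine g \<longleftrightarrow>
     (\<exists>\<alpha> \<beta> \<gamma> \<delta>. \<forall>v z. g (v, z) = \<alpha> + \<beta> * X v + \<gamma> * Y v + (if z then \<delta> else 0))"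

lemma prism_affineI:
  "(\<And>v z. g (v, z) = \<alpha> + \<beta> * X v + \<gamma> * Y v + (if z then \<delta> else 0)) \<Longrightarrow> prism_affine g"
  unfolding prism_affine_def by blast

lemma prism_affine_const: "prism_affine (\<lambda>_. r)"
  by (rule prism_affineI[of _ r 0 0 0]) simp

lemma prism_affine_X: "prism_affine (\<lambda>i. X (fst i))"
  by (rule prism_affineI[of _ 0 1 0 0]) simp

lemma prism_affine_level: "prism_affine (\<lambda>i. if snd i then r else 0)"
  by (rule prism_affineI[of _ 0 0 0 r]) simp

lemma prism_affine_add:
  assumes "prism_affine g" "prism_affine h"
  shows "prism_affine (\<lambda>i. g i + h i)"
proof -
  obtain \<alpha> \<beta> \<gamma> \<delta> where g: "\<And>v z. g (v, z) = \<alpha> + \<beta> * X v + \<gamma> * Y v + (if z then \<delta> else 0)"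
    using assms(1) unfolding prism_affine_def by blast
  obtain \<alpha>' \<beta>' \<gamma>' \<delta>' where h: "\<And>v z. h (v, z) = \<alpha>' + \<beta>' * X v + \<gamma>' * Y v + (if z then \<delta>' else 0)"
    using assms(2) unfolding prism_affine_def by blast
  show ?thesis
    by (rule prism_affineI[of _ "\<alpha> + \<alpha>'" "\<beta> + \<beta>'" "\<gamma> + \<gamma>'" "\<delta> + \<delta>'"])
      (simp add: g h algebra_simps)
qed

lemma prism_affine_scale:
  assumes "prism_affine g"
  shows "prism_affine (\<lambda>i. r * g i)"
proof -
  obtain \<alpha> \<beta> \<gamma> \<delta> where g: "\<And>v z. g (v, z) = \<alpha> + \<beta> * X v + \<gamma> * Y v + (if z then \<delta> else 0)"
    using assms(1) unfolding prism_affine_def by blast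
  show ?thesis
    by (rule prism_affineI[of _ "r * \<alpha>" "r * \<beta>" "r * \<gamma>" "r * \<delta>"]) (simp add: g algebra_simps)
qed

lemma prism_affine_diff:
  "prism_affine g \<Longrightarrow> prism_affine h \<Longrightarrow> prism_affine (\<lambda>i. g i - h i)"
  using prism_affine_add[of g "\<lambda>i. - 1 * h i"] prism_affine_scale[of h "- 1"] by simp

lemma prism_affine_edge_fun: "prism_affine (\<lambda>i. edge_fun e j (fst i))"
  by (rule prism_affineI[of _ "t e j" "s e j" "- sg e" 0]) (simp add: edge_fun_def)

lemma prism_affine_turn: "prism_affine (\<lambda>i. turn u v (fst i))"
  by (rule prism_affineI[of _ "(Y v - Y u) * X u - (X v - X u) * Y u" "- (Y v - Y u)" "X v - X u" 0])
    (simp add: turn_def algebra_simps)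

lemmas prism_affine_intros = prism_affine_const prism_affine_X prism_affine_level
  prism_affine_add prism_affine_scale prism_affine_diff prism_affine_edge_fun prism_affine_turn

lemma prism_affine_realize:
  assumes "prism_affine g"
  obtains \<kappa> d where "\<forall>i\<in>J. \<kappa> + d \<bullet> pt i = l (fst i) * g i"
proof -
  obtain \<alpha> \<beta> \<gamma> \<delta> where g: "\<And>v z. g (v, z) = \<alpha> + \<beta> * X v + \<gamma> * Y v + (if z then \<delta> else 0)"
    using assms unfolding prism_affine_def by blast
  obtain \<kappa> d where "\<forall>v\<in>I. \<kappa> + d \<bullet> a v = l v * (\<alpha> + \<beta> * X v + \<gamma> * Y v)
      \<and> \<kappa> + d \<bullet> b v = l v * (\<alpha> + \<beta> * X v + \<gamma> * Y v + \<delta>)"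
    using frame by blast
  then have "\<forall>i\<in>J. \<kappa> + d \<bullet> pt i = l (fst i) * g i"
    by (auto simp: J_def pt_def g)
  then show thesis by (rule that)
qed

lemma finite_J: "finite J"
  using finite_I by (simp add: J_def)

lemma l_fst_pos: "i \<in> J \<Longrightarrow> 0 < l (fst i)"
  by (auto simp: J_def l_pos)

lemma pt_image: "pt ` J = a ` I \<union> b ` I"
  by (force simp: J_def pt_def image_iff)

lemma P_pt: "P = convex hull (pt ` J)" and ext_pt: "{v. v extreme_point_of convex hull (pt ` J)} = pt ` J"
  using P_eq ext_P by (simp_all add: pt_image)

lemma inj_pt: "inj_on pt J"
proof (rule inj_onI)
  fix i j assume ij: "i \<in> J" "j \<in> J" "pt i = pt j"
  obtain \<kappa> d where 1: "\<forall>i\<in>J. \<kappa> + d \<bullet> pt i = l (fst i) * (if snd i then 1 else 0)"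
    by (rule prism_affine_realize[OF prism_affine_level])
  have "snd i = snd j" using 1[rule_format, OF ij(1)] 1[rule_format, OF ij(2)] ij(3)
      l_fst_pos[OF ij(1)] l_fst_pos[OF ij(2)] by (auto split: if_splits)
  moreover
  obtain \<kappa> d where 2: "\<forall>j\<in>J. \<kappa> + d \<bullet> pt j = l (fst j) * (X (fst j) - X (fst i))"
    by (rule prism_affine_realize[OF prism_affine_diff[OF prism_affine_X prism_affine_const]])
  have "l (fst j) * (X (fst j) - X (fst i)) = 0"
    using 2[rule_format, OF ij(1)] 2[rule_format, OF ij(2)] ij(3) by simp
  then have "X (fst j) = X (fst i)" using l_fst_pos[OF ij(2)] by simp
  then have "fst j = fst i" using X_eq_iff ij by (auto simp: J_def)
  ultimately show "i = j" by (simp add: prod_eq_iff)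
qed

text \<open>A function that vanishes on S except at i yields a plane through the other points that
  misses \<open>pt i\<close>.\<close>

lemma affine_independent_pt:
  assumes "S \<subseteq> J"
    and dual: "\<And>i. i \<in> S \<Longrightarrow> \<exists>g. prism_affine g \<and> g i \<noteq> 0 \<and> (\<forall>j\<in>S - {i}. g j = 0)"
  shows "\<not> affine_dependent (pt ` S)"
  unfolding affine_dependent_def
proof safe
  fix i assume i: "i \<in> S" "pt i \<in> affine hull (pt ` S - {pt i})"
  obtain g where g: "prism_affine g" "g i \<noteq> 0" "\<forall>j\<in>S - {i}. g j = 0" using dual i by blast
  obtain \<kappa> d where kd: "\<forall>i\<in>J. \<kappa> + d \<bullet> pt i = l (fst i) * g i"
    by (rule prism_affine_realize[OF g(1)])
  have "affine {x. d \<bullet> x = - \<kappa>}" by (rule affine_hyperplane)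
  moreover have "pt ` S - {pt i} \<subseteq> {x. d \<bullet> x = - \<kappa>}"
  proof safe
    fix j assume j: "j \<in> S" "pt j \<notin> {}" "pt j \<noteq> pt i"
    then have "j \<in> S - {i}" "j \<in> J" using assms(1) by auto
    then have "\<kappa> + d \<bullet> pt j = 0" using kd g(3) by simp
    then show "d \<bullet> pt j = - \<kappa>" by simp
  qed
  ultimately have "affine hull (pt ` S - {pt i}) \<subseteq> {x. d \<bullet> x = - \<kappa>}" by (rule hull_minimal[rotated])
  then have "d \<bullet> pt i = - \<kappa>" using i by blast
  then have "l (fst i) * g i = 0" using kd i assms(1) by fastforce
  then show False using g(2) l_fst_pos[of i] i assms(1) by auto
qed

end

lemma finite_positive_lower_bound:
  fixes A :: "real set"
  assumes "finite A" "\<And>x. x \<in> A \<Longrightarrow> 0 < x"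
  obtains \<epsilon> where "0 < \<epsilon>" "\<And>x. x \<in> A \<Longrightarrow> 2 * \<epsilon> < x"
proof -
  \<comment> \<open>The 1 keeps the set nonempty, and a third instead of a half makes
    \<open>2 * \<epsilon> < x\<close> strict.\<close>
  define \<epsilon> where "\<epsilon> = Min (insert 1 A) / 3"
  have "0 < \<epsilon>" unfolding \<epsilon>_def using assms by simp
  moreover have "2 * \<epsilon> < x" if "x \<in> A" for x
  proof -
    have "Min (insert 1 A) \<le> x" using assms that by (intro Min_le) auto
    then show ?thesis using \<open>0 < \<epsilon>\<close> unfolding \<epsilon>_def by linarith
  qed
  ultimately show thesis by (rule that)
qed

lemma card_pairs_less: "2 * card {(i, j). i < j \<and> j < (n::nat)} = n * (n - 1)"
proof (induction n)
  case (Suc n)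
  have "{(i, j). i < j \<and> j < Suc n} = {(i, j). i < j \<and> j < n} \<union> (\<lambda>i. (i, n)) ` {..<n}"
    by (auto simp: less_Suc_eq)
  moreover have "finite {(i, j). i < j \<and> j < n}"
    by (rule finite_subset[of _ "{..<n} \<times> {..<n}"]) auto
  moreover have "card ((\<lambda>i. (i, n)) ` {..<n}) = n" by (simp add: card_image inj_on_def)
  moreover have "{(i, j). i < j \<and> j < n} \<inter> (\<lambda>i. (i, n)) ` {..<n} = {}" by auto
  ultimately have "card {(i, j). i < j \<and> j < Suc n} = card {(i, j). i < j \<and> j < n} + n"
    by (simp add: card_Un_disjoint)
  then show ?case using Suc by (cases n) (auto simp: algebra_simps)
qed simp

context prism_frame
begin

section \<open>A triangulation with many tetrahedra\<close>

text \<open>The heights \<open>l * H\<close> on the prism play the role of the heights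
  \<open>H\<close> on the product: multiplication by the positive weights \<open>l\<close> changes
  neither zeros nor inequalities. All conditions can thus be checked with
  \<open>prism_affine\<close> functions.\<close>

lemma frame_triangulation:
  assumes F: "F \<noteq> {}" "\<And>S. S \<in> F \<Longrightarrow> S \<subseteq> J" "\<And>S. S \<in> F \<Longrightarrow> card S = 4"
    and dual: "\<And>S i. S \<in> F \<Longrightarrow> i \<in> S \<Longrightarrow> \<exists>g. prism_affine g \<and> g i \<noteq> 0 \<and> (\<forall>j\<in>S - {i}. g j = 0)"
    and reg: "\<And>S. S \<in> F \<Longrightarrow> \<exists>g. prism_affine g \<and> (\<forall>i\<in>S. g i = H i) \<and> (\<forall>i\<in>J - S. g i < H i)"
    and wall: "\<And>S i. S \<in> F \<Longrightarrow> i \<in> S \<Longrightarrow>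
      (\<exists>g. prism_affine g \<and> (\<forall>j\<in>J. 0 \<le> g j) \<and> (\<forall>j\<in>S - {i}. g j = 0) \<and> 0 < g i)
      \<or> (\<exists>S'\<in>F. S - {i} \<subseteq> S' \<and> i \<notin> S')"
  shows "\<exists>T. triangulation_of P T \<and> card T = card F"
proof -
  have 1: "\<exists>\<kappa> d. \<forall>i\<in>J. \<kappa> + d \<bullet> pt i \<le> l (fst i) * H i \<and> (\<kappa> + d \<bullet> pt i = l (fst i) * H i \<longleftrightarrow> i \<in> S)"
    if S: "S \<in> F" for S
  proof -
    obtain g where g: "prism_affine g" "\<forall>i\<in>S. g i = H i" "\<forall>i\<in>J - S. g i < H i" using reg[OF S] by blast
    obtain \<kappa> d where kd: "\<forall>i\<in>J. \<kappa> + d \<bullet> pt i = l (fst i) * g i" by (rule prism_affine_realize[OF g(1)])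
    have "\<kappa> + d \<bullet> pt i \<le> l (fst i) * H i \<and> (\<kappa> + d \<bullet> pt i = l (fst i) * H i \<longleftrightarrow> i \<in> S)" if i: "i \<in> J" for i
    proof (cases "i \<in> S")
      case True then show ?thesis using kd g(2) i by simp
    next
      case False
      then have "g i < H i" using g(3) i by simp
      then show ?thesis using kd i False l_fst_pos[OF i] by simp
    qed
    then show ?thesis by blast
  qed
  have 2: "(\<exists>\<kappa> d. (\<forall>i\<in>J. 0 \<le> \<kappa> + d \<bullet> pt i) \<and> (\<forall>i\<in>S - {v}. \<kappa> + d \<bullet> pt i = 0) \<and> 0 < \<kappa> + d \<bullet> pt v)
      \<or> (\<exists>S'\<in>F. S - {v} \<subseteq> S' \<and> v \<notin> S')" if S: "S \<in> F" "v \<in> S" for S v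
    using wall[OF S]
  proof
    assume "\<exists>g. prism_affine g \<and> (\<forall>j\<in>J. 0 \<le> g j) \<and> (\<forall>j\<in>S - {v}. g j = 0) \<and> 0 < g v"
    then obtain g where g: "prism_affine g" "\<forall>j\<in>J. 0 \<le> g j" "\<forall>j\<in>S - {v}. g j = 0" "0 < g v" by blast
    obtain \<kappa> d where kd: "\<forall>i\<in>J. \<kappa> + d \<bullet> pt i = l (fst i) * g i" by (rule prism_affine_realize[OF g(1)])
    have "\<forall>i\<in>J. 0 \<le> \<kappa> + d \<bullet> pt i" using kd g(2) l_fst_pos by (metis less_imp_le mult_nonneg_nonneg)
    moreover have "\<forall>i\<in>S - {v}. \<kappa> + d \<bullet> pt i = 0" using kd g(3) F(2)[OF S(1)] by (metis DiffD1 mult_zero_right subsetD)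
    moreover have "0 < \<kappa> + d \<bullet> pt v" using kd g(4) l_fst_pos[of v] F(2)[OF S(1)] S(2) by auto
    ultimately show ?thesis by blast
  qed blast
  have 3: "\<not> affine_dependent (pt ` S)" if "S \<in> F" for S
    using F(2)[OF that] dual[OF that] by (rule affine_independent_pt)
  show ?thesis
    using regular_triangulation[OF finite_J inj_pt ext_pt F 3 1 2] unfolding P_pt by blast
qed

definition quad :: "bool \<Rightarrow> nat \<Rightarrow> nat \<Rightarrow> ('i \<times> bool) set" where
  "quad e i j = {(c e i, False), (c e (Suc i), False), (c e j, True), (c e (Suc j), True)}"

text \<open>The vertex \<open>a lo\<close> joined to the fan of the second cap with centre
  \<open>lo\<close>, so all these tetrahedra contain the side edge at \<open>lo\<close>. The first
  edge of a chain contains \<open>lo\<close> and gives none.\<close>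

definition fan_lo :: "bool \<Rightarrow> nat \<Rightarrow> ('i \<times> bool) set" where
  "fan_lo e i = {(lo, False), (lo, True), (c e i, True), (c e (Suc i), True)}"

text \<open>The counterpart at the other end: \<open>b hi\<close> joined to the fan of the first cap
  with centre \<open>hi\<close>. The last edge of a chain contains \<open>hi\<close> and gives
  none.\<close>

definition fan_hi :: "bool \<Rightarrow> nat \<Rightarrow> ('i \<times> bool) set" where
  "fan_hi e i = {(c e i, False), (c e (Suc i), False), (hi, False), (hi, True)}"

definition tets :: "('i \<times> bool) set set" where
  "tets = {quad e i j | e i j. i < j \<and> j < k e} \<union> {fan_lo e i | e i. 0 < i \<and> i < k e}
     \<union> {fan_hi e i | e i. Suc i < k e}"

lemma quad_in: "i < j \<Longrightarrow> j < k e \<Longrightarrow> quad e i j \<in> tets"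
  and fan_lo_in: "0 < i \<Longrightarrow> i < k e \<Longrightarrow> fan_lo e i \<in> tets"
  and fan_hi_in: "Suc i < k e \<Longrightarrow> fan_hi e i \<in> tets"
  unfolding tets_def by blast+

lemma tets_cases:
  assumes "S \<in> tets"
  obtains (quad) e i j where "S = quad e i j" "i < j" "j < k e"
    | (fan_lo) e i where "S = fan_lo e i" "0 < i" "i < k e"
    | (fan_hi) e i where "S = fan_hi e i" "Suc i < k e"
  using assms unfolding tets_def by blast

lemma c_Suc_neq: "i < k e \<Longrightarrow> c e i \<noteq> c e (Suc i)"
  using c_eq_iff[of i e "Suc i"] by simp

lemma tets_subset: "S \<in> tets \<Longrightarrow> S \<subseteq> J"
  by (erule tets_cases) (auto simp: quad_def fan_lo_def fan_hi_def J_def c_in lo hi)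

lemma tets_card4: "S \<in> tets \<Longrightarrow> card S = 4"
proof (erule tets_cases)
  fix e i j assume "S = quad e i j" "i < j" "j < k e"
  then show "card S = 4" using c_Suc_neq[of i e] c_Suc_neq[of j e] by (simp add: quad_def)
next
  fix e i assume "S = fan_lo e i" "0 < i" "i < k e"
  then show "card S = 4" using c_Suc_neq[of i e] c_eq_lo[of i e] c_eq_lo[of "Suc i" e]
    by (auto simp: fan_lo_def card_insert_if)
next
  fix e i assume "S = fan_hi e i" "Suc i < k e"
  then show "card S = 4" using c_Suc_neq[of i e] c_eq_hi[of i e] c_eq_hi[of "Suc i" e]
    by (auto simp: fan_hi_def card_insert_if)
qed

text \<open>In a \<open>quad\<close> the function of one edge vanishes on that edge and, by the
  different slopes, is not constant on the other one; a correction by the level moves its zero to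
  the vertex beside p. In a fan the single vertex in its cap is separated by the level, the centre
  by an edge function, and each of the other two by the line through the centre and its
  neighbour.\<close>

lemma tets_dual:
  assumes "S \<in> tets" "p \<in> S"
  shows "\<exists>g. prism_affine g \<and> g p \<noteq> 0 \<and> (\<forall>q\<in>S - {p}. g q = 0)"
proof -
  have ex: ?thesis if "prism_affine g" "g p \<noteq> 0" "\<forall>q\<in>S. q \<noteq> p \<longrightarrow> g q = 0" for g
    using that by blast
  from assms(1) show ?thesis
  proof (cases rule: tets_cases)
    case (quad e i j)
    have i: "i < k e" and I: "c e i \<in> I" "c e (Suc i) \<in> I" "c e j \<in> I" "c e (Suc j) \<in> I"
      using quad c_in by auto
    have lt: "X (c e i) < X (c e (Suc i))" "X (c e j) < X (c e (Suc j))" and sl: "s e j < s e i"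
      using quad c_mono slope by auto
    note z = edge_fun_zero[OF i I(1)] edge_fun_zero[OF i I(2)]
      edge_fun_zero[OF quad(3) I(3)] edge_fun_zero[OF quad(3) I(4)]
    have d: "edge_fun e j (c e i) \<noteq> edge_fun e j (c e (Suc i))"
    proof
      assume "edge_fun e j (c e i) = edge_fun e j (c e (Suc i))"
      moreover have "edge_fun e i (c e i) = 0" "edge_fun e i (c e (Suc i)) = 0" using z by auto
      ultimately have "(s e i - s e j) * (X (c e (Suc i)) - X (c e i)) = 0"
        unfolding edge_fun_def by algebra
      then show False using sl lt by simp
    qed
    have d': "edge_fun e i (c e j) \<noteq> edge_fun e i (c e (Suc j))"
    proof
      assume "edge_fun e i (c e j) = edge_fun e i (c e (Suc j))"
      moreover have "edge_fun e j (c e j) = 0" "edge_fun e j (c e (Suc j)) = 0" using z by auto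
      ultimately have "(s e i - s e j) * (X (c e (Suc j)) - X (c e j)) = 0"
        unfolding edge_fun_def by algebra
      then show False using sl lt by simp
    qed
    from assms(2) quad(1) consider "p = (c e i, False)" | "p = (c e (Suc i), False)"
      | "p = (c e j, True)" | "p = (c e (Suc j), True)" by (auto simp: quad_def)
    then show ?thesis
    proof cases
      case 1
      show ?thesis
        by (rule ex[of "\<lambda>q. edge_fun e j (fst q) - edge_fun e j (c e (Suc i))
              + (if snd q then edge_fun e j (c e (Suc i)) else 0)"], intro prism_affine_intros)
          (use 1 quad z d in \<open>auto simp: quad_def\<close>)
    next
      case 2
      show ?thesis
        by (rule ex[of "\<lambda>q. edge_fun e j (fst q) - edge_fun e j (c e i)
              + (if snd q then edge_fun e j (c e i) else 0)"], intro prism_affine_intros)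
          (use 2 quad z d in \<open>auto simp: quad_def\<close>)
    next
      case 3
      show ?thesis
        by (rule ex[of "\<lambda>q. edge_fun e i (fst q) + (if snd q then - edge_fun e i (c e (Suc j)) else 0)"], intro prism_affine_intros)
          (use 3 quad z d' in \<open>auto simp: quad_def\<close>)
    next
      case 4
      show ?thesis
        by (rule ex[of "\<lambda>q. edge_fun e i (fst q) + (if snd q then - edge_fun e i (c e j) else 0)"], intro prism_affine_intros)
          (use 4 quad z d' in \<open>auto simp: quad_def\<close>)
    qed
  next
    case (fan_lo e i)
    have I: "c e i \<in> I" "c e (Suc i) \<in> I" and ne: "c e i \<noteq> lo" "c e (Suc i) \<noteq> lo" "c e i \<noteq> c e (Suc i)"
      using fan_lo c_in c_eq_lo[of i e] c_eq_lo[of "Suc i" e] c_Suc_neq[of i e] by auto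
    note z = edge_fun_zero[OF fan_lo(3) I(1)] edge_fun_zero[OF fan_lo(3) I(2)] edge_fun_zero[OF fan_lo(3) lo]
    from assms(2) fan_lo(1) consider "p = (lo, False)" | "p = (lo, True)"
      | "p = (c e i, True)" | "p = (c e (Suc i), True)" by (auto simp: fan_lo_def)
    then show ?thesis
    proof cases
      case 1
      show ?thesis
        by (rule ex[of "\<lambda>q. 1 - (if snd q then 1 else 0)"], intro prism_affine_intros)
          (use 1 fan_lo in \<open>auto simp: fan_lo_def\<close>)
    next
      case 2
      show ?thesis
        by (rule ex[of "\<lambda>q. edge_fun e i (fst q) - edge_fun e i lo + (if snd q then edge_fun e i lo else 0)"], intro prism_affine_intros)
          (use 2 fan_lo z ne in \<open>auto simp: fan_lo_def\<close>)
    next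
      case 3
      show ?thesis
        by (rule ex[of "\<lambda>q. turn lo (c e (Suc i)) (fst q)"], intro prism_affine_intros)
          (use 3 fan_lo ne I turn_neq_0[of lo "c e (Suc i)" "c e i"] lo in \<open>auto simp: fan_lo_def turn_def\<close>)
    next
      case 4
      show ?thesis
        by (rule ex[of "\<lambda>q. turn lo (c e i) (fst q)"], intro prism_affine_intros)
          (use 4 fan_lo ne I turn_neq_0[of lo "c e i" "c e (Suc i)"] lo in \<open>auto simp: fan_lo_def turn_def\<close>)
    qed
  next
    case (fan_hi e i)
    have i: "i < k e" using fan_hi by simp
    have I: "c e i \<in> I" "c e (Suc i) \<in> I" and ne: "c e i \<noteq> hi" "c e (Suc i) \<noteq> hi" "c e i \<noteq> c e (Suc i)"
      using fan_hi c_in c_eq_hi[of i e] c_eq_hi[of "Suc i" e] c_Suc_neq[of i e] by auto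
    note z = edge_fun_zero[OF i I(1)] edge_fun_zero[OF i I(2)] edge_fun_zero[OF i hi]
    from assms(2) fan_hi(1) consider "p = (hi, True)" | "p = (hi, False)"
      | "p = (c e i, False)" | "p = (c e (Suc i), False)" by (auto simp: fan_hi_def)
    then show ?thesis
    proof cases
      case 1
      show ?thesis
        by (rule ex[of "\<lambda>q. (if snd q then 1 else 0)"], intro prism_affine_intros)
          (use 1 fan_hi in \<open>auto simp: fan_hi_def\<close>)
    next
      case 2
      show ?thesis
        by (rule ex[of "\<lambda>q. edge_fun e i (fst q) + (if snd q then - edge_fun e i hi else 0)"], intro prism_affine_intros)
          (use 2 fan_hi z ne in \<open>auto simp: fan_hi_def\<close>)
    next
      case 3
      show ?thesis
        by (rule ex[of "\<lambda>q. turn hi (c e (Suc i)) (fst q)"], intro prism_affine_intros)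
          (use 3 fan_hi ne I turn_neq_0[of hi "c e (Suc i)" "c e i"] hi in \<open>auto simp: fan_hi_def turn_def\<close>)
    next
      case 4
      show ?thesis
        by (rule ex[of "\<lambda>q. turn hi (c e i) (fst q)"], intro prism_affine_intros)
          (use 4 fan_hi ne I turn_neq_0[of hi "c e i" "c e (Suc i)"] hi in \<open>auto simp: fan_hi_def turn_def\<close>)
    qed
  qed
qed

text \<open>Every facet of a tetrahedron that is not shared with another one lies in the boundary:
  the side facets are cut out by the functions \<open>edge_fun\<close>, the caps by the level.\<close>

lemma tets_wall:
  assumes "S \<in> tets" "p \<in> S"
  shows "(\<exists>g. prism_affine g \<and> (\<forall>q\<in>J. 0 \<le> g q) \<and> (\<forall>q\<in>S - {p}. g q = 0) \<and> 0 < g p)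
      \<or> (\<exists>S'\<in>tets. S - {p} \<subseteq> S' \<and> p \<notin> S')"
proof -
  have bd: ?thesis if "prism_affine g" "\<forall>q\<in>J. 0 \<le> g q" "\<forall>q\<in>S. q \<noteq> p \<longrightarrow> g q = 0" "0 < g p" for g
    using that by blast
  have edge: ?thesis if "j < k f" "\<forall>q\<in>S. q \<noteq> p \<longrightarrow> fst q = c f j \<or> fst q = c f (Suc j)"
      "fst p \<noteq> c f j" "fst p \<noteq> c f (Suc j)" for f j
  proof (rule bd[of "\<lambda>q. edge_fun f j (fst q)"])
    show "\<forall>q\<in>J. 0 \<le> edge_fun f j (fst q)" using that edge_fun_nonneg by (auto simp: J_def)
    have fst: "fst q \<in> I" if "q \<in> S" for q using tets_subset[OF assms(1)] that by (auto simp: J_def)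
    show "\<forall>q\<in>S. q \<noteq> p \<longrightarrow> edge_fun f j (fst q) = 0" using that fst edge_fun_zero[of j f] by auto
    show "0 < edge_fun f j (fst p)" using that fst[OF assms(2)] edge_fun_pos by auto
  qed (rule prism_affine_intros)
  have nb: ?thesis if "S' \<in> tets" "S - {p} \<subseteq> S'" "p \<notin> S'" for S'
    using that by blast
  from assms(1) show ?thesis
  proof (cases rule: tets_cases)
    case (quad e i j)
    have ne: "c e i \<noteq> c e (Suc i)" "c e j \<noteq> c e (Suc j)" using quad c_Suc_neq by auto
    from assms(2) quad(1) consider "p = (c e i, False)" | "p = (c e (Suc i), False)"
      | "p = (c e j, True)" | "p = (c e (Suc j), True)" by (auto simp: quad_def)
    then show ?thesis
    proof cases
      case 1
      show ?thesis
      \<comment> \<open>For adjacent edges the remaining three vertices lie over edge j, on a side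
        facet. Otherwise the wall is shared with the \<open>quad\<close> of the next edge in the
        first cap.\<close>
      proof (cases "Suc i = j")
        case True
        then show ?thesis using 1 quad c_eq_iff[of i e j] c_eq_iff[of i e "Suc j"]
          by (intro edge[of j e]) (auto simp: quad_def)
      next
        case False
        then show ?thesis using 1 quad c_eq_iff[of i e "Suc (Suc i)"] ne
          by (intro nb[of "quad e (Suc i) j"] quad_in) (auto simp: quad_def)
      qed
    next
      case 2
      show ?thesis
      proof (cases i)
        \<comment> \<open>Beyond the first edge the wall consists of \<open>a lo\<close> and a side
          of the second cap, so the neighbour is a fan tetrahedron at \<open>lo\<close>.\<close>
        case 0
        then show ?thesis using 2 quad ne
          by (intro nb[of "fan_lo e j"] fan_lo_in) (auto simp: quad_def fan_lo_def c_0)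
      next
        case (Suc i')
        then show ?thesis using 2 quad ne c_eq_iff[of i' e "Suc (Suc i')"]
          by (intro nb[of "quad e i' j"] quad_in) (auto simp: quad_def)
      qed
    next
      case 3
      show ?thesis
      proof (cases "Suc j = k e")
        case True
        then show ?thesis using 3 quad ne c_eq_hi[of j e] c_k[of e]
          by (intro nb[of "fan_hi e i"] fan_hi_in) (auto simp: quad_def fan_hi_def)
      next
        case False
        then show ?thesis using 3 quad ne c_eq_iff[of j e "Suc (Suc j)"]
          by (intro nb[of "quad e i (Suc j)"] quad_in) (auto simp: quad_def)
      qed
    next
      case 4
      show ?thesis
      proof (cases "j = Suc i")
        case True
        then show ?thesis using 4 quad c_eq_iff[of "Suc j" e i] c_eq_iff[of "Suc j" e "Suc i"]
          by (intro edge[of i e]) (auto simp: quad_def)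
      next
        case False
        then obtain j' where j': "j = Suc j'" "i < j'" using quad by (cases j) auto
        then show ?thesis using 4 quad ne c_eq_iff[of "Suc j" e j']
          by (intro nb[of "quad e i j'"] quad_in) (auto simp: quad_def)
      qed
    qed
  next
    case (fan_lo e i)
    have ne: "c e i \<noteq> lo" "c e (Suc i) \<noteq> lo" "c e i \<noteq> c e (Suc i)"
      using fan_lo c_eq_lo[of i e] c_eq_lo[of "Suc i" e] c_Suc_neq[of i e] by auto
    from assms(2) fan_lo(1) consider "p = (lo, False)" | "p = (lo, True)"
      | "p = (c e i, True)" | "p = (c e (Suc i), True)" by (auto simp: fan_lo_def)
    then show ?thesis
    proof cases
      case 1
      show ?thesis
        by (rule bd[of "\<lambda>q. 1 - (if snd q then 1 else 0)"], intro prism_affine_intros)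
          (use 1 fan_lo in \<open>auto simp: fan_lo_def\<close>)
    next
      case 2
      then show ?thesis using fan_lo ne c_0[of e]
        by (intro nb[of "quad e 0 i"] quad_in) (auto simp: quad_def fan_lo_def)
    next
      case 3
      show ?thesis
      proof (cases "Suc i = k e")
        case False
        then show ?thesis using 3 fan_lo ne c_eq_iff[of i e "Suc (Suc i)"]
          by (intro nb[of "fan_lo e (Suc i)"] fan_lo_in) (auto simp: fan_lo_def)
      next
        case True
        \<comment> \<open>At \<open>hi\<close> the fan of the second cap passes into the other chain
          f. If f is a single edge, the wall lies on the side facet over the chord from
          \<open>lo\<close> to \<open>hi\<close>.\<close>
        then have h: "c e (Suc i) = hi" by (simp add: c_k)
        define f where "f = (\<not> e)"
        have ci: "c e i \<noteq> hi" using ne h by simp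
        show ?thesis
        proof (cases "k f = 1")
          case True
          then show ?thesis using 3 fan_lo ne h ci c_0[of f] c_k[of f]
            by (intro edge[of 0 f]) (auto simp: fan_lo_def)
        next
          case False
          then obtain n where n: "k f = Suc n" "0 < n" using k_pos[of f] by (cases "k f") auto
          have ci': "c e i \<noteq> c f n" using c_both[of i e n] fan_lo n ne ci unfolding f_def by auto
          show ?thesis using 3 fan_lo ne h ci n c_k[of f] ci'
            by (intro nb[of "fan_lo f n"] fan_lo_in) (auto simp: fan_lo_def)
        qed
      qed
    next
      case 4
      show ?thesis
      proof (cases "i = 1")
        case True
        then show ?thesis using 4 fan_lo ne c_0[of e] k_pos[of e]
          by (intro edge[of 0 e]) (auto simp: fan_lo_def)
      next
        case False
        then obtain i' where i': "i = Suc i'" "0 < i'" using fan_lo by (cases i) auto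
        then show ?thesis using 4 fan_lo ne c_eq_iff[of "Suc i" e i']
          by (intro nb[of "fan_lo e i'"] fan_lo_in) (auto simp: fan_lo_def)
      qed
    qed
  next
    case (fan_hi e i)
    have ne: "c e i \<noteq> hi" "c e (Suc i) \<noteq> hi" "c e i \<noteq> c e (Suc i)"
      using fan_hi c_eq_hi[of i e] c_eq_hi[of "Suc i" e] c_Suc_neq[of i e] by auto
    from assms(2) fan_hi(1) consider "p = (hi, True)" | "p = (hi, False)"
      | "p = (c e i, False)" | "p = (c e (Suc i), False)" by (auto simp: fan_hi_def)
    then show ?thesis
    proof cases
      case 1
      show ?thesis
        by (rule bd[of "\<lambda>q. (if snd q then 1 else 0)"], intro prism_affine_intros)
          (use 1 fan_hi in \<open>auto simp: fan_hi_def\<close>)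
    next
      case 2
      have "Suc (k e - 1) = k e" using fan_hi by simp
      then have "c e (Suc (k e - 1)) = hi" using c_k[of e] by simp
      then show ?thesis using 2 fan_hi ne
        by (intro nb[of "quad e i (k e - 1)"] quad_in) (auto simp: quad_def fan_hi_def)
    next
      case 3
      show ?thesis
      proof (cases "Suc (Suc i) = k e")
        case True
        then have "c e (Suc (Suc i)) = hi" using c_k[of e] by simp
        then show ?thesis using 3 fan_hi ne True
          by (intro edge[of "Suc i" e]) (auto simp: fan_hi_def)
      next
        case False
        then show ?thesis using 3 fan_hi ne c_eq_iff[of i e "Suc (Suc i)"]
          by (intro nb[of "fan_hi e (Suc i)"] fan_hi_in) (auto simp: fan_hi_def)
      qed
    next
      case 4
      show ?thesis
      proof (cases i)
        case (Suc i')
        then show ?thesis using 4 fan_hi ne c_eq_iff[of "Suc i" e i']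
          by (intro nb[of "fan_hi e i'"] fan_hi_in) (auto simp: fan_hi_def)
      next
        case 0
        \<comment> \<open>As for the other fan, now passing into the other chain at
          \<open>lo\<close>.\<close>
        then have h: "c e i = lo" by (simp add: c_0)
        define f where "f = (\<not> e)"
        have ci: "c e (Suc i) \<noteq> lo" using ne h by simp
        show ?thesis
        proof (cases "k f = 1")
          case True
          then show ?thesis using 4 fan_hi ne h ci c_0[of f] c_k[of f]
            by (intro edge[of 0 f]) (auto simp: fan_hi_def)
        next
          case False
          then have n: "Suc 0 < k f" using k_pos[of f] by linarith
          have ci': "c e (Suc i) \<noteq> c f (Suc 0)" using c_both[of "Suc i" e "Suc 0"] fan_hi n ne ci unfolding f_def by auto
          show ?thesis using 4 fan_hi ne h ci n c_0[of f] ci'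
            by (intro nb[of "fan_hi f 0"] fan_hi_in) (auto simp: fan_hi_def)
        qed
      qed
    qed
  qed
qed

text \<open>The corrections by \<open>\<epsilon>\<close> refine by fans the two cells that consist of a cap and a vertex of the
  other cap.\<close>

definition height :: "real \<Rightarrow> 'i \<times> bool \<Rightarrow> real" where
  "height \<epsilon> = (\<lambda>(v, z). if z then - X v - (if v = lo then \<epsilon> else 0) else - (if v = hi then \<epsilon> else 0))"

lemma tets_regular:
  assumes "S \<in> tets" and eps: "0 < \<epsilon>"
    "\<And>v. v \<in> I \<Longrightarrow> v \<noteq> lo \<Longrightarrow> 2 * \<epsilon> < X v - X lo"
    "\<And>v. v \<in> I \<Longrightarrow> v \<noteq> hi \<Longrightarrow> 2 * \<epsilon> < X hi - X v"
    "\<And>e i j. i < j \<Longrightarrow> j < k e \<Longrightarrow> 2 * \<epsilon> < edge_fun e i hi / (s e i - s e j)"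
    "\<And>e i j. i < j \<Longrightarrow> j < k e \<Longrightarrow> 2 * \<epsilon> < edge_fun e j lo / (s e i - s e j)"
  shows "\<exists>g. prism_affine g \<and> (\<forall>q\<in>S. g q = height \<epsilon> q) \<and> (\<forall>q\<in>J - S. g q < height \<epsilon> q)"
proof -
  have ex: ?thesis if "prism_affine g" "\<And>v z. (v, z) \<in> S \<Longrightarrow> g (v, z) = height \<epsilon> (v, z)"
      "\<And>v z. v \<in> I \<Longrightarrow> (v, z) \<notin> S \<Longrightarrow> g (v, z) < height \<epsilon> (v, z)" for g
    using that by (intro exI[of _ g]) (auto simp: J_def)
  from assms(1) show ?thesis
  proof (cases rule: tets_cases)
    case (quad e i j)
    \<comment> \<open>The functions of edges i and j differ by a constant plus (s i - s j) * X.
      Scaled by r their difference is X up to a constant, and the level term absorbs the constant.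
      Positivity of r is what makes the edge in the second cap the later one.\<close>
    define r where "r = 1 / (s e i - s e j)"
    have sl: "s e j < s e i" using quad slope by simp
    then have r: "0 < r" "r * (s e i - s e j) = 1" by (simp_all add: r_def)
    have ik: "i < k e" using quad by simp
    define g where "g = (\<lambda>q. - r * edge_fun e i (fst q) + (if snd q then r * (t e i - t e j) else 0))"
    have gF: "g (v, False) = - (r * edge_fun e i v)" for v by (simp add: g_def)
    have gT: "g (v, True) = - X v - r * edge_fun e j v" for v
    proof -
      have "edge_fun e i v - (t e i - t e j) = edge_fun e j v + (s e i - s e j) * X v"
        by (simp add: edge_fun_def algebra_simps)
      then have "r * edge_fun e i v - r * (t e i - t e j) = r * edge_fun e j v + (r * (s e i - s e j)) * X v"
        by (metis distrib_left mult.assoc right_diff_distrib)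
      then show ?thesis unfolding r(2) by (simp add: g_def)
    qed
    have hi': "2 * \<epsilon> < r * edge_fun e i hi" and lo': "2 * \<epsilon> < r * edge_fun e j lo"
      using eps(4,5)[OF quad(2,3)] by (simp_all add: r_def)
    have cI: "c e i \<in> I" "c e (Suc i) \<in> I" "c e j \<in> I" "c e (Suc j) \<in> I" using quad c_in by auto
    have ne: "c e i \<noteq> hi" "c e (Suc i) \<noteq> hi" "c e j \<noteq> lo" "c e (Suc j) \<noteq> lo"
      using quad c_eq_hi[of i e] c_eq_hi[of "Suc i" e] c_eq_lo[of j e] c_eq_lo[of "Suc j" e] by auto
    show ?thesis
    proof (rule ex[of g])
      show "prism_affine g" unfolding g_def by (intro prism_affine_intros)
    next
      fix v z assume "(v, z) \<in> S"
      then show "g (v, z) = height \<epsilon> (v, z)"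
        using ne cI edge_fun_zero[OF ik] edge_fun_zero[OF quad(3)]
        unfolding quad(1) quad_def by (auto simp: height_def gF gT)
    next
      fix v z assume v: "v \<in> I" "(v, z) \<notin> S"
      show "g (v, z) < height \<epsilon> (v, z)"
      proof (cases z)
        case False
        then have "0 < edge_fun e i v"
          using v quad(1) by (intro edge_fun_pos ik) (auto simp: quad_def)
        then have "0 < r * edge_fun e i v" using r by simp
        then show ?thesis using False hi' eps(1) by (auto simp: gF height_def)
      next
        case True
        then have "0 < edge_fun e j v"
          using v quad(1) by (intro edge_fun_pos quad(3)) (auto simp: quad_def)
        then have "0 < r * edge_fun e j v" using r by simp
        then show ?thesis using True lo' eps(1) by (auto simp: gT height_def)
      qed
    qed
  next
    case (fan_lo e i)
    have ne: "c e i \<noteq> lo" "c e (Suc i) \<noteq> lo" using fan_lo c_eq_lo[of i e] c_eq_lo[of "Suc i" e] by auto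
    have p: "0 < edge_fun e i lo" using ne lo by (intro edge_fun_pos fan_lo(3)) auto
    have cI: "c e i \<in> I" "c e (Suc i) \<in> I" using fan_lo c_in by auto
    \<comment> \<open>With this tilt the function falls short of -X by exactly \<epsilon> at
      \<open>(lo, True)\<close>, and the level term makes it vanish at
      \<open>(lo, False)\<close>.\<close>
    define r where "r = \<epsilon> / edge_fun e i lo"
    have r: "0 < r" "r * edge_fun e i lo = \<epsilon>" using p eps(1) by (simp_all add: r_def)
    define g where "g = (\<lambda>q. - 1 * X (fst q) + - r * edge_fun e i (fst q) + (X lo + \<epsilon>) - (if snd q then X lo + \<epsilon> else 0))"
    have nn: "0 \<le> r * edge_fun e i v" if "v \<in> I" for v
      using edge_fun_nonneg[OF fan_lo(3) that] r(1) by simp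
    show ?thesis
    proof (rule ex[of g])
      show "prism_affine g" unfolding g_def by (intro prism_affine_intros)
    next
      fix v z assume "(v, z) \<in> S"
      then show "g (v, z) = height \<epsilon> (v, z)"
        using ne cI edge_fun_zero[OF fan_lo(3)] r(2) lo_neq_hi
        unfolding fan_lo(1) fan_lo_def by (auto simp: height_def g_def)
    next
      fix v z assume v: "v \<in> I" "(v, z) \<notin> S"
      then have vlo: "v \<noteq> lo" by (cases z) (auto simp: fan_lo(1) fan_lo_def)
      show "g (v, z) < height \<epsilon> (v, z)"
      proof (cases z)
        case False
        \<comment> \<open>At \<open>hi\<close> the height is lowered by \<epsilon> as well, and the
          function itself was raised by \<epsilon>; hence the factor 2 in the choice of
          \<epsilon>.\<close>
        then show ?thesis using eps(2)[OF v(1) vlo] eps(1) vlo nn[OF v(1)] by (auto simp: g_def height_def)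
      next
        case True
        then have "0 < edge_fun e i v"
          using v fan_lo(1) by (intro edge_fun_pos fan_lo(3)) (auto simp: fan_lo_def)
        then have "0 < r * edge_fun e i v" using r by simp
        then show ?thesis using True vlo by (auto simp: g_def height_def)
      qed
    qed
  next
    case (fan_hi e i)
    have ik: "i < k e" using fan_hi by simp
    have ne: "c e i \<noteq> hi" "c e (Suc i) \<noteq> hi" using fan_hi c_eq_hi[of i e] c_eq_hi[of "Suc i" e] by auto
    have p: "0 < edge_fun e i hi" using ne hi by (intro edge_fun_pos ik) auto
    have cI: "c e i \<in> I" "c e (Suc i) \<in> I" using fan_hi c_in by auto
    define r where "r = \<epsilon> / edge_fun e i hi"
    have r: "0 < r" "r * edge_fun e i hi = \<epsilon>" using p eps(1) by (simp_all add: r_def)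
    define g where "g = (\<lambda>q. - r * edge_fun e i (fst q) + (if snd q then \<epsilon> - X hi else 0))"
    have nn: "0 \<le> r * edge_fun e i v" if "v \<in> I" for v
      using edge_fun_nonneg[OF ik that] r(1) by simp
    show ?thesis
    proof (rule ex[of g])
      show "prism_affine g" unfolding g_def by (intro prism_affine_intros)
    next
      fix v z assume "(v, z) \<in> S"
      then show "g (v, z) = height \<epsilon> (v, z)"
        using ne cI edge_fun_zero[OF ik] r(2) lo_neq_hi
        unfolding fan_hi(1) fan_hi_def by (auto simp: height_def g_def)
    next
      fix v z assume v: "v \<in> I" "(v, z) \<notin> S"
      then have vhi: "v \<noteq> hi" by (cases z) (auto simp: fan_hi(1) fan_hi_def)
      show "g (v, z) < height \<epsilon> (v, z)"
      proof (cases z)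
        case True
        then show ?thesis using eps(3)[OF v(1) vhi] eps(1) vhi nn[OF v(1)] by (auto simp: g_def height_def)
      next
        case False
        then have "0 < edge_fun e i v"
          using v fan_hi(1) by (intro edge_fun_pos ik) (auto simp: fan_hi_def)
        then have "0 < r * edge_fun e i v" using r by simp
        then show ?thesis using False vhi by (auto simp: g_def height_def)
      qed
    qed
  qed
qed

lemma heights_exist:
  obtains \<epsilon> where "0 < \<epsilon>"
    "\<And>v. v \<in> I \<Longrightarrow> v \<noteq> lo \<Longrightarrow> 2 * \<epsilon> < X v - X lo"
    "\<And>v. v \<in> I \<Longrightarrow> v \<noteq> hi \<Longrightarrow> 2 * \<epsilon> < X hi - X v"
    "\<And>e i j. i < j \<Longrightarrow> j < k e \<Longrightarrow> 2 * \<epsilon> < edge_fun e i hi / (s e i - s e j)"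
    "\<And>e i j. i < j \<Longrightarrow> j < k e \<Longrightarrow> 2 * \<epsilon> < edge_fun e j lo / (s e i - s e j)"
proof -
  let ?D = "SIGMA e:UNIV. {(i, j). i < j \<and> j < k e}"
  have fin: "finite ?D"
    by (rule finite_subset[of _ "SIGMA e:UNIV. {..<k e} \<times> {..<k e}"]) auto
  define A where "A = (\<lambda>v. X v - X lo) ` (I - {lo}) \<union> (\<lambda>v. X hi - X v) ` (I - {hi})
    \<union> (\<lambda>(e, i, j). edge_fun e i hi / (s e i - s e j)) ` ?D
    \<union> (\<lambda>(e, i, j). edge_fun e j lo / (s e i - s e j)) ` ?D"
  have finA: "finite A" unfolding A_def using finite_I fin by auto
  have pos: "0 < edge_fun e i hi" "0 < edge_fun e j lo" "0 < s e i - s e j" if "i < j" "j < k e" for e i j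
    using that slope[OF that] c_eq_hi[of i e] c_eq_hi[of "Suc i" e] c_eq_lo[of j e] c_eq_lo[of "Suc j" e]
      edge_fun_pos[OF _ hi, of i e] edge_fun_pos[OF _ lo, of j e] by auto
  have posA: "0 < x" if "x \<in> A" for x
    using that unfolding A_def by (auto intro!: divide_pos_pos pos intro: lo_less less_hi)
  obtain \<epsilon> where eps: "0 < \<epsilon>" "\<And>x. x \<in> A \<Longrightarrow> 2 * \<epsilon> < x"
    using finite_positive_lower_bound[OF finA posA] by blast
  have 1: "edge_fun e i hi / (s e i - s e j) \<in> A" "edge_fun e j lo / (s e i - s e j) \<in> A"
    if "i < j" "j < k e" for e i j
  proof -
    have D: "(e, i, j) \<in> ?D" using that by simp
    show "edge_fun e i hi / (s e i - s e j) \<in> A"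
      unfolding A_def by (rule UnI1, rule UnI2, rule image_eqI[OF _ D]) simp
    show "edge_fun e j lo / (s e i - s e j) \<in> A"
      unfolding A_def by (rule UnI2, rule image_eqI[OF _ D]) simp
  qed
  have 2: "X v - X lo \<in> A" if "v \<in> I" "v \<noteq> lo" for v using that unfolding A_def by blast
  have 3: "X hi - X v \<in> A" if "v \<in> I" "v \<noteq> hi" for v using that unfolding A_def by blast
  show thesis by (rule that[of \<epsilon>]) (auto intro: eps 1 2 3)
qed

text \<open>Chain e contributes C(k e, 2) quads, and each of the two fans has card I - 2 tetrahedra;
  the 8 stands on the left to avoid truncated subtraction. The kinds are told apart by the numbers
  of vertices on the two levels, and \<open>edge_eqD\<close> recovers the indices from the edges on
  the levels.\<close>

lemma card_tets: "2 * card tets + 8 = (\<Sum>e\<in>UNIV. k e * (k e - 1)) + 4 * card I"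
proof -
  let ?D = "SIGMA e:UNIV. {(i, j). i < j \<and> j < k e}"
  let ?L = "SIGMA e:UNIV. {i. 0 < i \<and> i < k e}"
  let ?H = "SIGMA e:UNIV. {i. Suc i < k e}"
  let ?Q = "(\<lambda>(e, i, j). quad e i j) ` ?D"
  let ?A = "(\<lambda>(e, i). fan_lo e i) ` ?L"
  let ?B = "(\<lambda>(e, i). fan_hi e i) ` ?H"
  have tets: "tets = ?Q \<union> ?A \<union> ?B"
    unfolding tets_def by (auto simp: image_iff)
  have finD: "finite ?D"
    by (rule finite_subset[of _ "SIGMA e:UNIV. {..<k e} \<times> {..<k e}"]) auto
  have finL: "finite ?L" by (rule finite_subset[of _ "SIGMA e:UNIV. {..<k e}"]) auto
  have finH: "finite ?H" by (rule finite_subset[of _ "SIGMA e:UNIV. {..<k e}"]) auto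
  have bot: "{v. (v, False) \<in> quad e i j} = {c e i, c e (Suc i)}" for e i j by (auto simp: quad_def)
  have top: "{v. (v, True) \<in> quad e i j} = {c e j, c e (Suc j)}" for e i j by (auto simp: quad_def)
  have bot_lo: "{v. (v, False) \<in> fan_lo e i} = {lo}" for e i by (auto simp: fan_lo_def)
  have top_lo: "{v. (v, True) \<in> fan_lo e i} - {lo} = {c e i, c e (Suc i)}" if "0 < i" "i < k e" for e i
    using that c_eq_lo[of i e] c_eq_lo[of "Suc i" e] by (auto simp: fan_lo_def)
  have bot_hi: "{v. (v, False) \<in> fan_hi e i} - {hi} = {c e i, c e (Suc i)}" if "Suc i < k e" for e i
    using that c_eq_hi[of i e] c_eq_hi[of "Suc i" e] by (auto simp: fan_hi_def)
  have top_hi: "{v. (v, True) \<in> fan_hi e i} = {hi}" for e i by (auto simp: fan_hi_def)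
  have "inj_on (\<lambda>(e, i, j). quad e i j) ?D"
  proof (rule inj_onI, clarsimp)
    fix e i j e' i' j' assume *: "i < j" "j < k e" "i' < j'" "j' < k e'" "quad e i j = quad e' i' j'"
    then have "{c e i, c e (Suc i)} = {c e' i', c e' (Suc i')}" "{c e j, c e (Suc j)} = {c e' j', c e' (Suc j')}"
      using bot[of e i j] bot[of e' i' j'] top[of e i j] top[of e' i' j'] by simp_all
    then show "e = e' \<and> i = i' \<and> j = j'" using edge_eqD[of i e i' e'] edge_eqD[of j e j' e'] * by simp
  qed
  then have cQ: "card ?Q = card ?D" by (rule card_image)
  have "inj_on (\<lambda>(e, i). fan_lo e i) ?L"
  proof (rule inj_onI, clarsimp)
    fix e i e' i' assume *: "0 < i" "i < k e" "0 < i'" "i' < k e'" "fan_lo e i = fan_lo e' i'"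
    then have "{c e i, c e (Suc i)} = {c e' i', c e' (Suc i')}"
      using top_lo[of i e] top_lo[of i' e'] by simp
    then show "e = e' \<and> i = i'" using edge_eqD[of i e i' e'] * by simp
  qed
  then have cA: "card ?A = card ?L" by (rule card_image)
  have "inj_on (\<lambda>(e, i). fan_hi e i) ?H"
  proof (rule inj_onI, clarsimp)
    fix e i e' i' assume *: "Suc i < k e" "Suc i' < k e'" "fan_hi e i = fan_hi e' i'"
    then have "{c e i, c e (Suc i)} = {c e' i', c e' (Suc i')}"
      using bot_hi[of i e] bot_hi[of i' e'] by simp
    then show "e = e' \<and> i = i'" using edge_eqD[of i e i' e'] * by simp
  qed
  then have cB: "card ?B = card ?H" by (rule card_image)
  have card2: "card {c e i, c e (Suc i)} = 2" if "i < k e" for e i using c_Suc_neq[OF that] by simp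
  have "?Q \<inter> ?A = {}"
  proof -
    have False if "i < j" "j < k e" "quad e i j = fan_lo e' i'" for e i j e' i'
      using bot[of e i j] bot_lo[of e' i'] card2[of i e] that by simp
    then show ?thesis by fastforce
  qed
  moreover have "(?Q \<union> ?A) \<inter> ?B = {}"
  proof -
    have 1: False if "i < j" "j < k e" "quad e i j = fan_hi e' i'" for e i j e' i'
      using top[of e i j] top_hi[of e' i'] card2[of j e] that by simp
    have 2: False if "fan_lo e i = fan_hi e' i'" "Suc i' < k e'" for e i e' i'
    proof -
      have "{c e' i', c e' (Suc i')} \<subseteq> {lo}"
        using bot_lo[of e i] bot_hi[OF that(2)] that(1) by auto
      then show False using c_Suc_neq[of i' e'] that(2) by auto
    qed
    show ?thesis using 1 2 by fastforce
  qed
  ultimately have "card tets = card ?D + card ?L + card ?H"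
    unfolding tets using finD finL finH cQ cA cB by (subst card_Un_disjoint; simp add: card_Un_disjoint)
  moreover have "2 * card ?D = (\<Sum>e\<in>UNIV. k e * (k e - 1))"
  proof -
    have "finite {(i, j). i < j \<and> j < k e}" for e
      by (rule finite_subset[of _ "{..<k e} \<times> {..<k e}"]) auto
    then have "card ?D = (\<Sum>e\<in>UNIV. card {(i, j). i < j \<and> j < k e})" by (subst card_SigmaI) auto
    then show ?thesis by (simp add: sum_distrib_left card_pairs_less del: UNIV_bool)
  qed
  moreover have "card ?L + 2 = card I"
  proof -
    have "{i. 0 < i \<and> i < k e} = {1..<k e}" for e by auto
    then show ?thesis using k_sum k_pos[of True] k_pos[of False] by (subst card_SigmaI) (auto simp: UNIV_bool)
  qed
  moreover have "card ?H + 2 = card I"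
  proof -
    have "{i. Suc i < k e} = {..<k e - 1}" for e by auto
    then show ?thesis using k_sum k_pos[of True] k_pos[of False] by (subst card_SigmaI) (auto simp: UNIV_bool)
  qed
  ultimately show ?thesis by linarith
qed

theorem triangulation_exists: "\<exists>T. triangulation_of P T \<and> 2 * card T + 8 = (\<Sum>e\<in>UNIV. k e * (k e - 1)) + 4 * card I"
proof -
  obtain \<epsilon> where eps: "0 < \<epsilon>"
    "\<And>v. v \<in> I \<Longrightarrow> v \<noteq> lo \<Longrightarrow> 2 * \<epsilon> < X v - X lo"
    "\<And>v. v \<in> I \<Longrightarrow> v \<noteq> hi \<Longrightarrow> 2 * \<epsilon> < X hi - X v"
    "\<And>e i j. i < j \<Longrightarrow> j < k e \<Longrightarrow> 2 * \<epsilon> < edge_fun e i hi / (s e i - s e j)"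
    "\<And>e i j. i < j \<Longrightarrow> j < k e \<Longrightarrow> 2 * \<epsilon> < edge_fun e j lo / (s e i - s e j)"
    using heights_exist by blast
  have "2 \<le> k True \<or> 2 \<le> k False" using k_sum card_I by linarith
  then obtain e where "2 \<le> k e" by blast
  then have ne: "tets \<noteq> {}" using fan_hi_in[of 0 e] by auto
  have "\<exists>T. triangulation_of P T \<and> card T = card tets"
    by (rule frame_triangulation[OF ne tets_subset tets_card4 tets_dual tets_regular[OF _ eps] tets_wall])
  then show ?thesis using card_tets by auto
qed

end

lemma sum_two_point:
  fixes f :: "'a \<Rightarrow> real" and h :: "'a \<Rightarrow> 'b::real_vector"
  assumes "finite S" "p \<in> S" "q \<in> S" "p \<noteq> q" "\<And>x. x \<in> S \<Longrightarrow> x \<noteq> p \<Longrightarrow> x \<noteq> q \<Longrightarrow> f x = 0"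
  shows "(\<Sum>x\<in>S. f x *\<^sub>R h x) = f p *\<^sub>R h p + f q *\<^sub>R h q"
proof -
  have "(\<Sum>x\<in>S. f x *\<^sub>R h x) = (\<Sum>x\<in>{p, q}. f x *\<^sub>R h x)"
    using assms by (intro sum.mono_neutral_right) auto
  then show ?thesis using assms(4) by simp
qed

text \<open>From a zero in the interior a step against the gradient would make the function
  negative; the point y rules out that the function is zero throughout.\<close>

lemma affine_pos_interior:
  fixes K :: "'a::euclidean_space set"
  assumes "\<And>x. x \<in> K \<Longrightarrow> 0 \<le> \<kappa> + d \<bullet> x" "y \<in> K" "\<kappa> + d \<bullet> y \<noteq> 0" "x \<in> interior K"
  shows "0 < \<kappa> + d \<bullet> x"
proof (rule ccontr)
  assume "\<not> 0 < \<kappa> + d \<bullet> x"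
  then have z: "\<kappa> + d \<bullet> x = 0" using assms(1,4) interior_subset by (metis in_mono less_le)
  have d: "d \<noteq> 0" using z assms(3) by auto
  obtain e where e: "0 < e" "cball x e \<subseteq> K" using assms(4) by (meson mem_interior_cball)
  define x' where "x' = x - (e / norm d) *\<^sub>R d"
  have "x' \<in> cball x e" using d e(1) by (simp add: x'_def dist_norm)
  then have "0 \<le> \<kappa> + d \<bullet> x'" using e assms(1) by blast
  also have "\<kappa> + d \<bullet> x' = - (e / norm d) * (d \<bullet> d)"
    using z by (simp add: x'_def inner_diff_right)
  also have "\<dots> < 0" using d e(1) by (simp add: mult_pos_pos)
  finally show False by simp
qed

context prism_frame
begin

section \<open>The upper bound\<close>

text \<open>Fixes one affine function on space for each \<open>prism_affine\<close> function, so
  that its gradient can be used to form the directions \<open>dir\<close>.\<close>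

definition realizer :: "('i \<times> bool \<Rightarrow> real) \<Rightarrow> real \<times> (real^3)" where
  "realizer g = (SOME p. \<forall>q\<in>J. fst p + snd p \<bullet> pt q = l (fst q) * g q)"

abbreviation grad :: "('i \<times> bool \<Rightarrow> real) \<Rightarrow> real^3" where "grad g \<equiv> snd (realizer g)"
abbreviation offset :: "('i \<times> bool \<Rightarrow> real) \<Rightarrow> real" where "offset g \<equiv> fst (realizer g)"

definition af :: "('i \<times> bool \<Rightarrow> real) \<Rightarrow> real^3 \<Rightarrow> real" where
  "af g x = offset g + grad g \<bullet> x"

lemma af_pt:
  assumes "prism_affine g" "q \<in> J"
  shows "af g (pt q) = l (fst q) * g q"
proof -
  obtain \<kappa> d where "\<forall>q\<in>J. \<kappa> + d \<bullet> pt q = l (fst q) * g q"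
    by (rule prism_affine_realize[OF assms(1)])
  then have "\<exists>p. \<forall>q\<in>J. fst p + snd p \<bullet> pt q = l (fst q) * g q" by (intro exI[of _ "(\<kappa>, d)"]) simp
  from someI_ex[OF this] show ?thesis using assms(2) unfolding realizer_def af_def by blast
qed

lemma af_shift: "af g (x + r *\<^sub>R d) = af g x + r * (grad g \<bullet> d)"
  by (simp add: af_def inner_add_right)

lemma af_comb: "af g ((1 - r) *\<^sub>R x + r *\<^sub>R y) = (1 - r) * af g x + r * af g y"
  by (simp add: af_def inner_add_right algebra_simps)

lemma pt_in_P: "q \<in> J \<Longrightarrow> pt q \<in> P"
  unfolding P_pt by (simp add: hull_inc)

lemma af_nonneg:
  assumes "prism_affine g" "\<And>q. q \<in> J \<Longrightarrow> 0 \<le> g q" "x \<in> P"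
  shows "0 \<le> af g x"
proof -
  have "pt ` J \<subseteq> {x. - grad g \<bullet> x \<le> offset g}"
  proof safe
    fix q assume q: "q \<in> J"
    have "0 \<le> l (fst q) * g q" using assms(2)[OF q] l_fst_pos[OF q] by simp
    then show "- grad g \<bullet> pt q \<le> offset g" using af_pt[OF assms(1) q] by (simp add: af_def)
  qed
  then have "P \<subseteq> {x. - grad g \<bullet> x \<le> offset g}"
    unfolding P_pt by (rule hull_minimal) (rule convex_halfspace_le)
  then show ?thesis using assms(3) by (auto simp: af_def)
qed

lemma af_pos_interior:
  assumes "prism_affine g" "\<And>q. q \<in> J \<Longrightarrow> 0 \<le> g q" "q \<in> J" "g q \<noteq> 0" "x \<in> interior P"
  shows "0 < af g x"
proof -
  have "offset g + grad g \<bullet> pt q \<noteq> 0"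
    using af_pt[OF assms(1,3)] assms(4) l_fst_pos[OF assms(3)] by (simp add: af_def)
  then show ?thesis
    using affine_pos_interior[of P "offset g" "grad g" "pt q" x] af_nonneg[OF assms(1,2)] pt_in_P assms
    unfolding af_def by blast
qed

lemma af_neg_interior:
  assumes "prism_affine g" "\<And>q. q \<in> J \<Longrightarrow> g q \<le> 0" "q \<in> J" "g q \<noteq> 0" "x \<in> interior P"
  shows "af g x < 0"
proof -
  have "pt ` J \<subseteq> {x. grad g \<bullet> x \<le> - offset g}"
  proof safe
    fix q assume q: "q \<in> J"
    have "l (fst q) * g q \<le> 0" using assms(2)[OF q] l_fst_pos[OF q] by (simp add: mult_le_0_iff)
    then show "grad g \<bullet> pt q \<le> - offset g" using af_pt[OF assms(1) q] by (simp add: af_def)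
  qed
  then have "P \<subseteq> {x. grad g \<bullet> x \<le> - offset g}"
    unfolding P_pt by (rule hull_minimal) (rule convex_halfspace_le)
  then have 1: "0 \<le> - offset g + - grad g \<bullet> x" if "x \<in> P" for x using that by auto
  have "- offset g + - grad g \<bullet> pt q = - (l (fst q) * g q)"
    using af_pt[OF assms(1,3)] by (simp add: af_def)
  then have "- offset g + - grad g \<bullet> pt q \<noteq> 0"
    using assms(4) l_fst_pos[OF assms(3)] by simp
  then show ?thesis
    using affine_pos_interior[OF 1 pt_in_P[OF assms(3)] _ assms(5)] unfolding af_def by simp
qed

section \<open>Tetrahedra spanned by vertices of the prism\<close>

definition tet :: "('i \<times> bool) set \<Rightarrow> bool" where
  "tet S \<longleftrightarrow> S \<subseteq> J \<and> card S = 4 \<and> \<not> affine_dependent (pt ` S)"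

lemma tet_hull_UNIV:
  assumes "tet S"
  shows "affine hull (pt ` S) = UNIV"
proof -
  have "card (pt ` S) = 4"
    using assms inj_pt card_image inj_on_subset unfolding tet_def by metis
  then have "aff_dim (pt ` S) = 3"
    using affine_independent_iff_card[of "pt ` S"] assms unfolding tet_def by auto
  then show ?thesis using aff_dim_eq_full[of "pt ` S"] by simp
qed

lemma tet_finite: "tet S \<Longrightarrow> finite S"
  using finite_J finite_subset unfolding tet_def by blast

lemma tet_interior:
  assumes "tet S"
  shows "interior (convex hull (pt ` S)) = rel_interior (convex hull (pt ` S))"
  using rel_interior_interior[of "convex hull (pt ` S)"] tet_hull_UNIV[OF assms] by simp

text \<open>The vertices of a tetrahedron affinely span space. This is how four vertices on a common
  plane are recognized as not forming a tetrahedron.\<close>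

lemma tet_zero:
  assumes "tet S" "prism_affine g" "\<And>q. q \<in> S \<Longrightarrow> g q = 0" "q \<in> J"
  shows "g q = 0"
proof -
  have "pt ` S \<subseteq> {x. grad g \<bullet> x = - offset g}"
  proof safe
    fix q assume q: "q \<in> S"
    then have "q \<in> J" using assms(1) by (auto simp: tet_def)
    then have "af g (pt q) = 0" using af_pt[OF assms(2), of q] assms(3)[OF q] by simp
    then show "grad g \<bullet> pt q = - offset g" by (simp add: af_def)
  qed
  then have "affine hull (pt ` S) \<subseteq> {x. grad g \<bullet> x = - offset g}"
    by (rule hull_minimal) (rule affine_hyperplane)
  then have "grad g \<bullet> pt q = - offset g" using tet_hull_UNIV[OF assms(1)] by auto
  then have "l (fst q) * g q = 0" using af_pt[OF assms(2,4)] by (simp add: af_def)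
  then show ?thesis using l_fst_pos[OF assms(4)] by simp
qed

lemma positive_weights_interior:
  assumes S: "tet S" and u: "\<And>q. q \<in> S \<Longrightarrow> 0 < u q" "sum u S = 1"
  shows "(\<Sum>q\<in>S. u q *\<^sub>R pt q) \<in> interior (convex hull (pt ` S))"
proof -
  have inj: "inj_on pt S" using S inj_pt inj_on_subset unfolding tet_def by blast
  define u' where "u' = u \<circ> the_inv_into S pt"
  have u': "u' (pt q) = u q" if "q \<in> S" for q
    unfolding u'_def using the_inv_into_f_f[OF inj that] by simp
  have "\<forall>x\<in>pt ` S. 0 < u' x" using u u' by auto
  moreover have "sum u' (pt ` S) = 1" using u(2) u' by (simp add: sum.reindex[OF inj])
  moreover have "(\<Sum>x\<in>pt ` S. u' x *\<^sub>R x) = (\<Sum>q\<in>S. u q *\<^sub>R pt q)"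
    using u' by (simp add: sum.reindex[OF inj])
  ultimately show ?thesis
    unfolding tet_interior[OF S] using rel_interior_convex_hull_explicit[of "pt ` S"] S
    unfolding tet_def by blast
qed

lemma proper_face_not_interior:
  assumes S: "tet S" and R: "R \<subset> S" and x: "x \<in> convex hull (pt ` R)"
  shows "x \<notin> interior (convex hull (pt ` S))"
proof
  assume "x \<in> interior (convex hull (pt ` S))"
  then have xi: "x \<in> rel_interior (convex hull (pt ` S))" using tet_interior[OF S] by simp
  have face: "convex hull (pt ` R) face_of convex hull (pt ` S)"
    using face_of_convex_hull_affine_independent[of "pt ` S"] S R unfolding tet_def by blast
  have indep: "\<not> affine_dependent (pt ` S)" using S by (simp add: tet_def)
  have "convex hull (pt ` R) \<noteq> convex hull (pt ` S)"
  proof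
    assume eq: "convex hull (pt ` R) = convex hull (pt ` S)"
    have indepR: "\<not> affine_dependent (pt ` R)"
      using affine_independent_subset[OF indep, of "pt ` R"] R by blast
    have "pt ` R = {v. v extreme_point_of convex hull (pt ` R)}"
      by (simp add: extreme_point_of_convex_hull_affine_independent[OF indepR])
    also have "\<dots> = pt ` S"
      by (simp add: eq extreme_point_of_convex_hull_affine_independent[OF indep])
    finally have "pt ` R = pt ` S" .
    then have "R = S" using inj_on_image_eq_iff[OF inj_pt, of R S] R S unfolding tet_def by blast
    then show False using R by simp
  qed
  then show False using face_of_disjoint_rel_interior[OF face] xi x by blast
qed

text \<open>Lines inside the slices: on the slice where \<open>lev \<mu>\<close> vanishes, \<open>dir \<mu> \<xi>\<close> is the direction of
  the line \<open>X = \<xi>\<close> (in projective coordinates).\<close>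

definition lev :: "real \<Rightarrow> 'i \<times> bool \<Rightarrow> real" where "lev \<mu> = (\<lambda>q. \<mu> + (if snd q then 1 else 0))"

definition abscissa :: "real \<Rightarrow> 'i \<times> bool \<Rightarrow> real" where "abscissa \<xi> = (\<lambda>q. X (fst q) - \<xi>)"

definition dir :: "real \<Rightarrow> real \<Rightarrow> real^3" where "dir \<mu> \<xi> = cross3 (grad (lev \<mu>)) (grad (abscissa \<xi>))"

lemma prism_affine_lev: "prism_affine (lev \<mu>)"
  unfolding lev_def by (intro prism_affine_intros)

lemma prism_affine_abscissa: "prism_affine (abscissa \<xi>)"
  unfolding abscissa_def by (intro prism_affine_intros)

lemma dir_orthogonal: "grad (lev \<mu>) \<bullet> dir \<mu> \<xi> = 0" "grad (abscissa \<xi>) \<bullet> dir \<mu> \<xi> = 0"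
  by (simp_all add: dir_def dot_cross_self)

text \<open>With dependent gradients the common zero p would make the function of
  \<open>abscissa \<xi>\<close> proportional to that of \<open>lev \<mu>\<close>. Comparing the two
  ends of a side edge shows that the factor is 0, and then \<open>X\<close> would be
  constant.\<close>

lemma dir_nonzero:
  assumes "af (lev \<mu>) p = 0" "af (abscissa \<xi>) p = 0"
  shows "dir \<mu> \<xi> \<noteq> 0"
proof
  assume "dir \<mu> \<xi> = 0"
  then have "collinear {0, grad (lev \<mu>), grad (abscissa \<xi>)}" by (simp add: dir_def cross_eq_0)
  moreover have "grad (lev \<mu>) \<noteq> 0"
  proof
    assume "grad (lev \<mu>) = 0"
    then have "af (lev \<mu>) (pt (lo, True)) = af (lev \<mu>) (pt (lo, False))" by (simp add: af_def)
    then show False using af_pt[OF prism_affine_lev] l_pos[OF lo] lo by (simp add: J_def lev_def)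
  qed
  ultimately obtain r where r: "grad (abscissa \<xi>) = r *\<^sub>R grad (lev \<mu>)"
    unfolding collinear_lemma by (metis scaleR_zero_left)
  have "grad (abscissa \<xi>) \<bullet> p = r * (grad (lev \<mu>) \<bullet> p)" by (simp add: r)
  moreover have "offset (lev \<mu>) = - (grad (lev \<mu>) \<bullet> p)"
    and "offset (abscissa \<xi>) = - (grad (abscissa \<xi>) \<bullet> p)"
    using assms unfolding af_def by linarith+
  ultimately have "offset (abscissa \<xi>) = r * offset (lev \<mu>)" by simp
  then have eq: "af (abscissa \<xi>) x = r * af (lev \<mu>) x" for x
    using r by (simp add: af_def algebra_simps)
  have "X v = \<xi>" if v: "v \<in> I" for v
  proof -
    have "l v * (X v - \<xi>) = r * (l v * \<mu>)" "l v * (X v - \<xi>) = r * (l v * (\<mu> + 1))"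
      using eq[of "pt (v, False)"] eq[of "pt (v, True)"] v
      by (simp_all add: af_pt prism_affine_lev prism_affine_abscissa J_def)
        (simp_all add: lev_def abscissa_def)
    then have "r = 0" "l v * (X v - \<xi>) = 0" using l_pos[OF v] by (auto simp: algebra_simps)
    then show ?thesis using l_pos[OF v] by simp
  qed
  then show False using lo hi lo_less_hi by (metis less_irrefl)
qed

text \<open>A vector orthogonal to two independent gradients is parallel to their cross product, by
  the Lagrange identity.\<close>

lemma slice_line:
  assumes "af (lev \<mu>) p = 0" "af (abscissa \<xi>) p = 0" "af (lev \<mu>) x = 0" "af (abscissa \<xi>) x = 0"
  obtains r where "x = p + r *\<^sub>R dir \<mu> \<xi>"
proof -
  define y where "y = x - p"
  have "grad (lev \<mu>) \<bullet> y = 0" "grad (abscissa \<xi>) \<bullet> y = 0"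
    using assms by (simp_all add: y_def af_def inner_diff_right)
  then have "cross3 y (dir \<mu> \<xi>) = 0" unfolding dir_def Lagrange by (simp add: inner_commute)
  then have "collinear {0, dir \<mu> \<xi>, y}" unfolding cross_eq_0 by (simp add: insert_commute)
  then obtain r where "y = r *\<^sub>R dir \<mu> \<xi>"
    unfolding collinear_lemma using dir_nonzero[OF assms(1,2)] by (metis scaleR_zero_left)
  then show thesis using that[of r] by (simp add: y_def algebra_simps)
qed

text \<open>The diagonals \<open>a\<^sub>i b\<^sub>j\<close> and \<open>a\<^sub>j b\<^sub>i\<close> meet the slice \<open>lev (- (1 / 2)) = 0\<close> in the same point.\<close>

definition wt :: "'i \<Rightarrow> 'i \<Rightarrow> 'i \<times> bool \<Rightarrow> real" where
  "wt i j q = (if q = (i, False) then l j / (l i + l j) else if q = (j, True) then l i / (l i + l j) else 0)"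

definition mid :: "'i \<Rightarrow> 'i \<Rightarrow> real^3" where
  "mid i j = (l j / (l i + l j)) *\<^sub>R pt (i, False) + (l i / (l i + l j)) *\<^sub>R pt (j, True)"

lemma wt_nonneg: "i \<in> I \<Longrightarrow> j \<in> I \<Longrightarrow> 0 \<le> wt i j q"
  using l_pos[of i] l_pos[of j] by (auto simp: wt_def)

lemma wt_pos: "i \<in> I \<Longrightarrow> j \<in> I \<Longrightarrow> 0 < wt i j (i, False)" "i \<in> I \<Longrightarrow> j \<in> I \<Longrightarrow> 0 < wt i j (j, True)"
  using l_pos[of i] l_pos[of j] by (auto simp: wt_def)

lemma wt_sum:
  assumes "finite S" "(i, False) \<in> S" "(j, True) \<in> S" "i \<in> I" "j \<in> I"
  shows "sum (wt i j) S = 1" "(\<Sum>q\<in>S. wt i j q *\<^sub>R pt q) = mid i j"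
proof -
  have "l i + l j \<noteq> 0" using l_pos[of i] l_pos[of j] assms by auto
  have "(\<Sum>q\<in>S. wt i j q *\<^sub>R h q) = wt i j (i, False) *\<^sub>R h (i, False) + wt i j (j, True) *\<^sub>R h (j, True)"
    for h :: "_ \<Rightarrow> 'z::real_vector"
    using assms by (intro sum_two_point) (auto simp: wt_def)
  from this[of "\<lambda>_. 1::real"] this[of pt] show "sum (wt i j) S = 1" "(\<Sum>q\<in>S. wt i j q *\<^sub>R pt q) = mid i j"
    using \<open>l i + l j \<noteq> 0\<close> by (simp_all add: wt_def mid_def add_divide_distrib[symmetric] add.commute)
qed

text \<open>For i different from j the four points form a trapezoid with parallel sides of lengths
  \<open>l i\<close> and \<open>l j\<close>, whose diagonals divide each other in this ratio. Up to
  the denominator both sides are \<open>l j * a i + l i * a j + l i * l j * w\<close>.\<close>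

lemma mid_commute: "i \<in> I \<Longrightarrow> j \<in> I \<Longrightarrow> mid i j = mid j i"
  by (simp add: mid_def pt_def b_eq scaleR_add_right add.commute[of "l j"] algebra_simps)

lemma mid_eq: "i \<in> I \<Longrightarrow> j \<in> I \<Longrightarrow>
    mid i j = (1 - l i / (l i + l j)) *\<^sub>R pt (i, False) + (l i / (l i + l j)) *\<^sub>R pt (j, True)"
  using l_pos[of i] l_pos[of j] by (simp add: mid_def field_simps)

lemma af_mid:
  assumes "i \<in> I" "j \<in> I" "prism_affine g"
  shows "af g (mid i j) = l i * l j / (l i + l j) * (g (i, False) + g (j, True))"
proof -
  have "l i + l j \<noteq> 0" using l_pos[of i] l_pos[of j] assms by auto
  then have r: "1 - l i / (l i + l j) = l j / (l i + l j)" by (simp add: field_simps)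
  show ?thesis
    unfolding mid_eq[OF assms(1,2)] af_comb unfolding r using assms
    by (simp add: af_pt J_def algebra_simps add_divide_distrib)
qed

lemma af_lev_mid: "i \<in> I \<Longrightarrow> j \<in> I \<Longrightarrow> af (lev (- (1 / 2))) (mid i j) = 0"
  by (subst af_mid[OF _ _ prism_affine_lev]) (auto simp: lev_def)

lemma af_abscissa_mid:
  "i \<in> I \<Longrightarrow> j \<in> I \<Longrightarrow> af (abscissa \<xi>) (mid i j) = l i * l j / (l i + l j) * (X i + X j - 2 * \<xi>)"
  by (subst af_mid[OF _ _ prism_affine_abscissa]) (auto simp: abscissa_def)

definition mdir :: "'i \<Rightarrow> 'i \<Rightarrow> real^3" where "mdir i j = dir (- (1 / 2)) ((X i + X j) / 2)"

text \<open>By \<open>af_abscissa_mid\<close> the sums of \<open>X\<close> order the vertices of the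
  cell transversally, so \<open>mid i1 j1\<close> and \<open>mid i2 j2\<close> are on different
  sides of the line through \<open>mid i j\<close>. Their segment meets this line in a point x. The
  midpoint of x and \<open>mid i j\<close> has positive weight at every vertex of S and is therefore
  interior.\<close>

lemma slot_exists:
  assumes S: "tet S"
    and q: "(i, False) \<in> S" "(j, True) \<in> S" "(i1, False) \<in> S" "(j1, True) \<in> S" "(i2, False) \<in> S" "(j2, True) \<in> S"
    and X: "X i1 + X j1 < X i + X j" "X i + X j < X i2 + X j2"
    and cover: "S \<subseteq> {(i, False), (j, True), (i1, False), (j1, True), (i2, False), (j2, True)}"
  shows "\<exists>r. r \<noteq> 0 \<and> mid i j + r *\<^sub>R mdir i j \<in> interior (convex hull (pt ` S))"
proof -
  have I: "i \<in> I" "j \<in> I" "i1 \<in> I" "j1 \<in> I" "i2 \<in> I" "j2 \<in> I"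
    using S q by (auto simp: tet_def J_def)
  have fin: "finite S" by (rule tet_finite[OF S])
  define \<xi> where "\<xi> = (X i + X j) / 2"
  define p where "p = - af (abscissa \<xi>) (mid i1 j1)"
  define p' where "p' = af (abscissa \<xi>) (mid i2 j2)"
  have "0 < l i1 * l j1 / (l i1 + l j1) * (2 * \<xi> - (X i1 + X j1))"
    using X I l_pos by (intro mult_pos_pos divide_pos_pos add_pos_pos) (auto simp: \<xi>_def)
  then have p: "0 < p"
    unfolding p_def af_abscissa_mid[OF I(3,4)] minus_mult_right minus_diff_eq .
  have "0 < l i2 * l j2 / (l i2 + l j2) * (X i2 + X j2 - 2 * \<xi>)"
    using X I l_pos by (intro mult_pos_pos divide_pos_pos add_pos_pos) (auto simp: \<xi>_def)
  then have p': "0 < p'" unfolding p'_def af_abscissa_mid[OF I(5,6)] .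
  \<comment> \<open>The abscissa function has the values -p and p' at the two ends of the segment;
    this \<theta> is the parameter of its zero.\<close>
  define \<theta> where "\<theta> = p / (p + p')"
  have th: "0 < \<theta>" "\<theta> < 1" using p p' by (simp_all add: \<theta>_def)
  define x where "x = (1 - \<theta>) *\<^sub>R mid i1 j1 + \<theta> *\<^sub>R mid i2 j2"
  have "af (abscissa \<xi>) x = (1 - \<theta>) * (- p) + \<theta> * p'"
    unfolding x_def af_comb by (simp add: p_def p'_def)
  also have "\<dots> = 0" using p p' by (simp add: \<theta>_def field_simps)
  finally have x0: "af (abscissa \<xi>) x = 0" .
  have xl: "af (lev (- (1 / 2))) x = 0" unfolding x_def af_comb using I by (simp add: af_lev_mid)
  have m0: "af (abscissa \<xi>) (mid i j) = 0" using I by (simp add: af_abscissa_mid \<xi>_def)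
  obtain r where r: "x = mid i j + r *\<^sub>R dir (- (1 / 2)) \<xi>"
    using slice_line[OF af_lev_mid[OF I(1,2)] m0 xl x0] .
  define \<alpha> \<beta> \<gamma> where "\<alpha> = (1::real) / 2" and "\<beta> = (1 - \<theta>) / 2" and "\<gamma> = \<theta> / 2"
  note coeffs = this
  have pos: "0 < \<alpha>" "0 < \<beta>" "0 < \<gamma>" "\<alpha> + \<beta> + \<gamma> = 1" using th by (simp_all add: coeffs field_simps)
  define u where "u q = \<alpha> * wt i j q + \<beta> * wt i1 j1 q + \<gamma> * wt i2 j2 q" for q
  have upos: "0 < u q'" if "q' \<in> S" for q'
  proof -
    have nn: "0 \<le> \<alpha> * wt i j q'" "0 \<le> \<beta> * wt i1 j1 q'" "0 \<le> \<gamma> * wt i2 j2 q'"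
      using I pos by (auto intro!: mult_nonneg_nonneg wt_nonneg)
    have "0 < wt i j q' \<or> 0 < wt i1 j1 q' \<or> 0 < wt i2 j2 q'"
      using cover that I wt_pos[of i j] wt_pos[of i1 j1] wt_pos[of i2 j2] by auto
    then have "0 < \<alpha> * wt i j q' \<or> 0 < \<beta> * wt i1 j1 q' \<or> 0 < \<gamma> * wt i2 j2 q'"
      using pos by (metis mult_pos_pos)
    then show ?thesis unfolding u_def using nn by auto
  qed
  have usum: "sum u S = 1"
  proof -
    have "sum u S = \<alpha> * sum (wt i j) S + \<beta> * sum (wt i1 j1) S + \<gamma> * sum (wt i2 j2) S"
      by (simp add: u_def sum.distrib sum_distrib_left)
    then show ?thesis using pos(4)
        wt_sum(1)[OF fin q(1,2) I(1,2)] wt_sum(1)[OF fin q(3,4) I(3,4)] wt_sum(1)[OF fin q(5,6) I(5,6)]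
      by simp
  qed
  have "(\<Sum>q\<in>S. u q *\<^sub>R pt q) = \<alpha> *\<^sub>R (\<Sum>q\<in>S. wt i j q *\<^sub>R pt q)
      + \<beta> *\<^sub>R (\<Sum>q\<in>S. wt i1 j1 q *\<^sub>R pt q) + \<gamma> *\<^sub>R (\<Sum>q\<in>S. wt i2 j2 q *\<^sub>R pt q)"
    by (simp add: u_def scaleR_add_left sum.distrib scaleR_sum_right)
  also have "\<dots> = (1 / 2) *\<^sub>R mid i j + (1 / 2) *\<^sub>R x"
    using wt_sum(2)[OF fin q(1,2) I(1,2)] wt_sum(2)[OF fin q(3,4) I(3,4)] wt_sum(2)[OF fin q(5,6) I(5,6)]
    by (simp add: x_def coeffs scaleR_add_right)
  also have "\<dots> = mid i j + (r / 2) *\<^sub>R mdir i j"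
    unfolding r mdir_def \<xi>_def by (simp add: scaleR_add_right scaleR_add_left[symmetric])
  finally have int: "mid i j + (r / 2) *\<^sub>R mdir i j \<in> interior (convex hull (pt ` S))"
    using positive_weights_interior[OF S upos usum] by simp
  have "r \<noteq> 0"
  proof
    assume "r = 0"
    then have "mid i j \<in> interior (convex hull (pt ` S))" using int by simp
    moreover have "{(i, False), (j, True)} \<subset> S"
    proof -
      have "card {(i, False), (j, True)} < card S" using S by (simp add: tet_def)
      then show ?thesis using q by auto
    qed
    moreover have "mid i j \<in> convex hull (pt ` {(i, False), (j, True)})"
      using l_pos[of i] l_pos[of j] I unfolding mid_eq[OF I(1,2)]
      by (intro convexD_alt[OF convex_convex_hull]) (auto intro: hull_inc)
    ultimately show False using proper_face_not_interior[OF S] by blast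
  qed
  then show ?thesis using int by (intro exI[of _ "r / 2"]) simp
qed

end

lemma ray_interior:
  fixes K :: "'a::euclidean_space set"
  assumes "convex K" "x \<in> K" "x + r *\<^sub>R d \<in> interior K" "0 < \<rho>" "\<rho> \<le> r"
  shows "x + \<rho> *\<^sub>R d \<in> interior K"
proof -
  have "x - (\<rho> / r) *\<^sub>R (x - (x + r *\<^sub>R d)) \<in> interior K"
    using assms by (intro mem_interior_convex_shrink) auto
  then show ?thesis using assms by simp
qed

lemma extreme_point_not_between:
  assumes "x extreme_point_of K" "x + r *\<^sub>R d \<in> K" "x + r' *\<^sub>R d \<in> K" "d \<noteq> 0" "r * r' < 0"
  shows False
proof -
  define u where "u = r / (r - r')"
  have rr: "r \<noteq> r'" using assms(5) by (metis not_square_less_zero)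
  have u: "0 < u" "u < 1"
    using assms(5) unfolding u_def mult_less_0_iff by (auto simp: field_simps)
  have "(1 - u) * r + u * r' = 0" using rr by (simp add: u_def field_simps)
  then have "x = (1 - u) *\<^sub>R (x + r *\<^sub>R d) + u *\<^sub>R (x + r' *\<^sub>R d)"
    by (simp add: scaleR_add_right scaleR_left_diff_distrib flip: scaleR_add_left)
  moreover have "x + r *\<^sub>R d \<noteq> x + r' *\<^sub>R d" using rr assms(4) by simp
  ultimately have "x \<in> open_segment (x + r *\<^sub>R d) (x + r' *\<^sub>R d)"
    using u unfolding in_segment by blast
  then show False using assms(1-3) unfolding extreme_point_of_def by blast
qed

context prism_frame
begin

section \<open>Slots: the sides of slice vertices that a tetrahedron uses\<close>

definition verts :: "(real^3) set \<Rightarrow> ('i \<times> bool) set" where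
  "verts \<tau> = {q \<in> J. pt q extreme_point_of \<tau>}"

definition level :: "bool \<Rightarrow> (real^3) set \<Rightarrow> 'i set" where
  "level z \<tau> = {v. (v, z) \<in> verts \<tau>}"

lemma triangulation_tet:
  assumes "triangulation_of P T" "\<tau> \<in> T"
  shows "tet (verts \<tau>)" "\<tau> = convex hull (pt ` verts \<tau>)"
proof -
  have "3 simplex \<tau>" and ext: "{v. v extreme_point_of \<tau>} \<subseteq> {v. v extreme_point_of P}"
    using assms unfolding triangulation_of_def by auto
  then obtain C where C: "\<not> affine_dependent C" "int (card C) = 3 + 1" "\<tau> = convex hull C"
    unfolding simplex_def by blast
  have extC: "{v. v extreme_point_of \<tau>} = C"
    unfolding C(3) using extreme_point_of_convex_hull_affine_independent[OF C(1)] by blast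
  then have "C \<subseteq> pt ` J" using ext ext_P pt_image by simp
  then have ptv: "pt ` verts \<tau> = C" using extC unfolding verts_def by auto
  have "verts \<tau> \<subseteq> J" by (auto simp: verts_def)
  moreover from this have "card (verts \<tau>) = card C"
    using ptv card_image inj_on_subset[OF inj_pt] by metis
  ultimately show "tet (verts \<tau>)" "\<tau> = convex hull (pt ` verts \<tau>)"
    using C ptv by (auto simp: tet_def)
qed

lemma verts_levels: "verts \<tau> = (\<lambda>v. (v, False)) ` level False \<tau> \<union> (\<lambda>v. (v, True)) ` level True \<tau>"
  by (auto simp: level_def image_iff) (metis (full_types))

lemma level_subset: "level z \<tau> \<subseteq> I"
  by (auto simp: level_def verts_def J_def)

lemma finite_level: "finite (level z \<tau>)"
  using level_subset finite_I finite_subset by blast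

lemma card_levels: "card (verts \<tau>) = card (level False \<tau>) + card (level True \<tau>)"
proof -
  have "card ((\<lambda>v. (v, z)) ` level z \<tau>) = card (level z \<tau>)" for z
    by (rule card_image) (simp add: inj_on_def)
  then show ?thesis
    unfolding verts_levels using finite_level by (subst card_Un_disjoint) auto
qed

lemma level_nonempty:
  assumes "tet (verts \<tau>)"
  shows "level z \<tau> \<noteq> {}"
proof
  assume empty: "level z \<tau> = {}"
  have *: "snd q \<noteq> z" if "q \<in> verts \<tau>" for q
  proof
    assume "snd q = z"
    then have "(fst q, z) \<in> verts \<tau>" using that by (simp flip: \<open>snd q = z\<close>)
    then show False using empty by (auto simp: level_def)
  qed
  define \<mu> where "\<mu> = (if z then 0 else - 1::real)"
  have "lev \<mu> q = 0" if "q \<in> verts \<tau>" for q using *[OF that] by (auto simp: lev_def \<mu>_def)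
  then have "lev \<mu> (lo, z) = 0"
    using tet_zero[OF assms prism_affine_lev] lo by (auto simp: J_def)
  then show False by (auto simp: lev_def \<mu>_def split: if_splits)
qed

lemma three_sorted:
  assumes "A \<subseteq> I" "card A = 3"
  obtains i j h where "A = {i, j, h}" "X i < X j" "X j < X h"
proof -
  obtain x y z where A: "A = {x, y, z}" "x \<noteq> y" "y \<noteq> z" "x \<noteq> z"
    using assms(2) by (auto simp: card_3_iff)
  then have ne: "X x \<noteq> X y" "X y \<noteq> X z" "X x \<noteq> X z" using X_eq_iff assms(1) by auto
  then consider "X x < X y" "X y < X z" | "X x < X z" "X z < X y" | "X y < X x" "X x < X z"
    | "X y < X z" "X z < X x" | "X z < X x" "X x < X y" | "X z < X y" "X y < X x" by linarith
  then show thesis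
  proof cases
    case 1 then show thesis using that[of x y z] A(1) by auto
  next
    case 2 then show thesis using that[of x z y] A(1) by auto
  next
    case 3 then show thesis using that[of y x z] A(1) by auto
  next
    case 4 then show thesis using that[of y z x] A(1) by auto
  next
    case 5 then show thesis using that[of z x y] A(1) by auto
  next
    case 6 then show thesis using that[of z y x] A(1) by auto
  qed
qed

lemma two_sorted:
  assumes "A \<subseteq> I" "card A = 2"
  obtains i j where "A = {i, j}" "X i < X j"
proof -
  obtain x y where A: "A = {x, y}" "x \<noteq> y" using assms(2) by (auto simp: card_2_iff)
  then have "X x \<noteq> X y" using X_eq_iff assms(1) by auto
  then consider "X x < X y" | "X y < X x" by linarith
  then show thesis
  proof cases
    case 1 then show thesis using that[of x y] A(1) by auto
  next
    case 2 then show thesis using that[of y x] A(1) by auto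
  qed
qed

text \<open>A slot is a vertex \<open>mid i j\<close> of the cell of \<tau> in the middle slice,
  together with the side \<open>e\<close> on which the line of constant abscissa runs from it into
  the interior. The double count compares the slots that tetrahedra need with those
  available.\<close>

definition slots :: "(real^3) set \<Rightarrow> ('i \<times> 'i \<times> bool) set" where
  "slots \<tau> = {(i, j, e). (i, False) \<in> verts \<tau> \<and> (j, True) \<in> verts \<tau> \<and>
      (\<exists>r>0. mid i j + (sg e * r) *\<^sub>R mdir i j \<in> interior \<tau>)}"

lemma slots_subset: "slots \<tau> \<subseteq> I \<times> I \<times> UNIV"
  by (auto simp: slots_def verts_def J_def)

lemma finite_slots: "finite (slots \<tau>)"
  by (rule finite_subset[OF slots_subset]) (use finite_I in auto)

lemma slot_in:
  assumes "tet (verts \<tau>)" "\<tau> = convex hull (pt ` verts \<tau>)"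
    and q: "(i, False) \<in> verts \<tau>" "(j, True) \<in> verts \<tau>" "(i1, False) \<in> verts \<tau>" "(j1, True) \<in> verts \<tau>"
      "(i2, False) \<in> verts \<tau>" "(j2, True) \<in> verts \<tau>"
    and X: "X i1 + X j1 < X i + X j" "X i + X j < X i2 + X j2"
    and cover: "verts \<tau> \<subseteq> {(i, False), (j, True), (i1, False), (j1, True), (i2, False), (j2, True)}"
  shows "\<exists>e. (i, j, e) \<in> slots \<tau>"
proof -
  obtain r where r: "r \<noteq> 0" "mid i j + r *\<^sub>R mdir i j \<in> interior \<tau>"
    using slot_exists[OF assms(1) q X cover] assms(2) by auto
  have "sg (0 < r) * \<bar>r\<bar> = r" by (simp add: sg_def)
  then show ?thesis using r q(1,2) unfolding slots_def by (auto intro!: exI[of _ "0 < r"] exI[of _ "\<bar>r\<bar>"])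
qed

text \<open>A triangular cell has a vertex with the middle sum of \<open>X\<close>. In a quadrangle
  with i before i' and j before j', both mixed sums lie strictly between those of the pairs i, j and
  i', j', whatever their own order is, and so they give two slots.\<close>

lemma card_slots:
  assumes "tet (verts \<tau>)" "\<tau> = convex hull (pt ` verts \<tau>)"
  shows "2 \<le> card (slots \<tau>) + of_bool (card (level False \<tau>) = 3) + of_bool (card (level True \<tau>) = 3)"
proof -
  have c4: "card (level False \<tau>) + card (level True \<tau>) = 4"
    using assms(1) card_levels by (simp add: tet_def)
  have "card (level z \<tau>) \<noteq> 0" for z using level_nonempty[OF assms(1)] finite_level by simp
  from this[of True] this[of False] c4
  consider "card (level False \<tau>) = 3" "card (level True \<tau>) = 1"
    | "card (level False \<tau>) = 1" "card (level True \<tau>) = 3"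
    | "card (level False \<tau>) = 2" "card (level True \<tau>) = 2" by linarith
  then show ?thesis
  proof cases
    case 1
    obtain i j k where A: "level False \<tau> = {i, j, k}" "X i < X j" "X j < X k"
      using three_sorted[OF level_subset 1(1)] .
    obtain n where B: "level True \<tau> = {n}" using 1(2) by (auto simp: card_1_singleton_iff)
    have v: "verts \<tau> = {(i, False), (j, False), (k, False), (n, True)}"
      unfolding verts_levels A(1) B by auto
    obtain e where "(j, n, e) \<in> slots \<tau>"
      using slot_in[OF assms, of j n i n k n] A(2,3) v by auto
    then have "card (slots \<tau>) \<noteq> 0" using finite_slots by auto
    then show ?thesis using 1 by simp
  next
    case 2
    obtain i j k where B: "level True \<tau> = {i, j, k}" "X i < X j" "X j < X k"
      using three_sorted[OF level_subset 2(2)] .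
    obtain n where A: "level False \<tau> = {n}" using 2(1) by (auto simp: card_1_singleton_iff)
    have v: "verts \<tau> = {(n, False), (i, True), (j, True), (k, True)}"
      unfolding verts_levels A(1) B by auto
    obtain e where "(n, j, e) \<in> slots \<tau>"
      using slot_in[OF assms, of n j n i n k] B(2,3) v by auto
    then have "card (slots \<tau>) \<noteq> 0" using finite_slots by auto
    then show ?thesis using 2 by simp
  next
    case 3
    obtain i i' where A: "level False \<tau> = {i, i'}" "X i < X i'" using two_sorted[OF level_subset 3(1)] .
    obtain j j' where B: "level True \<tau> = {j, j'}" "X j < X j'" using two_sorted[OF level_subset 3(2)] .
    have v: "verts \<tau> = {(i, False), (i', False), (j, True), (j', True)}"
      unfolding verts_levels A(1) B by auto
    obtain e where e: "(i, j', e) \<in> slots \<tau>"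
      using slot_in[OF assms, of i j' i j i' j'] A(2) B(2) v by auto
    obtain e' where e': "(i', j, e') \<in> slots \<tau>"
      using slot_in[OF assms, of i' j i j i' j'] A(2) B(2) v by auto
    have "card {(i, j', e), (i', j, e')} \<le> card (slots \<tau>)"
      using e e' finite_slots by (intro card_mono) auto
    moreover have "i \<noteq> i'" using A(2) by auto
    ultimately show ?thesis by simp
  qed
qed

lemma mid_in: "(i, False) \<in> verts \<tau> \<Longrightarrow> (j, True) \<in> verts \<tau> \<Longrightarrow> \<tau> = convex hull (pt ` verts \<tau>) \<Longrightarrow> mid i j \<in> \<tau>"
  and mid_in_segment: "i \<in> I \<Longrightarrow> j \<in> I \<Longrightarrow> mid i j \<in> open_segment (pt (i, False)) (pt (j, True))"
proof -
  have r: "0 < l i / (l i + l j)" "l i / (l i + l j) < 1" if "i \<in> I" "j \<in> I"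
    using l_pos that by (auto simp: add_pos_pos)
  show "mid i j \<in> \<tau>" if "(i, False) \<in> verts \<tau>" "(j, True) \<in> verts \<tau>" "\<tau> = convex hull (pt ` verts \<tau>)"
  proof -
    have I: "i \<in> I" "j \<in> I" using that by (auto simp: verts_def J_def)
    have "mid i j \<in> convex hull (pt ` verts \<tau>)"
      unfolding mid_eq[OF I] using that r[OF I]
      by (intro convexD_alt[OF convex_convex_hull] hull_inc) auto
    then show ?thesis using that(3) by simp
  qed
  show "mid i j \<in> open_segment (pt (i, False)) (pt (j, True))" if I: "i \<in> I" "j \<in> I"
  proof -
    have "pt (i, False) \<noteq> pt (j, True)"
      using inj_onD[OF inj_pt, of "(i, False)" "(j, True)"] I by (auto simp: J_def)
    then show ?thesis unfolding in_segment mid_eq[OF I] using r[OF I] by blast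
  qed
qed

text \<open>Both tetrahedra are convex and contain the slice vertex, so both interiors contain a
  short initial piece of the same ray.\<close>

lemma slots_disjoint:
  assumes T: "triangulation_of P T" "\<tau> \<in> T" "\<tau>' \<in> T" "\<tau> \<noteq> \<tau>'"
  shows "slots \<tau> \<inter> slots \<tau>' = {}"
proof (rule ccontr)
  assume "slots \<tau> \<inter> slots \<tau>' \<noteq> {}"
  then obtain i j e where s: "(i, j, e) \<in> slots \<tau>" "(i, j, e) \<in> slots \<tau>'" by auto
  obtain r where r: "0 < r" "mid i j + (sg e * r) *\<^sub>R mdir i j \<in> interior \<tau>"
    using s(1) by (auto simp: slots_def)
  obtain r' where r': "0 < r'" "mid i j + (sg e * r') *\<^sub>R mdir i j \<in> interior \<tau>'"
    using s(2) by (auto simp: slots_def)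
  have m: "mid i j \<in> \<tau>" "mid i j \<in> \<tau>'"
    using s mid_in triangulation_tet[OF T(1,2)] triangulation_tet[OF T(1,3)] by (auto simp: slots_def)
  have cv: "convex \<tau>" "convex \<tau>'"
    using triangulation_tet(2)[OF T(1,2)] triangulation_tet(2)[OF T(1,3)] by (metis convex_convex_hull)+
  define \<rho> where "\<rho> = min r r'"
  have d: "mid i j + r *\<^sub>R (sg e *\<^sub>R mdir i j) \<in> interior \<tau>"
    "mid i j + r' *\<^sub>R (sg e *\<^sub>R mdir i j) \<in> interior \<tau>'"
    using r(2) r'(2) by (simp_all add: mult.commute)
  have "mid i j + \<rho> *\<^sub>R (sg e *\<^sub>R mdir i j) \<in> interior \<tau>"
    by (rule ray_interior[OF cv(1) m(1) d(1)]) (use r(1) r'(1) in \<open>auto simp: \<rho>_def\<close>)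
  moreover have "mid i j + \<rho> *\<^sub>R (sg e *\<^sub>R mdir i j) \<in> interior \<tau>'"
    by (rule ray_interior[OF cv(2) m(2) d(2)]) (use r(1) r'(1) in \<open>auto simp: \<rho>_def\<close>)
  ultimately show False using T unfolding triangulation_of_def by blast
qed

section \<open>Slots available to a triangulation\<close>

definition diagonals :: "(real^3) set set \<Rightarrow> ('i \<times> 'i) set" where
  "diagonals T = {(i, j). \<exists>\<tau>\<in>T. (i, False) \<in> verts \<tau> \<and> (j, True) \<in> verts \<tau>}"

text \<open>The crossing point lies in both tetrahedra, and the face condition then puts the whole
  edge from \<open>a i\<close> to \<open>b j\<close> into \<tau>'. So \<tau>' has the four vertices
  over i and j. On these \<open>turn i j\<close> vanishes, but not over a third vertex of the
  polygon.\<close>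

lemma diagonals_not_crossing:
  assumes T: "triangulation_of P T" and d: "(i, j) \<in> diagonals T" "(j, i) \<in> diagonals T"
  shows "i = j"
proof (rule ccontr)
  assume ne: "i \<noteq> j"
  obtain \<tau> where t: "\<tau> \<in> T" "(i, False) \<in> verts \<tau>" "(j, True) \<in> verts \<tau>" using d by (auto simp: diagonals_def)
  obtain \<tau>' where t': "\<tau>' \<in> T" "(j, False) \<in> verts \<tau>'" "(i, True) \<in> verts \<tau>'"
    using d by (auto simp: diagonals_def)
  have I: "i \<in> I" "j \<in> I" and J: "(i, False) \<in> J" "(j, True) \<in> J" using t by (auto simp: verts_def J_def)
  note tt = triangulation_tet[OF T t(1)] and tt' = triangulation_tet[OF T t'(1)]
  have m: "mid i j \<in> \<tau> \<inter> \<tau>'"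
    using mid_in[OF t(2,3) tt(2)] mid_in[OF t'(2,3) tt'(2)] mid_commute[OF I] by simp
  have "\<forall>A B. A \<in> T \<and> B \<in> T \<longrightarrow> A \<inter> B face_of A"
    using T unfolding triangulation_of_def triangulation_def by (elim conjE)
  then have "\<tau> \<inter> \<tau>' face_of \<tau>" using t(1) t'(1) by simp
  moreover have "pt (i, False) extreme_point_of \<tau>" "pt (j, True) extreme_point_of \<tau>"
    using t(2,3) by (simp_all add: verts_def)
  then have "pt (i, False) \<in> \<tau>" "pt (j, True) \<in> \<tau>"
    by (simp_all add: extreme_point_of_def)
  ultimately have "pt (i, False) \<in> \<tau> \<inter> \<tau>'" "pt (j, True) \<in> \<tau> \<inter> \<tau>'"
    using face_ofD[OF _ mid_in_segment[OF I] _ _ m] by simp_all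
  then have "pt (i, False) \<in> \<tau>'" "pt (j, True) \<in> \<tau>'" by simp_all
  moreover have "\<tau>' \<subseteq> P" using T t'(1) unfolding triangulation_of_def by blast
  moreover have "pt (i, False) extreme_point_of P" "pt (j, True) extreme_point_of P"
    using imageI[OF J(1), of pt] imageI[OF J(2), of pt] unfolding pt_image ext_P[symmetric] by simp_all
  moreover have "x extreme_point_of \<tau>'" if "x extreme_point_of P" "x \<in> \<tau>'" "\<tau>' \<subseteq> P" for x
    using that unfolding extreme_point_of_def by blast
  ultimately have "(i, False) \<in> verts \<tau>'" "(j, True) \<in> verts \<tau>'"
    using J unfolding verts_def by simp_all
  then have "{(i, False), (j, True), (j, False), (i, True)} \<subseteq> verts \<tau>'" using t' by auto
  moreover have "card {(i, False), (j, True), (j, False), (i, True)} = 4" using ne by simp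
  moreover have "card (verts \<tau>') = 4" using tt'(1) by (simp add: tet_def)
  ultimately have v: "verts \<tau>' = {(i, False), (j, True), (j, False), (i, True)}"
    using card_subset_eq[of "verts \<tau>'"] tet_finite[OF tt'(1)] by metis
  have "card {i, j} < card I" using card_I ne by simp
  then obtain k where k: "k \<in> I" "k \<noteq> i" "k \<noteq> j"
    using card_mono[of "{i, j}" I] by (metis finite.emptyI finite.insertI insertCI leD subsetI)
  have "turn i j (fst (k, True)) = 0"
  proof (rule tet_zero[OF tt'(1) prism_affine_turn])
    show "turn i j (fst q) = 0" if "q \<in> verts \<tau>'" for q
      using that unfolding v by (auto simp: turn_def)
  qed (use k in \<open>auto simp: J_def\<close>)
  then show False using turn_neq_0[OF I k(1)] ne k by simp
qed

text \<open>A supporting function that vanishes at \<open>mid i j\<close> is positive at the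
  interior points of the ray, and this decides the sign of its slope along the line, hence
  e.\<close>

lemma boundary_slot:
  assumes T: "triangulation_of P T" and I: "i \<in> I" "j \<in> I"
    and g: "prism_affine g" "\<And>q. q \<in> J \<Longrightarrow> 0 \<le> g q" "q \<in> J" "g q \<noteq> 0" "g (i, False) = 0" "g (j, True) = 0"
    and s: "(i, j, e) \<in> slots \<tau>" "(i, j, e') \<in> slots \<tau>'" "\<tau> \<in> T" "\<tau>' \<in> T"
  shows "e = e'"
proof (rule ccontr)
  assume "e \<noteq> e'"
  have sub: "interior \<tau> \<subseteq> interior P" "interior \<tau>' \<subseteq> interior P"
    using T s(3,4) unfolding triangulation_of_def by (auto intro!: interior_mono)
  obtain r where r: "0 < r" "mid i j + (sg e * r) *\<^sub>R mdir i j \<in> interior P"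
    using s(1) sub by (auto simp: slots_def)
  obtain r' where r': "0 < r'" "mid i j + (sg e' * r') *\<^sub>R mdir i j \<in> interior P"
    using s(2) sub by (auto simp: slots_def)
  define \<gamma> where "\<gamma> = grad g \<bullet> mdir i j"
  have "af g (mid i j) = 0" using af_mid[OF I g(1)] g(5,6) by simp
  then have "0 < sg e * r * \<gamma>" "0 < sg e' * r' * \<gamma>"
    using af_pos_interior[OF g(1-4) r(2)] af_pos_interior[OF g(1-4) r'(2)]
    by (simp_all add: af_shift \<gamma>_def)
  then have "0 < r * (sg e * \<gamma>)" "0 < r' * (sg e' * \<gamma>)" by (simp_all only: ac_simps)
  then have "0 < sg e * \<gamma>" "0 < sg e' * \<gamma>"
    using zero_less_mult_pos r(1) r'(1) by blast+
  then show False using \<open>e \<noteq> e'\<close> by (cases e; cases e') (simp_all add: sg_def)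
qed

text \<open>The function of \<open>abscissa (X i)\<close> vanishes along the whole line, whereas for
  an extreme i it has a strict sign in the interior of P.\<close>

lemma extreme_slot:
  assumes T: "triangulation_of P T" and s: "(i, i, e) \<in> slots \<tau>" "\<tau> \<in> T"
  shows "i \<noteq> lo" "i \<noteq> hi"
proof -
  have I: "i \<in> I" using s by (auto simp: slots_def verts_def J_def)
  obtain r where "mid i i + (sg e * r) *\<^sub>R mdir i i \<in> interior \<tau>" using s(1) by (auto simp: slots_def)
  moreover have "interior \<tau> \<subseteq> interior P"
    using T s(2) unfolding triangulation_of_def by (auto intro!: interior_mono)
  ultimately have int: "mid i i + (sg e * r) *\<^sub>R mdir i i \<in> interior P" by blast
  have "mdir i i = dir (- (1 / 2)) (X i)" by (simp add: mdir_def)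
  then have z: "af (abscissa (X i)) (mid i i + (sg e * r) *\<^sub>R mdir i i) = 0"
    using I dir_orthogonal by (simp add: af_shift af_abscissa_mid)
  show "i \<noteq> lo"
  proof
    assume i: "i = lo"
    have "0 < af (abscissa (X i)) (mid i i + (sg e * r) *\<^sub>R mdir i i)"
      using int lo_le lo_less_hi hi unfolding i
      by (intro af_pos_interior[where q = "(hi, True)"] prism_affine_abscissa) (auto simp: abscissa_def J_def)
    then show False using z by simp
  qed
  show "i \<noteq> hi"
  proof
    assume i: "i = hi"
    have "af (abscissa (X i)) (mid i i + (sg e * r) *\<^sub>R mdir i i) < 0"
      using int le_hi lo_less_hi lo unfolding i
      by (intro af_neg_interior[where q = "(lo, True)"] prism_affine_abscissa) (auto simp: abscissa_def J_def)
    then show False using z by simp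
  qed
qed

lemma on_edge:
  assumes "v \<in> I"
  obtains e n where "n < k e" "v = c e n \<or> v = c e (Suc n)"
proof -
  have "0 \<le> sg True * turn lo hi v \<or> 0 \<le> sg False * turn lo hi v" by (auto simp: sg_def)
  then obtain e where "0 \<le> sg e * turn lo hi v" by blast
  then have "v \<in> c e ` {..k e}" using c_bij[of e] assms by (auto simp: bij_betw_def)
  then obtain n where n: "n \<le> k e" "v = c e n" by auto
  show thesis
  proof (cases n)
    case 0
    then show thesis using that[of 0 e] n k_pos[of e] by auto
  next
    case (Suc n')
    then show thesis using that[of n' e] n by auto
  qed
qed

lemma edge_slot:
  assumes T: "triangulation_of P T" and I: "i \<in> I" "j \<in> I" and n: "n < k f"
    and ij: "i \<in> edge (f, n)" "j \<in> edge (f, n)"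
    and s: "(i, j, e) \<in> slots \<tau>" "(i, j, e') \<in> slots \<tau>'" "\<tau> \<in> T" "\<tau>' \<in> T"
  shows "e = e'"
proof -
  have "card (edge (f, n)) < card I" using card_I by (auto simp: edge_def card_insert_if)
  then have "\<not> I \<subseteq> edge (f, n)"
    using card_mono[of "edge (f, n)" I] by (auto simp: edge_def)
  then obtain v where v: "v \<in> I" "v \<notin> edge (f, n)" by blast
  show ?thesis
  proof (rule boundary_slot[where g = "\<lambda>q. edge_fun f n (fst q)" and q = "(v, True)", OF T I _ _ _ _ _ _ s])
    show "edge_fun f n (fst (v, True)) \<noteq> 0" using v edge_fun_zero[OF n, of v] by (simp add: edge_def)
    show "edge_fun f n (fst (i, False)) = 0" "edge_fun f n (fst (j, True)) = 0"
      using ij edge_fun_zero[OF n] I by (auto simp: edge_def)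
  qed (use v n edge_fun_nonneg in \<open>auto simp: J_def intro: prism_affine_edge_fun\<close>)
qed


section \<open>Tetrahedra with a facet in a cap\<close>

definition cap_level :: "bool \<Rightarrow> real" where "cap_level z = (if z then - 1 else 0)"

lemma af_cap_level:
  assumes "v \<in> I"
  shows "af (lev (cap_level z)) (pt (v, z)) = 0"
    and "af (lev (cap_level z)) (pt (v, \<not> z)) = (if z then - l v else l v)"
  using assms af_pt[OF prism_affine_lev, of "(v, z)" "cap_level z"]
    af_pt[OF prism_affine_lev, of "(v, \<not> z)" "cap_level z"]
  by (cases z; simp add: J_def lev_def cap_level_def)+

lemma af_affine_sum:
  assumes "sum u S = 1"
  shows "af g (\<Sum>q\<in>S. u q *\<^sub>R pt q) = (\<Sum>q\<in>S. u q * af g (pt q))"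
  unfolding af_def by (rule affine_fun_weights[OF assms])

text \<open>Here x is a relative interior point of the facet in cap z. The aim n' may differ from
  the apex n, so that tetrahedra with overlapping facets can be entered along one segment. Comparing
  levels shows that the aim has a positive barycentric coordinate at the apex, and a short step
  keeps the other coordinates positive.\<close>

lemma near_base_interior:
  assumes S: "tet S" and apex: "(n, \<not> z) \<in> S" and base: "\<And>q. q \<in> S \<Longrightarrow> q \<noteq> (n, \<not> z) \<Longrightarrow> snd q = z"
    and u: "\<And>q. q \<in> S \<Longrightarrow> q \<noteq> (n, \<not> z) \<Longrightarrow> 0 < u q" "u (n, \<not> z) = 0" "sum u S = 1"
    and x: "x = (\<Sum>q\<in>S. u q *\<^sub>R pt q)" and n': "n' \<in> I"
  obtains \<epsilon> where "0 < \<epsilon>"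
    "\<And>r. 0 < r \<Longrightarrow> r < \<epsilon> \<Longrightarrow> (1 - r) *\<^sub>R x + r *\<^sub>R pt (n', \<not> z) \<in> interior (convex hull (pt ` S))"
proof -
  let ?n = "(n, \<not> z)" and ?o = "pt (n', \<not> z)"
  have fin: "finite S" and inj: "inj_on pt S" and SJ: "S \<subseteq> J"
    using S tet_finite inj_pt inj_on_subset unfolding tet_def by blast+
  have nI: "n \<in> I" using apex SJ by (auto simp: J_def)
  have "?o \<in> affine hull (pt ` S)" using tet_hull_UNIV[OF S] by simp
  then obtain y where y: "sum y S = 1" "(\<Sum>q\<in>S. y q *\<^sub>R pt q) = ?o"
    by (rule affine_hull_image_weights[OF fin inj])
  have "af (lev (cap_level z)) ?o = (\<Sum>q\<in>S. y q * af (lev (cap_level z)) (pt q))"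
    unfolding y(2)[symmetric] by (rule af_affine_sum[OF y(1)])
  also have "\<dots> = y ?n * af (lev (cap_level z)) (pt ?n)"
  proof (rule sum_delta_weights[OF fin apex])
    fix q assume q: "q \<in> S" "q \<noteq> ?n"
    then have "q = (fst q, z)" "fst q \<in> I" using base[OF q] SJ by (auto simp: J_def prod_eq_iff)
    then show "af (lev (cap_level z)) (pt q) = 0" using af_cap_level(1)[of "fst q" z] by simp
  qed
  finally have "l n' = y ?n * l n"
    using af_cap_level(2)[OF n', of z] af_cap_level(2)[OF nI, of z] by (cases z) auto
  then have "0 < y ?n * l n" using l_pos[OF n'] by simp
  then have yn: "0 < y ?n" using zero_less_mult_pos2 l_pos[OF nI] by blast
  \<comment> \<open>For r below \<open>u q / (u q + \<bar>y q\<bar>)\<close> the coordinate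
    \<open>(1 - r) * u q + r * y q\<close> is positive, even for negative
    \<open>y q\<close>.\<close>
  have A: "finite (insert 1 ((\<lambda>q. u q / (u q + \<bar>y q\<bar>)) ` (S - {?n})))" using fin by simp
  have Apos: "0 < a" if "a \<in> insert 1 ((\<lambda>q. u q / (u q + \<bar>y q\<bar>)) ` (S - {?n}))" for a
    using that u(1) by (auto intro!: divide_pos_pos add_pos_nonneg)
  obtain \<epsilon> where eps: "0 < \<epsilon>"
    "\<And>a. a \<in> insert 1 ((\<lambda>q. u q / (u q + \<bar>y q\<bar>)) ` (S - {?n})) \<Longrightarrow> 2 * \<epsilon> < a"
    using finite_positive_lower_bound[OF A Apos] by blast
  show thesis
  proof (rule that[OF eps(1)])
    fix r assume r: "0 < r" "r < \<epsilon>"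
    define v where "v q = (1 - r) * u q + r * y q" for q
    have vpos: "0 < v q" if q: "q \<in> S" for q
    proof (cases "q = ?n")
      case True
      then show ?thesis using u(2) yn r by (simp add: v_def)
    next
      case False
      have uq: "0 < u q" using u(1) q False by simp
      have "2 * \<epsilon> < u q / (u q + \<bar>y q\<bar>)" using eps(2) q False by blast
      then have "r < u q / (u q + \<bar>y q\<bar>)" using r eps(1) by linarith
      then have "r * (u q + \<bar>y q\<bar>) < u q" using uq by (simp add: pos_less_divide_eq add_pos_nonneg)
      moreover have "- (r * \<bar>y q\<bar>) \<le> r * y q"
        using r(1) mult_left_mono[of "- \<bar>y q\<bar>" "y q" r] by simp
      moreover have "v q = u q - r * u q + r * y q" by (simp add: v_def algebra_simps)
      ultimately show ?thesis by (simp add: distrib_left)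
    qed
    have "sum v S = (1 - r) * sum u S + r * sum y S"
      by (simp add: v_def sum.distrib sum_distrib_left)
    then have vsum: "sum v S = 1" using u(3) y(1) by simp
    have "(\<Sum>q\<in>S. v q *\<^sub>R pt q) = (1 - r) *\<^sub>R (\<Sum>q\<in>S. u q *\<^sub>R pt q) + r *\<^sub>R (\<Sum>q\<in>S. y q *\<^sub>R pt q)"
      by (simp add: v_def scaleR_add_left sum.distrib scaleR_sum_right)
    then show "(1 - r) *\<^sub>R x + r *\<^sub>R ?o \<in> interior (convex hull (pt ` S))"
      using positive_weights_interior[OF S vpos vsum] y(2) x by simp
  qed
qed

text \<open>The analogue of \<open>slot_exists\<close> in the plane of a cap. The chord cannot cross
  the line of abscissa \<open>X j\<close> in \<open>pt (j, z)\<close> itself, since that is a vertex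
  of P.\<close>

lemma cap_chord:
  assumes I: "i \<in> I" "j \<in> I" "h \<in> I" and X: "X i < X j" "X j < X h"
  obtains r \<theta> where "r \<noteq> 0" "0 < \<theta>" "\<theta> < 1"
    "(1 - \<theta>) *\<^sub>R pt (i, z) + \<theta> *\<^sub>R pt (h, z) = pt (j, z) + r *\<^sub>R dir (cap_level z) (X j)"
proof -
  let ?\<mu> = "cap_level z" and ?\<xi> = "X j"
  define p where "p = l i * (X j - X i)"
  define p' where "p' = l h * (X h - X j)"
  have p: "0 < p" "0 < p'" using X I l_pos by (simp_all add: p_def p'_def)
  define \<theta> where "\<theta> = p / (p + p')"
  have th: "0 < \<theta>" "\<theta> < 1" using p by (simp_all add: \<theta>_def)
  define x where "x = (1 - \<theta>) *\<^sub>R pt (i, z) + \<theta> *\<^sub>R pt (h, z)"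
  have ab: "af (abscissa ?\<xi>) (pt (v, z)) = l v * (X v - X j)" if "v \<in> I" for v
    using that af_pt[OF prism_affine_abscissa, of "(v, z)"] by (simp add: J_def abscissa_def)
  have "af (abscissa ?\<xi>) x = (1 - \<theta>) * (- p) + \<theta> * p'"
    unfolding x_def af_comb ab[OF I(1)] ab[OF I(3)] by (simp add: p_def p'_def algebra_simps)
  also have "\<dots> = 0" using p by (simp add: \<theta>_def field_simps)
  finally have x0: "af (abscissa ?\<xi>) x = 0" .
  have xl: "af (lev ?\<mu>) x = 0" unfolding x_def af_comb using I af_cap_level by simp
  have j0: "af (abscissa ?\<xi>) (pt (j, z)) = 0" using ab[OF I(2)] by simp
  obtain r where r: "x = pt (j, z) + r *\<^sub>R dir ?\<mu> ?\<xi>"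
    using slice_line[OF af_cap_level(1)[OF I(2)] j0 xl x0] .
  have "r \<noteq> 0"
  proof
    assume "r = 0"
    then have "pt (j, z) = (1 - \<theta>) *\<^sub>R pt (i, z) + \<theta> *\<^sub>R pt (h, z)" using r by (simp add: x_def)
    moreover have "pt (i, z) \<noteq> pt (h, z)"
      using inj_onD[OF inj_pt, of "(i, z)" "(h, z)"] I X by (auto simp: J_def)
    ultimately have "pt (j, z) \<in> open_segment (pt (i, z)) (pt (h, z))"
      unfolding in_segment using th by blast
    moreover have "pt (j, z) extreme_point_of P"
      using imageI[of "(j, z)" J pt] I unfolding pt_image ext_P[symmetric] by (simp add: J_def)
    ultimately show False
      using pt_in_P[of "(i, z)"] pt_in_P[of "(h, z)"] I unfolding extreme_point_of_def by (simp add: J_def)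
  qed
  then show thesis using that th r unfolding x_def by blast
qed

text \<open>In the cap, the line of abscissa \<open>X j\<close> leaves the vertex
  \<open>pt (j, z)\<close> into both facets on the same side, since a vertex is not between two
  points of P. So the facets overlap, and \<open>near_base_interior\<close> with a common aim turns
  this into an overlap of the tetrahedra.\<close>

lemma middle_vertex_unique:
  assumes T: "triangulation_of P T" "\<tau> \<in> T" "\<tau>' \<in> T"
    and v: "verts \<tau> = {(i, z), (j, z), (h, z), (n, \<not> z)}" "X i < X j" "X j < X h"
    and v': "verts \<tau>' = {(i', z), (j, z), (h', z), (n', \<not> z)}" "X i' < X j" "X j < X h'"
  shows "\<tau> = \<tau>'"
proof (rule ccontr)
  assume ne: "\<tau> \<noteq> \<tau>'"
  note tt = triangulation_tet[OF T(1,2)] and tt' = triangulation_tet[OF T(1,3)]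
  have I: "i \<in> I" "j \<in> I" "h \<in> I" "n \<in> I" and I': "i' \<in> I" "h' \<in> I" "n' \<in> I"
    using tt(1) tt'(1) unfolding v(1) v'(1) by (auto simp: tet_def J_def)
  define d where "d = dir (cap_level z) (X j)"
  obtain r \<theta> where r: "r \<noteq> 0" "0 < \<theta>" "\<theta> < 1"
    "(1 - \<theta>) *\<^sub>R pt (i, z) + \<theta> *\<^sub>R pt (h, z) = pt (j, z) + r *\<^sub>R d"
    unfolding d_def by (rule cap_chord[OF I(1-3) v(2,3)])
  obtain r' \<theta>' where r': "r' \<noteq> 0" "0 < \<theta>'" "\<theta>' < 1"
    "(1 - \<theta>') *\<^sub>R pt (i', z) + \<theta>' *\<^sub>R pt (h', z) = pt (j, z) + r' *\<^sub>R d"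
    unfolding d_def by (rule cap_chord[OF I'(1) I(2) I'(2) v'(2,3)])
  have P: "pt (j, z) + r *\<^sub>R d \<in> P" "pt (j, z) + r' *\<^sub>R d \<in> P"
  proof -
    have "convex P" by (simp add: P_eq)
    note cv = convexD_alt[OF this pt_in_P pt_in_P]
    show "pt (j, z) + r *\<^sub>R d \<in> P"
      unfolding r(4)[symmetric] by (rule cv) (use r I in \<open>auto simp: J_def\<close>)
    show "pt (j, z) + r' *\<^sub>R d \<in> P"
      unfolding r'(4)[symmetric] by (rule cv) (use r' I' in \<open>auto simp: J_def\<close>)
  qed
  have ext: "pt (j, z) extreme_point_of P"
    using imageI[of "(j, z)" J pt] I unfolding pt_image ext_P[symmetric] by (simp add: J_def)
  have d0: "d \<noteq> 0"
    unfolding d_def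
    by (rule dir_nonzero[of _ "pt (j, z)"])
      (use I in \<open>simp_all add: af_cap_level af_pt prism_affine_abscissa J_def\<close>, simp add: abscissa_def)
  have "\<not> r * r' < 0" using extreme_point_not_between[OF ext P d0] by blast
  then have rr: "0 < r * r'" using r(1) r'(1) by (meson linorder_neqE_linordered_idom mult_eq_0_iff)
  \<comment> \<open>Chosen so that \<open>\<eta> * r = \<eta>' * r'\<close>, namely r * r' / (r +
    r'). This gives a common point x strictly inside both facets.\<close>
  define \<eta> where "\<eta> = r' / (r + r')"
  define \<eta>' where "\<eta>' = r / (r + r')"
  have sgn: "0 < r \<and> 0 < r' \<or> r < 0 \<and> r' < 0" using rr by (simp add: zero_less_mult_iff)
  have eta: "0 < \<eta>" "\<eta> < 1" "0 < \<eta>'" "\<eta>' < 1"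
    using sgn unfolding \<eta>_def \<eta>'_def by (auto simp: field_simps)
  have eq: "\<eta> * r = \<eta>' * r'" by (simp add: \<eta>_def \<eta>'_def)
  define x where "x = pt (j, z) + (\<eta> * r) *\<^sub>R d"
  have weights: "\<exists>\<epsilon>>0. \<forall>\<rho>. 0 < \<rho> \<and> \<rho> < \<epsilon> \<longrightarrow> (1 - \<rho>) *\<^sub>R x + \<rho> *\<^sub>R pt (n, \<not> z) \<in> interior (convex hull (pt ` S))"
    if S: "tet S" "S = {(f, z), (j, z), (g, z), (m, \<not> z)}" "X f < X j" "X j < X g"
      and y: "0 < \<eta>" "\<eta> < 1" "0 < \<theta>" "\<theta> < 1"
        "(1 - \<theta>) *\<^sub>R pt (f, z) + \<theta> *\<^sub>R pt (g, z) = pt (j, z) + r *\<^sub>R d"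
        "x = pt (j, z) + (\<eta> * r) *\<^sub>R d"
    for S f g m \<eta> \<theta> r
  proof -
    have dist: "f \<noteq> j" "j \<noteq> g" "f \<noteq> g" using S by auto
    define u where "u q = (if q = (f, z) then \<eta> * (1 - \<theta>) else if q = (g, z) then \<eta> * \<theta>
        else if q = (j, z) then 1 - \<eta> else 0)" for q
    have "x = (1 - \<eta>) *\<^sub>R pt (j, z) + \<eta> *\<^sub>R (pt (j, z) + r *\<^sub>R d)"
      unfolding y(6) by (simp add: algebra_simps)
    also have "\<dots> = (\<Sum>q\<in>S. u q *\<^sub>R pt q)"
      unfolding y(5)[symmetric] S(2) using dist by (simp add: u_def algebra_simps)
    finally have x: "x = (\<Sum>q\<in>S. u q *\<^sub>R pt q)" .
    have us: "sum u S = 1" unfolding S(2) using dist by (simp add: u_def algebra_simps)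
    have up: "0 < u q" if "q \<in> S" "q \<noteq> (m, \<not> z)" for q
      using that dist y unfolding S(2) by (auto simp: u_def)
    have base: "snd q = z" if "q \<in> S" "q \<noteq> (m, \<not> z)" for q
      using that unfolding S(2) by auto
    have m: "(m, \<not> z) \<in> S" "u (m, \<not> z) = 0" unfolding S(2) by (auto simp: u_def)
    obtain \<epsilon> where "0 < \<epsilon>"
      "\<And>r. 0 < r \<Longrightarrow> r < \<epsilon> \<Longrightarrow> (1 - r) *\<^sub>R x + r *\<^sub>R pt (n, \<not> z) \<in> interior (convex hull (pt ` S))"
      using near_base_interior[OF S(1) m(1) base up m(2) us x I(4)] by blast
    then show ?thesis by blast
  qed
  obtain \<epsilon> where eps: "0 < \<epsilon>" "\<And>\<rho>. 0 < \<rho> \<and> \<rho> < \<epsilon> \<Longrightarrow> (1 - \<rho>) *\<^sub>R x + \<rho> *\<^sub>R pt (n, \<not> z) \<in> interior \<tau>"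
    using weights[OF tt(1) v(1-3) eta(1,2) r(2-4) x_def] tt(2) by auto
  obtain \<epsilon>' where eps': "0 < \<epsilon>'" "\<And>\<rho>. 0 < \<rho> \<and> \<rho> < \<epsilon>' \<Longrightarrow> (1 - \<rho>) *\<^sub>R x + \<rho> *\<^sub>R pt (n, \<not> z) \<in> interior \<tau>'"
    using weights[OF tt'(1) v'(1-3) eta(3,4) r'(2-4) x_def[unfolded eq]] tt'(2) by auto
  define \<rho> where "\<rho> = min \<epsilon> \<epsilon>' / 2"
  have "0 < \<rho>" "\<rho> < \<epsilon>" "\<rho> < \<epsilon>'" using eps(1) eps'(1) by (auto simp: \<rho>_def)
  then have "interior \<tau> \<inter> interior \<tau>' \<noteq> {}" using eps(2) eps'(2) by blast
  then show False using T ne unfolding triangulation_of_def by blast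
qed

lemma finite_triangulation_of: "triangulation_of P T \<Longrightarrow> finite T"
  by (simp add: triangulation_of_def triangulation_def)

text \<open>The middle one of the three vertices in the cap, in the order of \<open>X\<close>, is an
  injective label and is never \<open>lo\<close> or \<open>hi\<close>.\<close>

lemma card_cap_tets:
  assumes T: "triangulation_of P T"
  shows "card {\<tau> \<in> T. card (level z \<tau>) = 3} + 2 \<le> card I"
proof -
  let ?C = "{\<tau> \<in> T. card (level z \<tau>) = 3}"
  define middle where "middle \<tau> j \<longleftrightarrow>
    (\<exists>i h n. verts \<tau> = {(i, z), (j, z), (h, z), (n, \<not> z)} \<and> X i < X j \<and> X j < X h)" for \<tau> j
  have "\<exists>j. middle \<tau> j" if "\<tau> \<in> ?C" for \<tau>
  proof -
    have \<tau>: "\<tau> \<in> T" "card (level z \<tau>) = 3" using that by auto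
    have "card (level False \<tau>) + card (level True \<tau>) = 4"
      using triangulation_tet(1)[OF T \<tau>(1)] card_levels by (simp add: tet_def)
    then have "card (level (\<not> z) \<tau>) = 1" using \<tau>(2) by (cases z) auto
    then obtain n where n: "level (\<not> z) \<tau> = {n}" by (auto simp: card_1_singleton_iff)
    obtain i j h where ijh: "level z \<tau> = {i, j, h}" "X i < X j" "X j < X h"
      using three_sorted[OF level_subset \<tau>(2)] .
    have "verts \<tau> = {(i, z), (j, z), (h, z), (n, \<not> z)}"
      unfolding verts_levels[of \<tau>] using n ijh(1) by (cases z) auto
    then show ?thesis using ijh(2,3) unfolding middle_def by blast
  qed
  then have "\<forall>\<tau>\<in>?C. \<exists>j. middle \<tau> j" by (rule ballI)
  from bchoice[OF this] obtain j where j: "\<forall>\<tau>\<in>?C. middle \<tau> (j \<tau>)" ..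
  have "inj_on j ?C"
  proof (rule inj_onI)
    fix \<tau> \<tau>' assume \<tau>: "\<tau> \<in> ?C" "\<tau>' \<in> ?C" "j \<tau> = j \<tau>'"
    have "middle \<tau> (j \<tau>)" using j \<tau>(1) by (rule bspec)
    then obtain i h n where v: "verts \<tau> = {(i, z), (j \<tau>, z), (h, z), (n, \<not> z)}" "X i < X (j \<tau>)" "X (j \<tau>) < X h"
      unfolding middle_def by blast
    have "middle \<tau>' (j \<tau>)" unfolding \<tau>(3) using j \<tau>(2) by (rule bspec)
    then obtain i' h' n' where v': "verts \<tau>' = {(i', z), (j \<tau>, z), (h', z), (n', \<not> z)}" "X i' < X (j \<tau>)" "X (j \<tau>) < X h'"
      unfolding middle_def by blast
    have "\<tau> \<in> T" "\<tau>' \<in> T" using \<tau> by simp_all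
    then show "\<tau> = \<tau>'" by (rule middle_vertex_unique[OF T _ _ v v'])
  qed
  moreover have "j ` ?C \<subseteq> I - {lo, hi}"
  proof (rule image_subsetI)
    fix \<tau> assume "\<tau> \<in> ?C"
    with j have "middle \<tau> (j \<tau>)" by (rule bspec)
    then obtain i h n where v: "verts \<tau> = {(i, z), (j \<tau>, z), (h, z), (n, \<not> z)}" "X i < X (j \<tau>)" "X (j \<tau>) < X h"
      unfolding middle_def by blast
    have "verts \<tau> \<subseteq> J" by (auto simp: verts_def)
    then have I: "i \<in> I" "j \<tau> \<in> I" "h \<in> I" unfolding v(1) by (auto simp: J_def)
    have "j \<tau> \<noteq> lo" using lo_le[OF I(1)] v(2) by auto
    moreover have "j \<tau> \<noteq> hi" using le_hi[OF I(3)] v(3) by auto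
    ultimately show "j \<tau> \<in> I - {lo, hi}" using I(2) by simp
  qed
  ultimately have "card ?C \<le> card (I - {lo, hi})"
    using finite_I by (intro card_inj_on_le) auto
  moreover have "card (I - {lo, hi}) = card I - 2"
    using lo hi lo_neq_hi finite_I by (simp add: card_Diff_subset)
  ultimately show ?thesis using card_I by linarith
qed

text \<open>With n = card I, at most n - 2 slots lie on side edges. Each pair of distinct indices
  gives at most two slots, and only one if it is an edge of the polygon. The bound is n - 2 + n * (n
  - 1) - n.\<close>

lemma card_slots_union:
  assumes T: "triangulation_of P T"
  shows "card (\<Union>\<tau>\<in>T. slots \<tau>) + 2 \<le> card I * (card I - 1)"
proof -
  let ?S = "\<Union>\<tau>\<in>T. slots \<tau>"
  define N where "N p = {e. (fst p, snd p, e) \<in> ?S}" for p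
  let ?D = "diagonals T"
  have D: "?D \<subseteq> I \<times> I" by (auto simp: diagonals_def verts_def J_def)
  then have finD: "finite ?D" using finite_I finite_subset by blast
  define D1 where "D1 = {p \<in> ?D. fst p = snd p}"
  define D2 where "D2 = {p \<in> ?D. fst p \<noteq> snd p}"
  have fin12: "finite D1" "finite D2" using finD by (auto simp: D1_def D2_def)
  have S: "?S = (\<lambda>(p, e). (fst p, snd p, e)) ` Sigma ?D N"
    by (force simp: N_def slots_def diagonals_def image_iff)
  have "card ?S = card (Sigma ?D N)"
    unfolding S by (rule card_image) (auto simp: inj_on_def)
  also have "\<dots> = (\<Sum>p\<in>?D. card (N p))" using finD by (subst card_SigmaI) auto
  also have "?D = D1 \<union> D2" by (auto simp: D1_def D2_def)
  also have "(\<Sum>p\<in>D1 \<union> D2. card (N p)) = (\<Sum>p\<in>D1. card (N p)) + (\<Sum>p\<in>D2. card (N p))"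
    using fin12 by (intro sum.union_disjoint) (auto simp: D1_def D2_def)
  finally have cardS: "card ?S = (\<Sum>p\<in>D1. card (N p)) + (\<Sum>p\<in>D2. card (N p))" .
  have N2: "card (N p) \<le> 2" for p
    using card_mono[of "UNIV :: bool set" "N p"] by simp
  have single: "card (N p) \<le> 1" if "\<And>e e'. e \<in> N p \<Longrightarrow> e' \<in> N p \<Longrightarrow> e = e'" for p
    using card_le_Suc0_iff_eq[of "N p"] that by auto
  have edge_N: "card (N p) \<le> 1" if "p \<in> ?D" "fst p \<in> edge (f, n)" "snd p \<in> edge (f, n)" "n < k f" for p f n
  proof (rule single)
    fix e e' assume "e \<in> N p" "e' \<in> N p"
    then show "e = e'" using edge_slot[OF T _ _ that(4,2,3)] that(1) D unfolding N_def by fastforce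
  qed
  have "(\<Sum>p\<in>D1. card (N p)) \<le> (\<Sum>p\<in>D1. of_bool (fst p \<in> I - {lo, hi}))"
  proof (rule sum_mono)
    fix p assume p: "p \<in> D1"
    show "card (N p) \<le> of_bool (fst p \<in> I - {lo, hi})"
    proof (cases "N p = {}")
      case False
      then obtain e \<tau> where e: "(fst p, fst p, e) \<in> slots \<tau>" "\<tau> \<in> T"
        using p unfolding N_def D1_def by auto
      have I: "fst p \<in> I" using p D unfolding D1_def by auto
      obtain f n where "n < k f" "fst p = c f n \<or> fst p = c f (Suc n)" using on_edge[OF I] .
      then have "card (N p) \<le> 1" using edge_N[of p f n] p unfolding D1_def edge_def by auto
      then show ?thesis using extreme_slot[OF T e] I by simp
    qed simp
  qed
  also have "\<dots> = card {p \<in> D1. fst p \<in> I - {lo, hi}}" using fin12 by (simp add: sum_of_bool_eq Int_def)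
  also have "\<dots> \<le> card (I - {lo, hi})"
    using finite_I by (intro card_inj_on_le[of fst]) (auto simp: inj_on_def D1_def)
  also have "\<dots> = card I - 2"
    using lo hi lo_neq_hi finite_I by (simp add: card_Diff_subset)
  finally have 1: "(\<Sum>p\<in>D1. card (N p)) \<le> card I - 2" .
  define B where "B = {b. b \<subseteq> I \<and> card b = 2}"
  have finB: "finite B" unfolding B_def using finite_I by simp
  define wgt where "wgt b = (if b \<in> edge ` edges then 1 else 2 :: nat)" for b
  define pr where "pr p = {fst p, snd p}" for p :: "'i \<times> 'i"
  \<comment> \<open>By \<open>diagonals_not_crossing\<close> at most one of the two diagonals over a
    pair occurs in T.\<close>
  have inj: "inj_on pr D2"
  proof (rule inj_onI)
    fix p q assume pq: "p \<in> D2" "q \<in> D2" "pr p = pr q"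
    then have "fst p = fst q \<and> snd p = snd q \<or> fst p = snd q \<and> snd p = fst q"
      by (auto simp: pr_def doubleton_eq_iff)
    moreover have "False" if "fst p = snd q" "snd p = fst q"
      using diagonals_not_crossing[OF T, of "fst p" "snd p"] pq(1,2) that unfolding D2_def
      by (metis (mono_tags, lifting) mem_Collect_eq prod.collapse)
    ultimately show "p = q" by (auto simp: prod_eq_iff)
  qed
  have "(\<Sum>p\<in>D2. card (N p)) \<le> (\<Sum>p\<in>D2. wgt (pr p))"
  proof (rule sum_mono)
    fix p assume p: "p \<in> D2"
    show "card (N p) \<le> wgt (pr p)"
    proof (cases "pr p \<in> edge ` edges")
      case True
      then obtain f n where fn: "n < k f" "pr p = edge (f, n)" unfolding edges_def by auto
      then have "card (N p) \<le> 1" using edge_N[of p f n] p unfolding D2_def pr_def by auto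
      then show ?thesis using True by (simp add: wgt_def)
    qed (use N2 in \<open>simp add: wgt_def\<close>)
  qed
  also have "\<dots> = sum wgt (pr ` D2)" by (simp add: sum.reindex[OF inj])
  also have "\<dots> \<le> sum wgt B"
    using finB D by (intro sum_mono2) (auto simp: B_def pr_def D2_def)
  finally have 2: "(\<Sum>p\<in>D2. card (N p)) \<le> sum wgt B" .
  have EB: "edge ` edges \<subseteq> B"
    using c_in c_Suc_neq unfolding edges_def edge_def B_def by auto
  have "sum wgt B + card (edge ` edges) = (\<Sum>b\<in>B. wgt b + of_bool (b \<in> edge ` edges))"
    using finB EB by (simp add: sum.distrib sum_of_bool_eq Int_absorb1 Int_def[symmetric] Collect_mem_eq)
  also have "\<dots> = (\<Sum>b\<in>B. 2)" by (rule sum.cong) (auto simp: wgt_def)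
  also have "\<dots> = 2 * card B" by simp
  finally have "sum wgt B + card I = 2 * card B"
    using card_image[OF inj_edge] card_edges by simp
  moreover have "even (card I * (card I - 1))" by (cases "card I") auto
  then have "2 * card B = card I * (card I - 1)"
    unfolding B_def n_subsets[OF finite_I] choose_two by (rule dvd_mult_div_cancel)
  ultimately show ?thesis using cardS 1 2 card_I by linarith
qed

theorem triangulation_card_le:
  assumes T: "triangulation_of P T"
  shows "2 * card T + 6 \<le> (card I)\<^sup>2 + card I"
proof -
  have fin: "finite T" by (rule finite_triangulation_of[OF T])
  have "2 * card T = (\<Sum>\<tau>\<in>T. 2)" by simp
  also have "\<dots> \<le> (\<Sum>\<tau>\<in>T. card (slots \<tau>) + of_bool (card (level False \<tau>) = 3) + of_bool (card (level True \<tau>) = 3))"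
    using card_slots triangulation_tet[OF T] by (intro sum_mono) blast
  also have "\<dots> = (\<Sum>\<tau>\<in>T. card (slots \<tau>)) + card {\<tau> \<in> T. card (level False \<tau>) = 3}
      + card {\<tau> \<in> T. card (level True \<tau>) = 3}"
    using fin by (simp add: sum.distrib sum_of_bool_eq Int_def)
  also have "(\<Sum>\<tau>\<in>T. card (slots \<tau>)) = card (\<Union>\<tau>\<in>T. slots \<tau>)"
    using fin finite_slots slots_disjoint[OF T] by (subst card_UN_disjoint) auto
  finally have "2 * card T \<le> card (\<Union>\<tau>\<in>T. slots \<tau>) + card {\<tau> \<in> T. card (level False \<tau>) = 3}
      + card {\<tau> \<in> T. card (level True \<tau>) = 3}" .
  moreover have "card I * (card I - 1) + card I = (card I)\<^sup>2"
    using card_I by (simp add: power2_eq_square diff_mult_distrib2)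
  ultimately show ?thesis
    using card_slots_union[OF T] card_cap_tets[OF T, of False] card_cap_tets[OF T, of True] by linarith
qed

end

section \<open>Coordinates from affine functions\<close>

text \<open>Both x and w are orthogonal to g, so \<open>cross3 x w\<close> is a multiple of g. Its
  product with d is the triple product in the last hypothesis, and \<open>g \<bullet> d\<close> is
  not 0, so the multiple is 0.\<close>

lemma parallel_to_axis:
  fixes w d g x :: "real^3"
  assumes "w \<noteq> 0" "g \<bullet> w = 0" "g \<bullet> d \<noteq> 0" "g \<bullet> x = 0" "cross3 w d \<bullet> x = 0"
  shows "\<exists>r. x = r *\<^sub>R w"
proof -
  have "cross3 g (cross3 x w) = 0"
    using assms(2,4) by (simp add: Lagrange)
  then have "collinear {0, g, cross3 x w}" by (simp add: cross_eq_0)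
  moreover have "g \<noteq> 0" using assms(3) by auto
  ultimately obtain r where r: "cross3 x w = r *\<^sub>R g"
    unfolding collinear_lemma by (metis scaleR_zero_left)
  have "cross3 x w \<bullet> d = cross3 w d \<bullet> x"
    by (metis cross_triple)
  then have "r * (g \<bullet> d) = 0" using assms(5) r by simp
  then have "cross3 x w = 0" using assms(3) r by simp
  then have "collinear {0, w, x}" by (simp add: cross_eq_0 insert_commute)
  then show ?thesis unfolding collinear_lemma using assms(1) by (metis scaleR_zero_left)
qed

text \<open>The side edges have direction \<open>w\<close> and lengths \<open>p0 + d0 \<bullet> a v\<close>; \<open>n\<close> measures the height over
  the cap of the points \<open>a v\<close>.\<close>

locale parallel_prism =
  fixes I :: "'i set" and a b :: "'i \<Rightarrow> real^3" and w n d0 :: "real^3" and \<nu> p0 :: real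
    and A :: "(real^3) set"
  assumes finite_I: "finite I" and card_I: "3 \<le> card I" and inj_a: "inj_on a I"
    and w: "w \<noteq> 0" and d0: "d0 \<bullet> w = 0" and n: "n \<bullet> w = 1"
    and level_a: "v \<in> I \<Longrightarrow> \<nu> + n \<bullet> a v = 0"
    and length_pos: "v \<in> I \<Longrightarrow> 0 < p0 + d0 \<bullet> a v"
    and b_eq: "v \<in> I \<Longrightarrow> b v = a v + (p0 + d0 \<bullet> a v) *\<^sub>R w"
    and A_eq: "A = convex hull (a ` I \<union> b ` I)"
    and ext_A: "{v. v extreme_point_of A} = a ` I \<union> b ` I"
begin

lemma a_eqI:
  assumes "u \<in> I" "v \<in> I" "a u - a v = r *\<^sub>R w"
  shows "u = v"
proof -
  have "n \<bullet> (a u - a v) = 0" using level_a[OF assms(1)] level_a[OF assms(2)] by (simp add: inner_diff_right)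
  then have "r = 0" using assms(3) n by simp
  then show ?thesis using assms inj_a by (auto dest: inj_onD)
qed

lemma a_not_in_hull:
  assumes v: "v \<in> I"
  shows "a v \<notin> convex hull (a ` (I - {v}))"
proof
  assume "a v \<in> convex hull (a ` (I - {v}))"
  moreover have "convex hull (a ` (I - {v})) \<subseteq> A" unfolding A_eq by (rule hull_mono) auto
  moreover have "a v extreme_point_of A" using ext_A v by auto
  ultimately have "a v extreme_point_of convex hull (a ` (I - {v}))"
    unfolding extreme_point_of_def by blast
  then have "a v \<in> a ` (I - {v})" by (rule extreme_point_of_convex_hull)
  then show False using inj_a v by (auto dest: inj_onD)
qed

end

text \<open>Three affine functions \<open>f j x = p j + d j \<bullet> x\<close> that are invariant under translation by \<open>w\<close>
  serve as homogeneous coordinates.\<close>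

locale prism_coordinates = parallel_prism I a b w n d0 \<nu> p0 A
  for I :: "'i set" and a b :: "'i \<Rightarrow> real^3" and w n d0 :: "real^3" and \<nu> p0 :: real
    and A :: "(real^3) set" +
  fixes p1 p2 c0 c1 c2 :: real and d1 d2 :: "real^3"
  assumes d12: "d1 \<bullet> w = 0" "d2 \<bullet> w = 0"
    and const: "c0 * (p0 + d0 \<bullet> x) + c1 * (p1 + d1 \<bullet> x) + c2 * (p2 + d2 \<bullet> x) = 1"
    and separate: "d0 \<bullet> x = 0 \<Longrightarrow> d1 \<bullet> x = 0 \<Longrightarrow> d2 \<bullet> x = 0 \<Longrightarrow> \<exists>r. x = r *\<^sub>R w"
begin

definition len :: "'i \<Rightarrow> real" where "len v = p0 + d0 \<bullet> a v"
definition X0 :: "'i \<Rightarrow> real" where "X0 v = (p1 + d1 \<bullet> a v) / len v"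
definition Y0 :: "'i \<Rightarrow> real" where "Y0 v = (p2 + d2 \<bullet> a v) / len v"

lemma len_pos: "v \<in> I \<Longrightarrow> 0 < len v"
  by (simp add: len_def length_pos)

lemma coords: "v \<in> I \<Longrightarrow> p1 + d1 \<bullet> a v = len v * X0 v" "v \<in> I \<Longrightarrow> p2 + d2 \<bullet> a v = len v * Y0 v"
  using len_pos[of v] by (simp_all add: X0_def Y0_def)

lemma const_len:
  assumes "v \<in> I"
  shows "len v * (c0 + c1 * X0 v + c2 * Y0 v) = 1"
proof -
  have "c0 * len v + c1 * (len v * X0 v) + c2 * (len v * Y0 v) = 1"
    using const[of "a v"] coords[OF assms] by (simp add: len_def)
  then show ?thesis by (simp add: algebra_simps)
qed

lemma coordinates_inj:
  assumes "u \<in> I" "v \<in> I" "X0 u = X0 v" "Y0 u = Y0 v"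
  shows "u = v"
proof -
  have "len u * (c0 + c1 * X0 v + c2 * Y0 v) = 1" "len v * (c0 + c1 * X0 v + c2 * Y0 v) = 1"
    using const_len[OF assms(1)] const_len[OF assms(2)] assms(3,4) by simp_all
  then have len: "len u = len v" by (metis mult_cancel_right zero_neq_one mult_zero_right)
  then have "p1 + d1 \<bullet> a u = p1 + d1 \<bullet> a v" "p2 + d2 \<bullet> a u = p2 + d2 \<bullet> a v"
    using coords[OF assms(1)] coords[OF assms(2)] assms(3,4) by simp_all
  with len have "\<exists>r. a u - a v = r *\<^sub>R w"
    by (intro separate) (simp_all add: inner_diff_right len_def)
  then show ?thesis using a_eqI[OF assms(1,2)] by blast
qed

text \<open>Two distinct vertices get the same abscissa for at most one \<theta>.\<close>

lemma finite_bad_shears: "finite {\<theta>. \<not> inj_on (\<lambda>v. X0 v + \<theta> * Y0 v) I}"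
proof -
  have "{\<theta>. \<not> inj_on (\<lambda>v. X0 v + \<theta> * Y0 v) I} \<subseteq> (\<lambda>(u, v). (X0 v - X0 u) / (Y0 u - Y0 v)) ` (I \<times> I)"
  proof
    fix \<theta> assume "\<theta> \<in> {\<theta>. \<not> inj_on (\<lambda>v. X0 v + \<theta> * Y0 v) I}"
    then obtain u v where uv: "u \<in> I" "v \<in> I" "u \<noteq> v" "X0 u + \<theta> * Y0 u = X0 v + \<theta> * Y0 v"
      by (auto simp: inj_on_def)
    have "Y0 u \<noteq> Y0 v" using coordinates_inj[OF uv(1,2)] uv(3,4) by auto
    then have "\<theta> = (X0 v - X0 u) / (Y0 u - Y0 v)" using uv(4) by (simp add: field_simps)
    then show "\<theta> \<in> (\<lambda>(u, v). (X0 v - X0 u) / (Y0 u - Y0 v)) ` (I \<times> I)" using uv by auto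
  qed
  then show ?thesis using finite_I by (meson finite_SigmaI finite_imageI finite_subset)
qed

text \<open>Returning from the perspective coordinates to space changes the weights u i into
  \<open>u i * len v / len i\<close>. The identity \<open>const\<close> makes the new weights sum to
  1. The three coordinate functions then agree at the new combination and at \<open>a v\<close>, so
  by \<open>separate\<close> the difference is a multiple of w, and the common cap plane makes it
  0.\<close>

lemma polygon:
  assumes inj: "inj_on X0 I"
  shows "convex_polygon I X0 Y0"
proof (unfold_locales)
  fix v assume v: "v \<in> I"
  let ?I = "I - {v}"
  show "(X0 v, Y0 v) \<notin> convex hull ((\<lambda>u. (X0 u, Y0 u)) ` ?I)"
  proof
    assume h: "(X0 v, Y0 v) \<in> convex hull ((\<lambda>u. (X0 u, Y0 u)) ` ?I)"
    have fin: "finite ?I" using finite_I by simp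
    have "inj_on (\<lambda>u. (X0 u, Y0 u)) ?I" using inj by (auto simp: inj_on_def)
    then obtain u where u: "\<forall>i\<in>?I. 0 \<le> u i" "sum u ?I = 1" "(\<Sum>i\<in>?I. u i *\<^sub>R (X0 i, Y0 i)) = (X0 v, Y0 v)"
      by (rule convex_hull_image_weights[OF fin _ h])
    have uX: "(\<Sum>i\<in>?I. u i * X0 i) = X0 v" and uY: "(\<Sum>i\<in>?I. u i * Y0 i) = Y0 v"
      using arg_cong[OF u(3), of fst] arg_cong[OF u(3), of snd] by (simp_all add: fst_sum snd_sum)
    define y where "y i = u i * len v / len i" for i
    have y: "y i * (len i * r) = len v * (u i * r)" if "i \<in> ?I" for i r
      using len_pos[of i] that by (simp add: y_def)
    have "sum y ?I = (\<Sum>i\<in>?I. y i * (len i * (c0 + c1 * X0 i + c2 * Y0 i)))"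
      using const_len by (intro sum.cong) auto
    also have "\<dots> = (\<Sum>i\<in>?I. len v * (u i * (c0 + c1 * X0 i + c2 * Y0 i)))"
      by (intro sum.cong y) auto
    also have "\<dots> = len v * (c0 * sum u ?I + c1 * (\<Sum>i\<in>?I. u i * X0 i) + c2 * (\<Sum>i\<in>?I. u i * Y0 i))"
      by (simp add: sum_distrib_left sum.distrib algebra_simps)
    also have "\<dots> = 1" unfolding u(2) uX uY using const_len[OF v] by simp
    finally have ysum: "sum y ?I = 1" .
    define x where "x = (\<Sum>i\<in>?I. y i *\<^sub>R a i)"
    have "p0 + d0 \<bullet> x = p0 + d0 \<bullet> a v"
    proof -
      have "p0 + d0 \<bullet> x = (\<Sum>i\<in>?I. y i * (len i * 1))"
        unfolding x_def affine_fun_weights[OF ysum] by (simp add: len_def)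
      also have "\<dots> = (\<Sum>i\<in>?I. len v * (u i * 1))" by (intro sum.cong y) auto
      also have "\<dots> = len v" using u(2) by (simp flip: sum_distrib_left)
      finally show ?thesis by (simp add: len_def)
    qed
    moreover have "p1 + d1 \<bullet> x = p1 + d1 \<bullet> a v"
    proof -
      have "p1 + d1 \<bullet> x = (\<Sum>i\<in>?I. y i * (len i * X0 i))"
        unfolding x_def affine_fun_weights[OF ysum] using coords(1) by (intro sum.cong) auto
      also have "\<dots> = (\<Sum>i\<in>?I. len v * (u i * X0 i))" by (intro sum.cong y) auto
      also have "\<dots> = len v * X0 v" using uX by (simp flip: sum_distrib_left)
      finally show ?thesis using coords(1)[OF v] by simp
    qed
    moreover have "p2 + d2 \<bullet> x = p2 + d2 \<bullet> a v"
    proof -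
      have "p2 + d2 \<bullet> x = (\<Sum>i\<in>?I. y i * (len i * Y0 i))"
        unfolding x_def affine_fun_weights[OF ysum] using coords(2) by (intro sum.cong) auto
      also have "\<dots> = (\<Sum>i\<in>?I. len v * (u i * Y0 i))" by (intro sum.cong y) auto
      also have "\<dots> = len v * Y0 v" using uY by (simp flip: sum_distrib_left)
      finally show ?thesis using coords(2)[OF v] by simp
    qed
    ultimately have "\<exists>r. x - a v = r *\<^sub>R w" by (intro separate) (simp_all add: inner_diff_right)
    then obtain r where r: "x - a v = r *\<^sub>R w" by blast
    have "\<nu> + n \<bullet> x = 0"
      unfolding x_def affine_fun_weights[OF ysum] using level_a by (intro sum.neutral) auto
    then have "n \<bullet> (x - a v) = 0" using level_a[OF v] by (simp add: inner_diff_right)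
    then have "x = a v" using r n by simp
    moreover have "x \<in> convex hull (a ` ?I)"
      unfolding x_def
    proof (rule weights_in_convex_hull_image[OF fin _ ysum])
      show "0 \<le> y i" if "i \<in> ?I" for i
        using that u(1) len_pos[OF v] len_pos[of i] by (simp add: y_def)
    qed (auto intro: hull_inc)
    ultimately show False using a_not_in_hull[OF v] by simp
  qed
qed (use finite_I card_I inj in auto)

lemma frame_exists:
  assumes ch: "chained_polygon I X0 Y0 k c s t"
  shows "prism_frame I X0 Y0 k c s t len a b w A"
proof -
  interpret chained_polygon I X0 Y0 k c s t by (rule ch)
  show ?thesis
  proof unfold_locales
    fix v assume v: "v \<in> I"
    show "0 < len v" by (rule len_pos[OF v])
    show "b v = a v + len v *\<^sub>R w" using b_eq[OF v] by (simp add: len_def)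
  next
    fix \<alpha> \<beta> \<gamma> \<delta> :: real
    define d where "d = \<alpha> *\<^sub>R d0 + \<beta> *\<^sub>R d1 + \<gamma> *\<^sub>R d2 + \<delta> *\<^sub>R n"
    define \<kappa> where "\<kappa> = \<alpha> * p0 + \<beta> * p1 + \<gamma> * p2 + \<delta> * \<nu>"
    have eq: "\<kappa> + d \<bullet> x = \<alpha> * (p0 + d0 \<bullet> x) + \<beta> * (p1 + d1 \<bullet> x) + \<gamma> * (p2 + d2 \<bullet> x) + \<delta> * (\<nu> + n \<bullet> x)" for x
      by (simp add: \<kappa>_def d_def inner_add_left algebra_simps)
    have "\<kappa> + d \<bullet> a v = len v * (\<alpha> + \<beta> * X0 v + \<gamma> * Y0 v)" if v: "v \<in> I" for v
      unfolding eq coords[OF v] level_a[OF v] by (simp add: len_def algebra_simps)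
    moreover have "d \<bullet> w = \<delta>" using d0 d12 n by (simp add: d_def inner_add_left)
    then have "\<kappa> + d \<bullet> b v = \<kappa> + d \<bullet> a v + len v * \<delta>" if "v \<in> I" for v
      using b_eq[OF that] by (simp add: inner_add_right len_def)
    ultimately show "\<exists>\<kappa> d. \<forall>v\<in>I. \<kappa> + d \<bullet> a v = len v * (\<alpha> + \<beta> * X0 v + \<gamma> * Y0 v) \<and>
        \<kappa> + d \<bullet> b v = len v * (\<alpha> + \<beta> * X0 v + \<gamma> * Y0 v + \<delta>)"
      by (intro exI[of _ \<kappa>] exI[of _ d]) (simp add: algebra_simps)
  qed (use A_eq ext_A in auto)
qed

lemma sheared: "prism_coordinates I a b w n d0 \<nu> p0 A (p1 + \<theta> * p2) p2 c0 c1 (c2 - \<theta> * c1) (d1 + \<theta> *\<^sub>R d2) d2"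
proof unfold_locales
  show "c0 * (p0 + d0 \<bullet> x) + c1 * (p1 + \<theta> * p2 + (d1 + \<theta> *\<^sub>R d2) \<bullet> x) + (c2 - \<theta> * c1) * (p2 + d2 \<bullet> x) = 1" for x
    using const[of x] by (simp add: inner_add_left algebra_simps)
  show "\<exists>r. x = r *\<^sub>R w" if "d0 \<bullet> x = 0" "(d1 + \<theta> *\<^sub>R d2) \<bullet> x = 0" "d2 \<bullet> x = 0" for x
    using that separate by (simp add: inner_add_left)
qed (use d12 in \<open>auto simp: inner_add_left\<close>)

lemma sheared_coords:
  assumes "v \<in> I"
  shows "(p1 + \<theta> * p2 + (d1 + \<theta> *\<^sub>R d2) \<bullet> a v) / len v = X0 v + \<theta> * Y0 v"
  using len_pos[OF assms] by (simp add: X0_def Y0_def inner_add_left field_simps)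

end

context parallel_prism
begin

text \<open>For d0 = 0 all side edges are equally long, and linear coordinates orthogonal to w
  serve. Otherwise the three functions are the length, the constant 1 and the product with
  \<open>cross3 w d0\<close>. The length vanishes where the cap planes meet, so dividing by it sends
  that line to infinity.\<close>

lemma coordinates_exist:
  obtains p1 p2 c0 c1 c2 d1 d2 where "prism_coordinates I a b w n d0 \<nu> p0 A p1 p2 c0 c1 c2 d1 d2"
proof (cases "d0 = 0")
  case True
  obtain e :: "real^3" where e: "e \<noteq> 0" "e \<bullet> w = 0"
    using orthogonal_to_vector_exists[of w] by (auto simp: orthogonal_def inner_commute)
  obtain v where "v \<in> I" using card_I by fastforce
  then have p0: "0 < p0" using length_pos[of v] True by simp
  have "prism_coordinates I a b w n d0 \<nu> p0 A 0 0 (1 / p0) 0 0 e (cross3 w e)"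
  proof unfold_locales
    show "cross3 w e \<bullet> w = 0" by (simp add: dot_cross_self)
    show "1 / p0 * (p0 + d0 \<bullet> x) + 0 * (0 + e \<bullet> x) + 0 * (0 + cross3 w e \<bullet> x) = 1" for x
      using True p0 by simp
    show "\<exists>r. x = r *\<^sub>R w" if "e \<bullet> x = 0" "cross3 w e \<bullet> x = 0" for x
      using parallel_to_axis[OF w e(2) _ that] e(1) by simp
  qed (use e in auto)
  then show thesis by (rule that)
next
  case False
  have "prism_coordinates I a b w n d0 \<nu> p0 A 1 0 0 1 0 0 (cross3 w d0)"
  proof unfold_locales
    show "cross3 w d0 \<bullet> w = 0" by (simp add: dot_cross_self)
    show "\<exists>r. x = r *\<^sub>R w" if "d0 \<bullet> x = 0" "cross3 w d0 \<bullet> x = 0" for x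
      using parallel_to_axis[OF w d0 _ that] False by simp
  qed auto
  then show thesis by (rule that)
qed

lemma frame:
  obtains X Y k c s t l where "prism_frame I X Y k c s t l a b w A"
proof -
  obtain p1 p2 c0 c1 c2 d1 d2 where "prism_coordinates I a b w n d0 \<nu> p0 A p1 p2 c0 c1 c2 d1 d2"
    by (rule coordinates_exist)
  then interpret C: prism_coordinates I a b w n d0 \<nu> p0 A p1 p2 c0 c1 c2 d1 d2 .
  have "\<exists>\<theta>. \<theta> \<notin> {\<theta>. \<not> inj_on (\<lambda>v. C.X0 v + \<theta> * C.Y0 v) I}"
    using C.finite_bad_shears infinite_UNIV_char_0 ex_new_if_finite by blast
  then obtain \<theta> where \<theta>: "inj_on (\<lambda>v. C.X0 v + \<theta> * C.Y0 v) I" by auto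
  interpret S: prism_coordinates I a b w n d0 \<nu> p0 A "p1 + \<theta> * p2" p2 c0 c1 "c2 - \<theta> * c1" "d1 + \<theta> *\<^sub>R d2" d2
    by (rule C.sheared)
  have "S.X0 v = C.X0 v + \<theta> * C.Y0 v" if "v \<in> I" for v
    using C.sheared_coords[OF that] by (simp add: S.X0_def S.len_def C.len_def)
  then have "inj_on S.X0 I" using \<theta> by (simp add: inj_on_def)
  then have "convex_polygon I S.X0 S.Y0" by (rule S.polygon)
  then obtain k c s t where "chained_polygon I S.X0 S.Y0 k c s t"
    using convex_polygon.chains by blast
  then show thesis using S.frame_exists that by blast
qed

end

lemma triangulation_count_range:
  assumes fr: "prism_frame I X Y k c s t l a b w P" and m: "card I = m"
  shows "\<lceil>((real m)\<^sup>2 + 6 * real m - 16) / 4\<rceil> \<le> int (max_triangulation_size P)"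
    and "real (max_triangulation_size P) \<le> ((real m)\<^sup>2 + real m - 6) / 2"
    and "k False = 1 \<Longrightarrow> real (max_triangulation_size P) = ((real m)\<^sup>2 + real m - 6) / 2"
proof -
  interpret prism_frame I X Y k c s t l a b w P by (rule fr)
  let ?N = "{card T | T. triangulation_of P T}"
  obtain T where T: "triangulation_of P T" "2 * card T + 8 = (\<Sum>e\<in>UNIV. k e * (k e - 1)) + 4 * card I"
    using triangulation_exists by blast
  have le: "2 * x + 6 \<le> m\<^sup>2 + m" if "x \<in> ?N" for x using that triangulation_card_le m by auto
  then have "?N \<subseteq> {..m\<^sup>2 + m}" by fastforce
  then have fin: "finite ?N" by (rule finite_subset) simp
  have max_in: "max_triangulation_size P \<in> ?N"
    unfolding max_triangulation_size_def using fin T(1) by (intro Max_in) auto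
  have max_ge: "card T \<le> max_triangulation_size P"
    unfolding max_triangulation_size_def using fin T(1) by (intro Max_ge) auto
  have "real (2 * max_triangulation_size P + 6) \<le> real (m\<^sup>2 + m)"
    using le[OF max_in] by (simp only: of_nat_le_iff)
  then show upper: "real (max_triangulation_size P) \<le> ((real m)\<^sup>2 + real m - 6) / 2"
    by (simp add: field_simps)
  have ks: "real (k True) + real (k False) = real m" using k_sum m by (metis of_nat_add)
  have kk: "real (k e * (k e - 1)) = real (k e) * (real (k e) - 1)" for e
    using k_pos[of e] by (simp add: of_nat_diff)
  have "real (2 * card T + 8) = real (k True * (k True - 1) + k False * (k False - 1) + 4 * m)"
    using T(2) m by (simp add: UNIV_bool add.commute)
  then have cT: "2 * real (card T) + 8 = real (k True) * (real (k True) - 1) + real (k False) * (real (k False) - 1) + 4 * real m"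
    unfolding of_nat_add kk by simp
  \<comment> \<open>This square yields k True^2 + k False^2 \<ge> m^2 / 2, which turns the count
    into the fraction under the ceiling.\<close>
  have "0 \<le> (real (k True) - real (k False))\<^sup>2" by simp
  then have "((real m)\<^sup>2 + 6 * real m - 16) / 4 \<le> real (card T)"
    using cT unfolding ks[symmetric] by (simp add: power2_eq_square algebra_simps)
  also have "\<dots> \<le> real (max_triangulation_size P)" using max_ge by simp
  finally show "\<lceil>((real m)\<^sup>2 + 6 * real m - 16) / 4\<rceil> \<le> int (max_triangulation_size P)"
    by (simp add: ceiling_le_iff)
  show "real (max_triangulation_size P) = ((real m)\<^sup>2 + real m - 6) / 2" if "k False = 1"
  proof -
    have kF: "real (k False) = 1" using that by simp
    then have kT: "real (k True) = real m - 1" using ks by simp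
    have "((real m)\<^sup>2 + real m - 6) / 2 = real (card T)"
      using cT unfolding kF kT by (simp add: power2_eq_square algebra_simps)
    then show ?thesis using upper max_ge by simp
  qed
qed

section \<open>Face lattice isomorphisms\<close>

locale face_iso =
  fixes f :: "'a::euclidean_space set \<Rightarrow> 'b::euclidean_space set" and S T
  assumes iso: "face_lattice_iso f S T" and S: "polytope S" and T: "polytope T"
begin

lemma f_face: "G face_of S \<Longrightarrow> f G face_of T"
  using iso unfolding face_lattice_iso_def bij_betw_def by blast

lemma f_surj:
  assumes "H face_of T"
  obtains G where "G face_of S" "f G = H"
proof -
  have "f ` {G. G face_of S} = {H. H face_of T}"
    using iso unfolding face_lattice_iso_def bij_betw_def by (elim conjE)
  then have "H \<in> f ` {G. G face_of S}" using assms by simp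
  then show thesis using that by auto
qed

lemma f_inj:
  assumes "G face_of S" "H face_of S" "f G = f H"
  shows "G = H"
proof -
  have "inj_on f {G. G face_of S}"
    using iso unfolding face_lattice_iso_def bij_betw_def by (elim conjE)
  then show ?thesis using assms by (auto dest: inj_onD)
qed

lemma f_mono: "G face_of S \<Longrightarrow> H face_of S \<Longrightarrow> f G \<subseteq> f H \<longleftrightarrow> G \<subseteq> H"
  using iso unfolding face_lattice_iso_def by simp

lemma f_empty: "f {} = {}"
proof -
  obtain G where G: "G face_of S" "f G = {}" by (rule f_surj[OF empty_face_of])
  then show ?thesis using f_mono[OF empty_face_of G(1)] by simp
qed

lemma f_whole: "f S = T"
proof -
  have "S face_of S" using S by (simp add: face_of_refl polytope_imp_convex)
  moreover obtain G where G: "G face_of S" "f G = T"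
    using f_surj[OF face_of_refl[OF polytope_imp_convex[OF T]]] .
  ultimately have "T \<subseteq> f S" using f_mono[of G S] face_of_imp_subset by blast
  then show ?thesis using f_face[OF \<open>S face_of S\<close>] face_of_imp_subset by blast
qed

lemma f_nonempty: "G face_of S \<Longrightarrow> G \<noteq> {} \<Longrightarrow> f G \<noteq> {}"
  using f_inj[OF _ empty_face_of] f_empty by metis

definition vmap :: "'a \<Rightarrow> 'b" where "vmap x = the_elem (f {x})"

lemma vertex_of_face:
  fixes R :: "'c::euclidean_space set"
  assumes "polytope R" "G face_of R" "G \<noteq> {}"
  obtains x where "x extreme_point_of R" "x \<in> G"
proof -
  have "polytope G" using assms by (metis face_of_polytope_polytope)
  then obtain x where "x extreme_point_of G"
    using extreme_point_exists_convex[of G] assms(3) polytope_imp_compact polytope_imp_convex by blast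
  then show thesis using that extreme_point_of_face[OF assms(2)] by blast
qed

text \<open>Pull back a vertex y of \<open>f {x}\<close>: the corresponding face is nonempty and
  contained in {x}, so it is {x} and \<open>f {x}\<close> is {y}.\<close>

lemma vmap:
  assumes "x extreme_point_of S"
  shows "f {x} = {vmap x}"
proof -
  have x: "{x} face_of S" using assms by (simp add: face_of_singleton)
  obtain y where y: "y extreme_point_of T" "y \<in> f {x}"
    using vertex_of_face[OF T f_face[OF x] f_nonempty[OF x]] by auto
  obtain G where G: "G face_of S" "f G = {y}"
    using f_surj[of "{y}"] y(1) face_of_singleton by metis
  have "G \<subseteq> {x}" using f_mono[OF G(1) x] G(2) y(2) by simp
  moreover have "G \<noteq> {}" using G(2) f_empty by auto
  ultimately have "G = {x}" by blast
  then have "f {x} = {y}" using G(2) by simp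
  then show ?thesis by (simp add: vmap_def)
qed

lemma vmap_face_iff:
  assumes "x extreme_point_of S" "G face_of S"
  shows "vmap x \<in> f G \<longleftrightarrow> x \<in> G"
  using f_mono[of "{x}" G] assms vmap by (simp add: face_of_singleton)

lemma vmap_extreme: "x extreme_point_of S \<Longrightarrow> vmap x extreme_point_of T"
  using f_face[of "{x}"] vmap by (simp add: face_of_singleton)

lemma inj_vmap: "inj_on vmap {x. x extreme_point_of S}"
proof (rule inj_onI)
  fix x y assume *: "x \<in> {x. x extreme_point_of S}" "y \<in> {x. x extreme_point_of S}" "vmap x = vmap y"
  then have "f {x} = f {y}" using vmap by simp
  then show "x = y" using f_inj[of "{x}" "{y}"] * by (simp add: face_of_singleton)
qed

lemma extreme_points_face:
  assumes G: "G face_of S"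
  shows "{y. y extreme_point_of f G} = vmap ` {x. x extreme_point_of G}"
proof safe
  fix x assume "x extreme_point_of G"
  then have "x extreme_point_of S" "x \<in> G" using extreme_point_of_face[OF G] by auto
  then show "vmap x extreme_point_of f G"
    using extreme_point_of_face[OF f_face[OF G]] vmap_extreme vmap_face_iff G by simp
next
  fix y assume "y extreme_point_of f G"
  then have y: "y extreme_point_of T" "y \<in> f G" using extreme_point_of_face[OF f_face[OF G]] by auto
  obtain H where H: "H face_of S" "f H = {y}" using f_surj[of "{y}"] y(1) face_of_singleton by metis
  have "H \<noteq> {}" using H(2) f_empty by auto
  then obtain x where x: "x extreme_point_of S" "x \<in> H" using vertex_of_face[OF S H(1)] by blast
  have xy: "vmap x = y" using vmap_face_iff[OF x(1) H(1)] x(2) H(2) by simp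
  then have "x \<in> G" using vmap_face_iff[OF x(1) G] y(2) by simp
  then show "y \<in> vmap ` {x. x extreme_point_of G}" using x(1) xy extreme_point_of_face[OF G] by auto
qed

end

lemma extreme_point_unit_interval: "x extreme_point_of {0..1::real} \<longleftrightarrow> x = 0 \<or> x = 1"
  using extreme_point_of_segment[of x 0 "1::real"] by (simp add: closed_segment_eq_real_ivl)

lemma face_of_unit_interval_cases:
  assumes "F face_of {0..1::real}" "x \<in> F" "x = 0 \<or> x = 1"
  shows "F = {x} \<or> F = {0..1}"
proof (rule ccontr)
  assume "\<not> (F = {x} \<or> F = {0..1})"
  then obtain y where y: "y \<in> F" "y \<noteq> x" and ne: "F \<noteq> {0..1}" using assms(2) by blast
  have sub: "F \<subseteq> {0..1}" using assms(1) by (rule face_of_imp_subset)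
  have "0 \<in> F \<and> 1 \<in> F"
  proof (cases "y = 0 \<or> y = 1")
    case True then show ?thesis using y assms(2,3) by auto
  next
    case False
    then have "y \<in> open_segment 0 1" using y(1) sub by (auto simp: open_segment_eq_real_ivl)
    then show ?thesis using face_ofD[OF assms(1)] y(1) by auto
  qed
  then have "closed_segment 0 1 \<subseteq> F"
    using assms(1) by (intro closed_segment_subset) (auto simp: face_of_imp_convex)
  then show False using ne sub by (auto simp: closed_segment_eq_real_ivl)
qed

lemma extreme_point_prod_unit_interval:
  fixes Q :: "'a::euclidean_space set"
  shows "x extreme_point_of (Q \<times> {0..1::real}) \<longleftrightarrow> fst x extreme_point_of Q \<and> (snd x = 0 \<or> snd x = 1)"
proof -
  have "{x} = {fst x} \<times> {snd x}" by auto
  then have "{x} face_of (Q \<times> {0..1::real}) \<longleftrightarrow> {fst x} face_of Q \<and> {snd x} face_of {0..1::real}"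
    using face_of_Times_eq[of "{fst x}" "{snd x}" Q "{0..1::real}"] by simp
  then show ?thesis by (simp add: face_of_singleton extreme_point_unit_interval)
qed

lemma polytope_hull_extreme: "polytope S \<Longrightarrow> S = convex hull {x. x extreme_point_of S}"
  for S :: "'a::euclidean_space set"
  by (rule Krein_Milman_Minkowski) (auto simp: polytope_imp_compact polytope_imp_convex)

section \<open>The vertices of a prism\<close>

text \<open>Passes from the lattice isomorphism to labelled points: \<open>a v\<close> and
  \<open>b v\<close> are the vertices that correspond to (v, 0) and (v, 1), so equal labels mean a
  side edge.\<close>

lemma prism_vertices:
  assumes "prism m A C D"
  obtains I :: "(real^2) set" and a b where
    "finite I" "card I = m" "inj_on a I" "a ` I \<inter> b ` I = {}"
    "{v. v extreme_point_of A} = a ` I \<union> b ` I" "A = convex hull (a ` I \<union> b ` I)"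
    "C face_of A" "D face_of A" "aff_dim C = 2" "aff_dim D = 2"
    "C = convex hull (a ` I)" "D = convex hull (b ` I)" "a ` I \<inter> D = {}" "b ` I \<inter> C = {}"
    "\<forall>v\<in>I. side_edge A C D (closed_segment (a v) (b v))"
proof -
  obtain Q :: "(real^2) set" and f where A: "polytope A" "aff_dim A = 3"
    and Q: "polytope Q" "aff_dim Q = 2" "card {v. v extreme_point_of Q} = m"
    and iso: "face_lattice_iso f (Q \<times> {0..1::real}) A"
    and CD: "f (Q \<times> {0}) = C" "f (Q \<times> {1}) = D"
    using assms unfolding prism_def by blast
  let ?S = "Q \<times> {0..1::real}"
  have "polytope {0..1::real}" using polytope_interval[of 0 "1::real"] by simp
  then have S: "polytope ?S" using Q(1) by (intro polytope_Times)
  interpret face_iso f ?S A by unfold_locales (fact iso S A(1))+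
  define I where "I = {v. v extreme_point_of Q}"
  define a where "a v = vmap (v, 0)" for v
  define b where "b v = vmap (v, 1)" for v
  have Qne: "Q \<noteq> {}" using Q(2) by auto
  have Qface: "Q face_of Q" using Q(1) by (simp add: face_of_refl polytope_imp_convex)
  have fin: "finite I" unfolding I_def using Q(1) by (intro finite_polyhedron_extreme_points polytope_imp_polyhedron)
  have extS: "{x. x extreme_point_of ?S} = (\<lambda>v. (v, 0)) ` I \<union> (\<lambda>v. (v, 1)) ` I"
    unfolding extreme_point_prod_unit_interval I_def by force
  have "?S face_of ?S" using S by (simp add: face_of_refl polytope_imp_convex)
  from extreme_points_face[OF this] have extA: "{v. v extreme_point_of A} = a ` I \<union> b ` I"
    unfolding f_whole extS by (simp add: image_Un image_image a_def b_def)
  have 01: "{0} face_of {0..1::real}" "{1} face_of {0..1::real}"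
    by (simp_all add: face_of_singleton extreme_point_unit_interval)
  have cap: "Q \<times> {s} face_of ?S" if "s = 0 \<or> s = 1" for s
    using that face_of_Times_eq[of Q "{s}" Q "{0..1}"] Qface 01 by auto
  have IQ: "v \<in> Q" if "v \<in> I" for v using that by (simp add: I_def extreme_point_of_def)
  have cap_ext: "{x. x extreme_point_of (Q \<times> {s})} = (\<lambda>v. (v, s)) ` I" if s: "s = 0 \<or> s = 1" for s :: real
  proof -
    have "x extreme_point_of (Q \<times> {s}) \<longleftrightarrow> fst x \<in> I \<and> snd x = s" for x
      unfolding extreme_point_of_face[OF cap[OF s]] extreme_point_prod_unit_interval
      using s IQ by (cases x) (auto simp: I_def)
    then show ?thesis by force
  qed
  have cap_ext': "{v. v extreme_point_of f (Q \<times> {s})} = (\<lambda>v. vmap (v, s)) ` I" if s: "s = 0 \<or> s = 1" for s :: real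
    using extreme_points_face[OF cap[OF s]] unfolding cap_ext[OF s] by (simp add: image_image)
  have faces: "C face_of A" "D face_of A" using f_face[OF cap[of 0]] f_face[OF cap[of 1]] CD by auto
  have extC: "{v. v extreme_point_of C} = a ` I"
    using cap_ext'[of 0] CD by (simp add: a_def)
  have extD: "{v. v extreme_point_of D} = b ` I"
    using cap_ext'[of 1] CD by (simp add: b_def)
  have polys: "polytope C" "polytope D" using faces A(1) face_of_polytope_polytope by blast+
  have "inj_on vmap ((\<lambda>v. (v, 0)) ` I \<union> (\<lambda>v. (v, 1)) ` I)" using inj_vmap unfolding extS .
  then have inj: "vmap x = vmap y \<longleftrightarrow> x = y" if "x \<in> I \<times> {0, 1}" "y \<in> I \<times> {0, 1}" for x y
  proof -
    have "x \<in> (\<lambda>v. (v, 0)) ` I \<union> (\<lambda>v. (v, 1)) ` I" "y \<in> (\<lambda>v. (v, 0)) ` I \<union> (\<lambda>v. (v, 1)) ` I"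
      using that by auto
    then show ?thesis using inj_on_eq_iff[OF \<open>inj_on vmap _\<close>] by blast
  qed
  have disj: "a ` I \<inter> b ` I = {}" using inj by (auto simp: a_def b_def)
  \<comment> \<open>Dimension is not part of a lattice isomorphism. The cap lies in some facet,
    whose preimage is a proper face of the product containing Q at level s, hence equal to it; so
    the cap is that facet.\<close>
  have facet: "aff_dim (f (Q \<times> {s})) = 2" if s: "s = 0 \<or> s = 1" for s :: real
  proof -
    let ?C = "f (Q \<times> {s})"
    have ne: "?C \<noteq> {}" using f_nonempty[OF cap[OF s]] Qne by auto
    have "Q \<times> {s} \<noteq> ?S"
    proof
      assume "Q \<times> {s} = ?S"
      then have "{s} = {0..1::real}" using Qne by (simp add: times_eq_iff)
      moreover have "0 \<in> {0..1::real}" "1 \<in> {0..1::real}" by auto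
      ultimately show False by (metis singletonD zero_neq_one)
    qed
    then have "?C \<noteq> A" using f_inj[OF cap[OF s] \<open>?S face_of ?S\<close>] f_whole by metis
    then obtain H where H: "H facet_of A" "?C \<subseteq> H"
      using face_of_polyhedron_subset_facet[OF polytope_imp_polyhedron[OF A(1)] f_face[OF cap[OF s]] ne] by blast
    obtain G where G: "G face_of ?S" "f G = H" using f_surj[OF facet_of_imp_face_of[OF H(1)]] .
    have sub: "Q \<times> {s} \<subseteq> G" using f_mono[OF cap[OF s] G(1)] G(2) H(2) by simp
    obtain F F' where F: "G = F \<times> F'" "F face_of Q" "F' face_of {0..1::real}"
      using G(1) unfolding face_of_Times_decomp by blast
    have "Q \<subseteq> F" "s \<in> F'" using sub Qne unfolding F(1) by auto
    then have "F = Q" using face_of_imp_subset[OF F(2)] by blast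
    moreover have "F' = {s} \<or> F' = {0..1}" by (rule face_of_unit_interval_cases[OF F(3) \<open>s \<in> F'\<close> s])
    moreover have "G \<noteq> ?S" using G(2) f_whole H(1) by (metis facet_of_irrefl)
    ultimately have "G = Q \<times> {s}" using F(1) by auto
    then have "?C = H" using G(2) by simp
    then show ?thesis using H(1) A(2) unfolding facet_of_def by simp
  qed
  have seg: "side_edge A C D (closed_segment (a v) (b v))" if v: "v \<in> I" for v
  proof -
    let ?G = "{v} \<times> {0..1::real}"
    have G: "?G face_of ?S"
      using v face_of_Times_eq[of "{v}" "{0..1::real}" Q "{0..1::real}"]
      by (auto simp: I_def face_of_singleton intro: face_of_refl)
    have "{x. x extreme_point_of ?G} = {(v, 0), (v, 1)}"
      using v extreme_point_of_face[OF G] unfolding extreme_point_prod_unit_interval I_def by auto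
    then have ext: "{y. y extreme_point_of f ?G} = {a v, b v}"
      using extreme_points_face[OF G] by (simp add: a_def b_def)
    have "polytope (f ?G)" using face_of_polytope_polytope A(1) f_face[OF G] by blast
    then have "f ?G = convex hull {a v, b v}" using polytope_hull_extreme[of "f ?G"] ext by simp
    then have "closed_segment (a v) (b v) face_of A" using f_face[OF G] by (simp add: segment_convex_hull)
    moreover have "a v \<noteq> b v" using disj v by blast
    then have "aff_dim (closed_segment (a v) (b v)) = 1"
      by (simp add: segment_convex_hull aff_dim_convex_hull aff_dim_2)
    moreover have "a v \<in> C" "b v \<in> D"
      using extC extD v unfolding extreme_point_of_def by blast+
    ultimately show ?thesis unfolding side_edge_def edge_of_def
      using ends_in_segment[of "a v" "b v"] by blast
  qed
  show thesis
  proof (rule that[of I a b])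
    show "card I = m" using Q(3) by (simp add: I_def)
    show "inj_on a I" using inj by (auto simp: inj_on_def a_def)
    show "A = convex hull (a ` I \<union> b ` I)" using polytope_hull_extreme[OF A(1)] extA by simp
    show "C = convex hull (a ` I)" using polytope_hull_extreme[OF polys(1)] extC by simp
    show "D = convex hull (b ` I)" using polytope_hull_extreme[OF polys(2)] extD by simp
    show "a ` I \<inter> D = {}" using extreme_point_of_face[OF faces(2)] extA extD disj by blast
    show "b ` I \<inter> C = {}" using extreme_point_of_face[OF faces(1)] extA extC disj by blast
    show "aff_dim C = 2" "aff_dim D = 2" using facet[of 0] facet[of 1] CD by auto
    show "\<forall>v\<in>I. side_edge A C D (closed_segment (a v) (b v))" using seg by simp
  qed (fact fin disj extA faces)+
qed

lemma parallel_segments: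
  assumes "parallel_sets (closed_segment x y) (closed_segment x' y')"
  shows "\<exists>r. y - x = r *\<^sub>R (y' - x')"
proof -
  have hull: "affine hull (closed_segment x y) = range (\<lambda>u. x + u *\<^sub>R (y - x))" for x y :: "real^3"
    by (simp add: segment_convex_hull affine_hull_2_alt)
  obtain s where s: "affine hull (closed_segment x' y') = (\<lambda>z. s + z) ` (affine hull (closed_segment x y))"
    using assms unfolding parallel_sets_def affine_parallel_def by blast
  have "x \<in> affine hull (closed_segment x y)" "y \<in> affine hull (closed_segment x y)"
    by (simp_all add: hull_inc)
  then have "s + x \<in> affine hull (closed_segment x' y')" "s + y \<in> affine hull (closed_segment x' y')"
    unfolding s by auto
  then obtain r r' where "s + x = x' + r *\<^sub>R (y' - x')" "s + y = x' + r' *\<^sub>R (y' - x')"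
    unfolding hull by auto
  note eq = this
  have "y - x = (s + y) - (s + x)" by simp
  also have "\<dots> = (r' - r) *\<^sub>R (y' - x')" unfolding eq by (simp add: scaleR_left_diff_distrib)
  finally have "y - x = (r' - r) *\<^sub>R (y' - x')" .
  then show ?thesis ..
qed

lemma face_hyperplane:
  fixes A :: "'a::euclidean_space set"
  assumes "polytope A" "C face_of A"
  obtains e \<epsilon> where "\<forall>x\<in>A. e \<bullet> x \<le> \<epsilon>" "C = A \<inter> {x. e \<bullet> x = \<epsilon>}"
proof -
  have "C exposed_face_of A"
    using assms exposed_face_of_polyhedron polytope_imp_polyhedron by blast
  then obtain e \<epsilon> where "A \<subseteq> {x. e \<bullet> x \<le> \<epsilon>}" "C = A \<inter> {x. e \<bullet> x = \<epsilon>}"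
    unfolding exposed_face_of_def by blast
  then show thesis by (intro that[of e \<epsilon>]) auto
qed

lemma prism_parallel_side_edges:
  assumes "prism m A C D" "side_edges_parallel A C D" "3 \<le> m"
  obtains I :: "(real^2) set" and a b w n d0 \<nu> p0 where
    "parallel_prism I a b w n d0 \<nu> p0 A" "card I = m" "C face_of A" "D face_of A"
    "aff_dim C = 2" "aff_dim D = 2" "C = convex hull (a ` I)" "D = convex hull (b ` I)"
proof -
  obtain I :: "(real^2) set" and a b where I: "finite I" "card I = m" "inj_on a I" "a ` I \<inter> b ` I = {}"
    and A: "{v. v extreme_point_of A} = a ` I \<union> b ` I" "A = convex hull (a ` I \<union> b ` I)"
    and faces: "C face_of A" "D face_of A" and dims: "aff_dim C = 2" "aff_dim D = 2"
    and hulls: "C = convex hull (a ` I)" "D = convex hull (b ` I)"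
    and disj: "a ` I \<inter> D = {}" "b ` I \<inter> C = {}"
    and seg: "\<forall>v\<in>I. side_edge A C D (closed_segment (a v) (b v))"
    by (rule prism_vertices[OF assms(1)])
  have polyA: "polytope A" using assms(1) by (simp add: prism_def)
  have inA: "a v \<in> A" "b v \<in> A" and inCD: "a v \<in> C" "b v \<in> D" if "v \<in> I" for v
    unfolding A(2) hulls using that by (auto intro: hull_inc)
  obtain e \<epsilon> where e: "\<forall>x\<in>A. e \<bullet> x \<le> \<epsilon>" "C = A \<inter> {x. e \<bullet> x = \<epsilon>}"
    using face_hyperplane[OF polyA faces(1)] .
  obtain g \<gamma> where g: "\<forall>x\<in>A. g \<bullet> x \<le> \<gamma>" "D = A \<inter> {x. g \<bullet> x = \<gamma>}"
    using face_hyperplane[OF polyA faces(2)] .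
  have ea: "e \<bullet> a v = \<epsilon>" and eb: "e \<bullet> b v < \<epsilon>" and ga: "g \<bullet> a v < \<gamma>" and gb: "g \<bullet> b v = \<gamma>"
    if v: "v \<in> I" for v
  proof -
    show "e \<bullet> a v = \<epsilon>" using inCD(1)[OF v] e(2) by auto
    show "g \<bullet> b v = \<gamma>" using inCD(2)[OF v] g(2) by auto
    have "b v \<notin> C" "a v \<notin> D" using disj v by auto
    then have "e \<bullet> b v \<noteq> \<epsilon>" "g \<bullet> a v \<noteq> \<gamma>" using inA[OF v] e(2) g(2) by auto
    then show "e \<bullet> b v < \<epsilon>" "g \<bullet> a v < \<gamma>" using e(1) g(1) inA[OF v] by (simp_all add: less_le)
  qed
  obtain v0 where v0: "v0 \<in> I" using I(2) assms(3) by fastforce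
  define w where "w = b v0 - a v0"
  have ew: "e \<bullet> w < 0" and gw: "0 < g \<bullet> w"
    using ea[OF v0] eb[OF v0] ga[OF v0] gb[OF v0] by (simp_all add: w_def inner_diff_right)
  \<comment> \<open>The function n is the one that supports the first cap, scaled to grow by 1 along
    w. From \<open>a v\<close> the second cap is reached after (\<gamma> - g \<bullet> a v) / (g
    \<bullet> w) times w; adding n, which is constant on the first cap, makes this length invariant
    along w.\<close>
  define n where "n = (1 / (e \<bullet> w)) *\<^sub>R e"
  define \<nu> where "\<nu> = - \<epsilon> / (e \<bullet> w)"
  define d0 where "d0 = n - (1 / (g \<bullet> w)) *\<^sub>R g"
  define p0 where "p0 = \<nu> + \<gamma> / (g \<bullet> w)"
  have nw: "n \<bullet> w = 1" using ew by (simp add: n_def)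
  have level: "\<nu> + n \<bullet> a v = 0" if "v \<in> I" for v
    using ea[OF that] by (simp add: n_def \<nu>_def)
  have len: "p0 + d0 \<bullet> a v = (\<gamma> - g \<bullet> a v) / (g \<bullet> w)" if "v \<in> I" for v
    using level[OF that] by (simp add: p0_def d0_def inner_diff_left diff_divide_distrib)
  have "parallel_prism I a b w n d0 \<nu> p0 A"
  proof
    show "w \<noteq> 0" using ew by auto
    show "d0 \<bullet> w = 0" using nw gw by (simp add: d0_def inner_diff_left)
    fix v assume v: "v \<in> I"
    show "0 < p0 + d0 \<bullet> a v" unfolding len[OF v] using ga[OF v] gw by simp
    have "parallel_sets (closed_segment (a v) (b v)) (closed_segment (a v0) (b v0))"
      using assms(2) bspec[OF seg v] bspec[OF seg v0] unfolding side_edges_parallel_def by blast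
    then obtain r where r: "b v - a v = r *\<^sub>R w" unfolding w_def using parallel_segments by blast
    have "g \<bullet> (b v - a v) = \<gamma> - g \<bullet> a v" using gb[OF v] by (simp add: inner_diff_right)
    then have "r * (g \<bullet> w) = \<gamma> - g \<bullet> a v" unfolding r by simp
    then have "r = p0 + d0 \<bullet> a v" unfolding len[OF v] using gw by (simp add: field_simps)
    then show "b v = a v + (p0 + d0 \<bullet> a v) *\<^sub>R w" using r by (simp add: algebra_simps)
  qed (use I assms(3) A nw level in auto)
  then show thesis using that I(2) faces dims hulls by blast
qed

section \<open>Prisms that project onto a side facet\<close>

text \<open>The coordinates are \<phi>, up to sign the product with \<open>cross3 w d\<close>, and
  the distance from the plane of F up to scale. The projection preserves \<phi>, so no vertex leaves
  the range of F. By nondegeneracy one end of this range is reached only on F; \<phi> is oriented so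
  that this is the maximum. A small positive shear moves only the vertices off F, to the right but
  not past the maximum. So \<open>lo\<close> and \<open>hi\<close> stay on F, and the lower chain is
  their chord.\<close>

lemma prism_projecting:
  assumes "prism m A C D" "side_edges_parallel A C D" "3 \<le> m" "parallel_sets C D"
    and F: "side_facet A C D F" "projects_onto \<pi> A F" "nondegenerate_projection \<pi> A F"
  shows "real (max_triangulation_size A) = ((real m)\<^sup>2 + real m - 6) / 2"
proof -
  obtain I :: "(real^2) set" and a b w n d0 \<nu> p0 where "parallel_prism I a b w n d0 \<nu> p0 A"
    and m: "card I = m" and faces: "C face_of A" "D face_of A"
    and dims: "aff_dim C = 2" "aff_dim D = 2" and hulls: "C = convex hull (a ` I)" "D = convex hull (b ` I)"
    by (rule prism_parallel_side_edges[OF assms(1-3)])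
  then interpret A: parallel_prism I a b w n d0 \<nu> p0 A by simp
  have polyA: "polytope A" using assms(1) by (simp add: prism_def)
  have convA: "convex A" using polyA by (rule polytope_imp_convex)
  have inA: "a v \<in> A" "b v \<in> A" if "v \<in> I" for v
    unfolding A.A_eq using that by (auto intro: hull_inc)
  obtain u0 where u0: "u0 \<in> I" using m assms(3) by fastforce
  define \<rho> where "\<rho> = p0 + d0 \<bullet> a u0"
  have \<rho>: "0 < \<rho>" unfolding \<rho>_def by (rule A.length_pos[OF u0])
  have level_b: "\<nu> + n \<bullet> b v = p0 + d0 \<bullet> a v" if "v \<in> I" for v
    using A.level_a[OF that] A.b_eq[OF that] A.n by (simp add: inner_add_right)
  \<comment> \<open>Parallel caps make n constant on the second cap, so all side edges have the same
    length.\<close>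
  have "p0 + d0 \<bullet> a v = \<rho>" if v: "v \<in> I" for v
  proof -
    obtain s where s: "affine hull D = (\<lambda>x. s + x) ` (affine hull C)"
      using assms(4) unfolding parallel_sets_def affine_parallel_def by blast
    have "a ` I \<subseteq> {x. n \<bullet> x = - \<nu>}" using A.level_a by (auto simp: eq_neg_iff_add_eq_0 add.commute)
    then have "affine hull C \<subseteq> {x. n \<bullet> x = - \<nu>}"
      unfolding hulls affine_hull_convex_hull by (rule hull_minimal) (rule affine_hyperplane)
    then have "n \<bullet> x = n \<bullet> s - \<nu>" if "x \<in> affine hull D" for x
      using that unfolding s by (auto simp: inner_add_right)
    moreover have "b v \<in> affine hull D" "b u0 \<in> affine hull D"
      unfolding hulls affine_hull_convex_hull using v u0 by (auto intro: hull_inc)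
    ultimately have "n \<bullet> b v = n \<bullet> b u0" by simp
    then show ?thesis using level_b[OF v] level_b[OF u0] by (simp add: \<rho>_def)
  qed
  then have b_eq: "b v = a v + \<rho> *\<^sub>R w" if "v \<in> I" for v using A.b_eq[OF that] that by simp
  have level_bounds: "0 \<le> \<nu> + n \<bullet> x \<and> \<nu> + n \<bullet> x \<le> \<rho>" if "x \<in> A" for x
  proof -
    have "a ` I \<union> b ` I \<subseteq> {x. n \<bullet> x \<ge> - \<nu>} \<inter> {x. n \<bullet> x \<le> \<rho> - \<nu>}"
      using A.level_a level_b \<open>\<And>v. v \<in> I \<Longrightarrow> p0 + d0 \<bullet> a v = \<rho>\<close> \<rho> by (force simp: algebra_simps)
    then have "A \<subseteq> {x. n \<bullet> x \<ge> - \<nu>} \<inter> {x. n \<bullet> x \<le> \<rho> - \<nu>}"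
      unfolding A.A_eq by (rule hull_minimal) (intro convex_Int convex_halfspace_ge convex_halfspace_le)
    then show ?thesis using that by auto
  qed
  have Ffacet: "F facet_of A" "F \<noteq> C" "F \<noteq> D" using F(1) by (auto simp: side_facet_def)
  have Fface: "F face_of A" by (rule facet_of_imp_face_of[OF Ffacet(1)])
  have polyF: "polytope F" using face_of_polytope_polytope polyA Fface by blast
  have dimF: "aff_dim F = 2" using Ffacet(1) assms(1) by (simp add: facet_of_def prism_def)
  obtain g \<gamma> where g: "\<forall>x\<in>A. g \<bullet> x \<le> \<gamma>" "F = A \<inter> {x. g \<bullet> x = \<gamma>}"
    using face_hyperplane[OF polyA Fface] .
  have extF: "{x. x extreme_point_of F} = (a ` I \<union> b ` I) \<inter> F"
    using extreme_point_of_face[OF Fface] A.ext_A by blast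
  have not_sub: "\<not> F \<subseteq> K" if "K face_of A" "aff_dim K = 2" "F \<noteq> K" for K
  proof
    assume "F \<subseteq> K"
    then have "F face_of K" using Fface that(1) face_of_face by blast
    then show False
      using face_of_aff_dim_lt[of K F] that dimF face_of_imp_convex by fastforce
  qed
  \<comment> \<open>If w were transversal to the plane of F, then the side edge at a vertex of F in
    one of the caps would leave A. So all vertices of F would lie in the other cap.\<close>
  have gw: "g \<bullet> w = 0"
  proof (rule ccontr)
    assume "g \<bullet> w \<noteq> 0"
    then consider "0 < g \<bullet> w" | "g \<bullet> w < 0" by linarith
    then show False
    proof cases
      case 1
      have "a v \<notin> F" if "v \<in> I" for v
      proof
        assume "a v \<in> F"
        then have "g \<bullet> b v = \<gamma> + \<rho> * (g \<bullet> w)" using g(2) b_eq[OF that] by (simp add: inner_add_right)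
        then show False using bspec[OF g(1) inA(2)[OF that]] mult_pos_pos[OF \<rho> 1] by simp
      qed
      then have "{x. x extreme_point_of F} \<subseteq> b ` I" unfolding extF by blast
      then have "F \<subseteq> D" using polytope_hull_extreme[OF polyF] hulls(2) hull_mono by metis
      then show False using not_sub[OF faces(2) dims(2) Ffacet(3)] by simp
    next
      case 2
      have "b v \<notin> F" if "v \<in> I" for v
      proof
        assume "b v \<in> F"
        then have "g \<bullet> a v = \<gamma> - \<rho> * (g \<bullet> w)" using g(2) b_eq[OF that] by (simp add: inner_add_right)
        then show False using bspec[OF g(1) inA(1)[OF that]] mult_pos_neg[OF \<rho> 2] by simp
      qed
      then have "{x. x extreme_point_of F} \<subseteq> a ` I" unfolding extF by blast
      then have "F \<subseteq> C" using polytope_hull_extreme[OF polyF] hulls(1) hull_mono by metis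
      then show False using not_sub[OF faces(1) dims(1) Ffacet(2)] by simp
    qed
  qed
  define VF where "VF = {v \<in> I. g \<bullet> a v = \<gamma>}"
  have inF: "a v \<in> F \<longleftrightarrow> v \<in> VF" "b v \<in> F \<longleftrightarrow> v \<in> VF" if "v \<in> I" for v
    using that inA[OF that] gw b_eq[OF that] unfolding g(2) VF_def by (simp_all add: inner_add_right)
  have F_eq: "F = convex hull (a ` VF \<union> b ` VF)"
  proof -
    have "(a ` I \<union> b ` I) \<inter> F = a ` VF \<union> b ` VF" using inF VF_def by auto
    then show ?thesis using polytope_hull_extreme[OF polyF] extF by simp
  qed
  have VF: "VF \<noteq> {}" "finite VF"
  proof -
    show "finite VF" using A.finite_I by (simp add: VF_def)
    show "VF \<noteq> {}"
    proof
      assume "VF = {}"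
      then have "F = {}" using F_eq by simp
      then show False using dimF by simp
    qed
  qed
  obtain d where d: "parallel_projection d (affine hull F) \<pi>" and \<pi>A: "\<pi> ` A = F"
    using F(2) unfolding projects_onto_def by blast
  have line: "{x + s *\<^sub>R d | s. True} \<inter> affine hull F = {\<pi> x}" for x
    using d unfolding parallel_projection_def by simp
  have proj: "\<exists>s. \<pi> x = x + s *\<^sub>R d" "\<pi> x \<in> affine hull F" for x
  proof -
    have "\<pi> x \<in> {x + s *\<^sub>R d | s. True} \<inter> affine hull F" unfolding line by simp
    then show "\<exists>s. \<pi> x = x + s *\<^sub>R d" "\<pi> x \<in> affine hull F" by auto
  qed
  have proj_unique: "x + s *\<^sub>R d = \<pi> x" if "x + s *\<^sub>R d \<in> affine hull F" for x s
  proof -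
    have "x + s *\<^sub>R d \<in> {x + s *\<^sub>R d | s. True} \<inter> affine hull F" using that by blast
    then show ?thesis unfolding line by simp
  qed
  have affF: "g \<bullet> x = \<gamma>" if "x \<in> affine hull F" for x
  proof -
    have "affine hull F \<subseteq> {x. g \<bullet> x = \<gamma>}"
      by (rule hull_minimal) (use g(2) in \<open>auto simp: affine_hyperplane\<close>)
    then show ?thesis using that by blast
  qed
  have g0: "g \<noteq> 0"
  proof
    assume "g = 0"
    then have "F = A \<or> F = {}" using g(2) by auto
    then show False using dimF assms(1) Ffacet(1) by (auto simp: prism_def)
  qed
  have gd: "g \<bullet> d \<noteq> 0"
  proof
    assume 0: "g \<bullet> d = 0"
    obtain s where s: "\<pi> (((\<gamma> + 1) / (g \<bullet> g)) *\<^sub>R g) = ((\<gamma> + 1) / (g \<bullet> g)) *\<^sub>R g + s *\<^sub>R d" using proj(1) by blast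
    have "g \<bullet> \<pi> (((\<gamma> + 1) / (g \<bullet> g)) *\<^sub>R g) = \<gamma> + 1"
      unfolding s using 0 g0 by (simp add: inner_add_right)
    then show False using affF[OF proj(2)] by simp
  qed
  \<comment> \<open>F contains a side edge, so its plane is invariant under translation by \<rho>
    times w, and the projection commutes with this translation.\<close>
  have \<pi>w: "\<pi> (x + \<rho> *\<^sub>R w) = \<pi> x + \<rho> *\<^sub>R w" for x
  proof -
    obtain v where v: "v \<in> VF" using VF(1) by blast
    then have vI: "v \<in> I" by (simp add: VF_def)
    have "a v \<in> affine hull F" "b v \<in> affine hull F" using inF[OF vI] v by (auto intro: hull_inc)
    then have "\<pi> x + 1 *\<^sub>R (b v - a v) \<in> affine hull F"
      using proj(2) by (intro mem_affine_3_minus affine_affine_hull)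
    moreover obtain s where s: "\<pi> x = x + s *\<^sub>R d" using proj(1) by blast
    ultimately have "x + \<rho> *\<^sub>R w + s *\<^sub>R d \<in> affine hull F" using b_eq[OF vI] by (simp add: algebra_simps)
    from proj_unique[OF this] show ?thesis using s by (simp add: algebra_simps)
  qed
  define \<phi>0 where "\<phi>0 = cross3 w d"
  have \<phi>0: "\<phi>0 \<bullet> w = 0" "\<phi>0 \<bullet> d = 0" by (simp_all add: \<phi>0_def dot_cross_self)
  have sep: "\<exists>r. x = r *\<^sub>R w" if "\<phi>0 \<bullet> x = 0" "g \<bullet> x = 0" for x
    using parallel_to_axis[OF A.w gw gd] that unfolding \<phi>0_def by simp
  have eqI: "x = y" if "\<phi>0 \<bullet> x = \<phi>0 \<bullet> y" "g \<bullet> x = g \<bullet> y" "n \<bullet> x = n \<bullet> y" for x y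
  proof -
    have "\<exists>r. x - y = r *\<^sub>R w" by (rule sep) (simp_all add: inner_diff_right that)
    then obtain r where r: "x - y = r *\<^sub>R w" ..
    have "n \<bullet> (x - y) = 0" using that by (simp add: inner_diff_right)
    then show ?thesis using r A.n by simp
  qed
  have \<phi>\<pi>: "\<phi>0 \<bullet> \<pi> x = \<phi>0 \<bullet> x" for x
    using proj(1)[of x] \<phi>0 by (auto simp: inner_add_right)
  obtain w0 where w0: "w0 extreme_point_of F" "\<forall>v. v extreme_point_of A \<and> \<pi> v = w0 \<longrightarrow> v = w0"
    using F(3) unfolding nondegenerate_projection_def by blast
  obtain q0 where q0: "q0 \<in> VF" "w0 = a q0 \<or> w0 = b q0"
  proof -
    have "w0 \<in> (a ` I \<union> b ` I) \<inter> F" using w0(1) extF by blast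
    then show thesis using inF that by auto
  qed
  have q0I: "q0 \<in> I" using q0(1) by (simp add: VF_def)
  have \<phi>b: "\<phi>0 \<bullet> b v = \<phi>0 \<bullet> a v" if "v \<in> I" for v using b_eq[OF that] \<phi>0 by (simp add: inner_add_right)
  \<comment> \<open>On F the value of \<phi>0 determines the point in the first cap. So a value
    strictly between two others would put the vertex \<open>a q0\<close> between \<open>a p\<close>
    and \<open>a q\<close>.\<close>
  have q0_ends: "(\<forall>v\<in>VF. \<phi>0 \<bullet> a v \<le> \<phi>0 \<bullet> a q0) \<or> (\<forall>v\<in>VF. \<phi>0 \<bullet> a q0 \<le> \<phi>0 \<bullet> a v)"
  proof (rule ccontr)
    assume "\<not> ?thesis"
    then obtain p q where pq: "p \<in> VF" "q \<in> VF" "\<phi>0 \<bullet> a p < \<phi>0 \<bullet> a q0" "\<phi>0 \<bullet> a q0 < \<phi>0 \<bullet> a q"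
      by (auto simp: not_le)
    then have I: "p \<in> I" "q \<in> I" by (auto simp: VF_def)
    define r where "r = (\<phi>0 \<bullet> a q0 - \<phi>0 \<bullet> a p) / (\<phi>0 \<bullet> a q - \<phi>0 \<bullet> a p)"
    have r: "0 < r" "r < 1" "r * (\<phi>0 \<bullet> a q - \<phi>0 \<bullet> a p) = \<phi>0 \<bullet> a q0 - \<phi>0 \<bullet> a p"
      using pq(3,4) by (simp_all add: r_def)
    have na: "n \<bullet> a v = - \<nu>" if "v \<in> I" for v using A.level_a[OF that] by linarith
    have aeq: "a q0 = (1 - r) *\<^sub>R a p + r *\<^sub>R a q"
    proof (rule eqI)
      show "\<phi>0 \<bullet> a q0 = \<phi>0 \<bullet> ((1 - r) *\<^sub>R a p + r *\<^sub>R a q)"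
        using r(3) by (simp add: inner_add_right algebra_simps)
      show "g \<bullet> a q0 = g \<bullet> ((1 - r) *\<^sub>R a p + r *\<^sub>R a q)"
        using pq q0(1) unfolding VF_def by (simp add: inner_add_right algebra_simps)
      show "n \<bullet> a q0 = n \<bullet> ((1 - r) *\<^sub>R a p + r *\<^sub>R a q)"
        using na[OF q0I] na[OF I(1)] na[OF I(2)] by (simp add: inner_add_right algebra_simps)
    qed
    have "a p \<noteq> a q" using pq(3,4) by auto
    then have "a q0 \<in> open_segment (a p) (a q)" unfolding in_segment using aeq r by blast
    moreover have "a q0 extreme_point_of A" using A.ext_A q0I by auto
    ultimately show False using inA(1)[OF I(1)] inA(1)[OF I(2)] unfolding extreme_point_of_def by blast
  qed
  obtain \<phi> where \<phi>: "\<phi> = \<phi>0 \<or> \<phi> = - \<phi>0" and q0_max: "\<forall>v\<in>VF. \<phi> \<bullet> a v \<le> \<phi> \<bullet> a q0"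
    using q0_ends
  proof
    assume "\<forall>v\<in>VF. \<phi>0 \<bullet> a v \<le> \<phi>0 \<bullet> a q0"
    then show thesis by (intro that[of \<phi>0]) auto
  next
    assume "\<forall>v\<in>VF. \<phi>0 \<bullet> a q0 \<le> \<phi>0 \<bullet> a v"
    then show thesis by (intro that[of "- \<phi>0"]) auto
  qed
  have sep': "\<exists>r. x = r *\<^sub>R w" if "\<phi> \<bullet> x = 0" "g \<bullet> x = 0" for x
    using \<phi> sep[of x] that by auto
  have \<phi>w: "\<phi> \<bullet> w = 0" using \<phi> \<phi>0 by auto
  have \<phi>\<pi>': "\<phi> \<bullet> \<pi> x = \<phi> \<bullet> x" for x using \<phi> \<phi>\<pi> by auto
  have \<phi>b': "\<phi> \<bullet> b v = \<phi> \<bullet> a v" if "v \<in> I" for v using \<phi> \<phi>b[OF that] by auto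
  define lo where "lo = Min ((\<lambda>v. \<phi> \<bullet> a v) ` VF)"
  have "lo \<in> (\<lambda>v. \<phi> \<bullet> a v) ` VF" unfolding lo_def using VF by (intro Min_in) auto
  then obtain p where p: "p \<in> VF" "lo = \<phi> \<bullet> a p" by auto
  have bounds: "\<phi> \<bullet> a p \<le> \<phi> \<bullet> x \<and> \<phi> \<bullet> x \<le> \<phi> \<bullet> a q0" if x: "x \<in> F" for x
  proof -
    have "a ` VF \<union> b ` VF \<subseteq> {x. \<phi> \<bullet> x \<ge> \<phi> \<bullet> a p} \<inter> {x. \<phi> \<bullet> x \<le> \<phi> \<bullet> a q0}"
    proof -
      have "\<phi> \<bullet> a p \<le> \<phi> \<bullet> a v" if "v \<in> VF" for v
        using that VF(2) unfolding p(2)[symmetric] lo_def by (intro Min_le) auto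
      then show ?thesis using q0_max \<phi>b' by (auto simp: VF_def)
    qed
    then have "F \<subseteq> {x. \<phi> \<bullet> x \<ge> \<phi> \<bullet> a p} \<inter> {x. \<phi> \<bullet> x \<le> \<phi> \<bullet> a q0}"
      unfolding F_eq by (rule hull_minimal) (intro convex_Int convex_halfspace_ge convex_halfspace_le)
    then show ?thesis using x by auto
  qed
  have \<pi>F: "\<pi> (a v) \<in> F" "\<pi> (b v) \<in> F" if "v \<in> I" for v using \<pi>A inA[OF that] by auto
  have range: "\<phi> \<bullet> a p \<le> \<phi> \<bullet> a v \<and> \<phi> \<bullet> a v \<le> \<phi> \<bullet> a q0" if "v \<in> I" for v
    using bounds[OF \<pi>F(1)[OF that]] \<phi>\<pi>' by simp
  \<comment> \<open>Both \<pi> (a v) and its translate by \<rho> times w lie in F, where levels stay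
    between 0 and \<rho>. So \<pi> (a v) is at level 0 and equals \<open>a q0\<close>. Nondegeneracy
    then identifies the vertices, by way of \<open>b v\<close> if w0 is in the second cap.\<close>
  have top: "v \<in> VF" if v: "v \<in> I" "\<phi> \<bullet> a v = \<phi> \<bullet> a q0" for v
  proof -
    have \<pi>b: "\<pi> (b v) = \<pi> (a v) + \<rho> *\<^sub>R w" using b_eq[OF v(1)] \<pi>w by simp
    have FA: "x \<in> A" if "x \<in> F" for x using that g(2) by blast
    have "\<nu> + n \<bullet> \<pi> (a v) + \<rho> \<le> \<rho>"
      using level_bounds[OF FA[OF \<pi>F(2)[OF v(1)]]] A.n by (simp add: \<pi>b inner_add_right)
    then have lev: "\<nu> + n \<bullet> \<pi> (a v) = 0" using level_bounds[OF FA[OF \<pi>F(1)[OF v(1)]]] by linarith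
    have \<pi>a: "\<pi> (a v) = a q0"
    proof (rule eqI)
      show "\<phi>0 \<bullet> \<pi> (a v) = \<phi>0 \<bullet> a q0" unfolding \<phi>\<pi> using v(2) \<phi> by auto
      show "g \<bullet> \<pi> (a v) = g \<bullet> a q0" using affF[OF proj(2)] q0(1) by (simp add: VF_def)
      show "n \<bullet> \<pi> (a v) = n \<bullet> a q0" using lev A.level_a[OF q0I] by simp
    qed
    have ext: "a v extreme_point_of A" "b v extreme_point_of A" using A.ext_A v(1) by auto
    have "a v = a q0"
      using q0(2)
    proof
      assume "w0 = a q0"
      then show ?thesis using w0(2) ext(1) \<pi>a by metis
    next
      assume "w0 = b q0"
      then have "b v = b q0" using w0(2) ext(2) \<pi>a \<pi>b b_eq[OF q0I] by metis
      then show ?thesis using b_eq[OF q0I] b_eq[OF v(1)] by simp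
    qed
    then show ?thesis using v(1) q0(1) by (simp add: VF_def)
  qed
  interpret P: parallel_prism I a b w n 0 \<nu> \<rho> A
    by unfold_locales (use A.finite_I A.card_I A.inj_a A.w A.n A.level_a \<rho> b_eq A.A_eq A.ext_A in auto)
  interpret K: prism_coordinates I a b w n 0 \<nu> \<rho> A 0 \<gamma> "1 / \<rho>" 0 0 \<phi> "- g"
  proof unfold_locales
    show "1 / \<rho> * (\<rho> + 0 \<bullet> x) + 0 * (0 + \<phi> \<bullet> x) + 0 * (\<gamma> + - g \<bullet> x) = 1" for x using \<rho> by simp
    show "\<exists>r. x = r *\<^sub>R w" if "\<phi> \<bullet> x = 0" "- g \<bullet> x = 0" for x using sep'[of x] that by simp
  qed (use \<phi>w gw in auto)
  have KX: "K.X0 v = (\<phi> \<bullet> a v) / \<rho>" and KY: "K.Y0 v = (\<gamma> - g \<bullet> a v) / \<rho>" for v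
    by (simp_all add: K.X0_def K.Y0_def K.len_def)
  have Y_nonneg: "0 \<le> K.Y0 v" if "v \<in> I" for v using bspec[OF g(1) inA(1)[OF that]] \<rho> by (simp add: KY)
  have Y_zero: "K.Y0 v = 0 \<longleftrightarrow> v \<in> VF" if "v \<in> I" for v using that \<rho> by (auto simp: KY VF_def)
  \<comment> \<open>The values of \<theta> at which a vertex off F would catch up with q0.\<close>
  have finS: "finite ((\<lambda>v. (K.X0 q0 - K.X0 v) / (K.Y0 v)) ` (I - VF))" using A.finite_I by simp
  have posS: "0 < x" if x: "x \<in> (\<lambda>v. (K.X0 q0 - K.X0 v) / (K.Y0 v)) ` (I - VF)" for x
  proof -
    obtain v where v: "v \<in> I" "v \<notin> VF" "x = (K.X0 q0 - K.X0 v) / K.Y0 v" using x by blast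
    have "\<phi> \<bullet> a v < \<phi> \<bullet> a q0" using range[OF v(1)] top[OF v(1)] v(2) by (auto simp: less_le)
    then have "K.X0 v < K.X0 q0" using \<rho> by (simp add: KX divide_strict_right_mono)
    moreover have "0 < K.Y0 v" using Y_nonneg[OF v(1)] Y_zero[OF v(1)] v(2) by (auto simp: less_le)
    ultimately show ?thesis using v(3) by simp
  qed
  obtain \<epsilon> where eps: "0 < \<epsilon>"
    "\<And>x. x \<in> (\<lambda>v. (K.X0 q0 - K.X0 v) / (K.Y0 v)) ` (I - VF) \<Longrightarrow> 2 * \<epsilon> < x"
    using finite_positive_lower_bound[OF finS posS] by blast
  have "infinite {0<..<\<epsilon>}" using eps(1) by (simp add: infinite_Ioo)
  then have "infinite ({0<..<\<epsilon>} - {\<theta>. \<not> inj_on (\<lambda>v. K.X0 v + \<theta> * K.Y0 v) I})"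
    by (rule Diff_infinite_finite[OF K.finite_bad_shears])
  then obtain \<theta> where \<theta>: "\<theta> \<in> {0<..<\<epsilon>}" "\<theta> \<notin> {\<theta>. \<not> inj_on (\<lambda>v. K.X0 v + \<theta> * K.Y0 v) I}"
    by (metis (no_types, lifting) Diff_iff all_not_in_conv finite.emptyI)
  define p1 c2 d1 where "p1 = 0 + \<theta> * \<gamma>" and "c2 = 0 - \<theta> * (0 :: real)" and "d1 = \<phi> + \<theta> *\<^sub>R - g"
  note shear_defs = this
  interpret S: prism_coordinates I a b w n 0 \<nu> \<rho> A p1 \<gamma> "1 / \<rho>" 0 c2 d1 "- g"
    unfolding shear_defs by (rule K.sheared)
  have SX: "S.X0 v = K.X0 v + \<theta> * K.Y0 v" if "v \<in> I" for v
  proof -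
    have "S.X0 v = (p1 + d1 \<bullet> a v) / K.len v" by (rule S.X0_def)
    also have "\<dots> = K.X0 v + \<theta> * K.Y0 v" unfolding shear_defs by (rule K.sheared_coords[OF that])
    finally show ?thesis .
  qed
  have SY: "S.Y0 v = K.Y0 v" for v
    unfolding S.Y0_def K.Y0_def by simp
  have "inj_on S.X0 I" using \<theta>(2) SX by (simp add: inj_on_def)
  then have poly: "convex_polygon I S.X0 S.Y0" by (rule S.polygon)
  then interpret G: convex_polygon I S.X0 S.Y0 .
  obtain k c s t where ch: "chained_polygon I S.X0 S.Y0 k c s t" using G.chains by blast
  then interpret H: chained_polygon I S.X0 S.Y0 k c s t .
  have pI: "p \<in> I" using p(1) by (simp add: VF_def)
  \<comment> \<open>The shear fixes p and moves vertices off F to the right, so a tie at the minimum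
    is broken in favour of F.\<close>
  have "G.lo \<in> VF"
  proof (rule ccontr)
    assume "G.lo \<notin> VF"
    then have "0 < K.Y0 G.lo" using Y_nonneg[OF G.lo] Y_zero[OF G.lo] by (auto simp: less_le)
    then have "0 < \<theta> * K.Y0 G.lo" using \<theta>(1) by simp
    moreover have "K.X0 p \<le> K.X0 G.lo" using range[OF G.lo] \<rho> by (simp add: KX divide_right_mono)
    moreover have "K.Y0 p = 0" using Y_zero[OF pI] p(1) by simp
    ultimately show False using G.lo_le[OF pI] SX[OF pI] SX[OF G.lo] by simp
  qed
  moreover have "G.hi \<in> VF"
  proof (rule ccontr)
    assume n: "G.hi \<notin> VF"
    then have y: "0 < K.Y0 G.hi" using Y_nonneg[OF G.hi] Y_zero[OF G.hi] by (auto simp: less_le)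
    have "2 * \<epsilon> < (K.X0 q0 - K.X0 G.hi) / K.Y0 G.hi" using G.hi n by (intro eps(2)) auto
    then have "\<theta> < (K.X0 q0 - K.X0 G.hi) / K.Y0 G.hi" using \<theta>(1) by simp
    then have "\<theta> * K.Y0 G.hi < K.X0 q0 - K.X0 G.hi" using y by (simp add: pos_less_divide_eq)
    moreover have "K.Y0 q0 = 0" using Y_zero[OF q0I] q0(1) by simp
    ultimately show False using G.le_hi[OF q0I] SX[OF q0I] SX[OF G.hi] by simp
  qed
  ultimately have "S.Y0 G.lo = 0" "S.Y0 G.hi = 0" using SY Y_zero G.lo G.hi by auto
  then have "0 \<le> G.turn G.lo G.hi v" if "v \<in> I" for v
    using Y_nonneg[OF that] SY[of v] G.lo_less_hi by (simp add: G.turn_def)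
  then have k: "k False = 1" by (rule H.k_False_1)
  show ?thesis
    by (rule triangulation_count_range(3)[OF S.frame_exists[OF ch] m k])
qed

section \<open>Prisms over polygons inscribed in a parabola\<close>

lemma face_lattice_iso_affine_image:
  fixes L :: "'a::euclidean_space \<Rightarrow> 'b::euclidean_space"
  assumes L: "linear L" "inj L"
  shows "face_lattice_iso (\<lambda>G. (+) p ` L ` G) S ((+) p ` L ` S)"
proof -
  have inj: "inj (\<lambda>x. p + L x)" using L(2) by (simp add: inj_def)
  have img: "(+) p ` L ` G = (\<lambda>x. p + L x) ` G" for G by (simp add: image_image)
  have iff: "(+) p ` L ` G face_of (+) p ` L ` S \<longleftrightarrow> G face_of S" for G
    by (simp add: face_of_linear_image[OF L])
  have "bij_betw (\<lambda>G. (+) p ` L ` G) {G. G face_of S} {G. G face_of (+) p ` L ` S}"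
    unfolding bij_betw_def
  proof (intro conjI equalityI subsetI)
    show "inj_on (\<lambda>G. (+) p ` L ` G) {G. G face_of S}"
      unfolding img using inj by (simp add: inj_on_def inj_image_eq_iff)
  next
    fix H assume "H \<in> (\<lambda>G. (+) p ` L ` G) ` {G. G face_of S}"
    then show "H \<in> {G. G face_of (+) p ` L ` S}" using iff by auto
  next
    fix H assume H: "H \<in> {G. G face_of (+) p ` L ` S}"
    then have "H \<subseteq> (\<lambda>x. p + L x) ` S" using face_of_imp_subset img by auto
    then obtain G where "H = (\<lambda>x. p + L x) ` G" by (auto simp: subset_image_iff)
    then have "H = (+) p ` L ` G" by (simp add: img)
    then show "H \<in> (\<lambda>G. (+) p ` L ` G) ` {G. G face_of S}" using H iff by auto
  qed
  then show ?thesis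
    unfolding face_lattice_iso_def img using inj by (simp add: inj_image_subset_iff)
qed

lemma quadratic_three_roots:
  fixes p q r :: real
  assumes "\<And>x. x \<in> R \<Longrightarrow> p * x\<^sup>2 + q * x = r" "3 \<le> card R"
  shows "p = 0 \<and> q = 0"
proof -
  obtain x y z where xyz: "x \<in> R" "y \<in> R" "z \<in> R" "x \<noteq> y" "y \<noteq> z" "x \<noteq> z"
  proof -
    obtain T where "T \<subseteq> R" "card T = 3" using assms(2) by (meson obtain_subset_with_card_n)
    then show thesis using that by (auto simp: card_3_iff)
  qed
  have "(x - y) * (p * (x + y) + q) = 0" "(x - z) * (p * (x + z) + q) = 0"
    using assms(1)[OF xyz(1)] assms(1)[OF xyz(2)] assms(1)[OF xyz(3)]
    by (simp_all add: power2_eq_square algebra_simps)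
  then have e: "p * (x + y) + q = 0" "p * (x + z) + q = 0" using xyz by auto
  moreover have "p * (y - z) = (p * (x + y) + q) - (p * (x + z) + q)" by (simp add: algebra_simps)
  ultimately have "p * (y - z) = 0" by simp
  then have "p = 0" using xyz by simp
  then show ?thesis using e by simp
qed

locale parabola_prism =
  fixes a u v w :: "real^3" and c :: real and V :: "(real^3) set"
  assumes unit: "norm u = 1" "norm v = 1" "u \<bullet> v = 0" and c: "c \<noteq> 0" and w: "w \<notin> span {u, v}"
    and V: "V \<subseteq> parabola a u v c" "finite V" and card_V: "3 \<le> card V"
begin

definition L :: "(real^2) \<times> real \<Rightarrow> real^3" where
  "L = (\<lambda>(y, s). y $ 1 *\<^sub>R u + y $ 2 *\<^sub>R v + s *\<^sub>R w)"

definition pnt :: "real \<Rightarrow> real^2" where "pnt x = vector [x, c * x\<^sup>2]"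

definition R :: "real set" where "R = {x. a + x *\<^sub>R u + (c * x\<^sup>2) *\<^sub>R v \<in> V}"

definition Q :: "(real^2) set" where "Q = convex hull (pnt ` R)"

abbreviation lift :: "((real^2) \<times> real) set \<Rightarrow> (real^3) set" where "lift G \<equiv> (+) a ` L ` G"

lemma uv: "u \<bullet> u = 1" "v \<bullet> v = 1" "u \<bullet> v = 0" "v \<bullet> u = 0"
  using unit by (simp_all add: dot_square_norm inner_commute)

lemma linear_L: "linear L"
  by (rule linearI) (auto simp: L_def algebra_simps split: prod.splits)

lemma L_zero:
  assumes "L x = 0"
  shows "x = 0"
proof -
  obtain y s where x: "x = (y, s)" by force
  have eq: "y $ 1 *\<^sub>R u + y $ 2 *\<^sub>R v + s *\<^sub>R w = 0" using assms by (simp add: L_def x)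
  have "s = 0"
  proof (rule ccontr)
    assume s: "s \<noteq> 0"
    have "s *\<^sub>R w + (y $ 1 *\<^sub>R u + y $ 2 *\<^sub>R v) = 0" using eq by (simp only: add.commute)
    then have "s *\<^sub>R w = - (y $ 1 *\<^sub>R u + y $ 2 *\<^sub>R v)" by (simp only: eq_neg_iff_add_eq_0)
    also have "\<dots> \<in> span {u, v}" by (intro span_neg span_add span_scale span_base) auto
    finally have "s *\<^sub>R w \<in> span {u, v}" .
    then have "(1 / s) *\<^sub>R (s *\<^sub>R w) \<in> span {u, v}" by (rule span_scale)
    then show False using w s by simp
  qed
  then have eq': "y $ 1 *\<^sub>R u + y $ 2 *\<^sub>R v = 0" using eq by simp
  have "u \<bullet> (y $ 1 *\<^sub>R u + y $ 2 *\<^sub>R v) = 0" "v \<bullet> (y $ 1 *\<^sub>R u + y $ 2 *\<^sub>R v) = 0" unfolding eq' by simp_all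
  then have "y $ 1 = 0" "y $ 2 = 0" by (simp_all add: inner_add_right uv)
  then show ?thesis using \<open>s = 0\<close> by (simp add: x vec_eq_iff forall_2 zero_prod_def)
qed

lemma inj_L: "inj L"
  using L_zero linear_injective_0[OF linear_L] by blast

lemma L_eq_iff: "L x = L y \<longleftrightarrow> x = y"
  using inj_L by (simp add: inj_eq)

lemma pnt_nth [simp]: "pnt x $ 1 = x" "pnt x $ 2 = c * x\<^sup>2"
  by (simp_all add: pnt_def)

lemma inj_pnt: "inj pnt"
proof (rule injI)
  fix x y assume "pnt x = pnt y"
  then have "pnt x $ 1 = pnt y $ 1" by simp
  then show "x = y" by simp
qed

lemma lift_pnt: "a + L (pnt x, s) = a + x *\<^sub>R u + (c * x\<^sup>2) *\<^sub>R v + s *\<^sub>R w"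
  by (simp add: L_def)

lemma V_eq: "V = (\<lambda>x. a + L (pnt x, 0)) ` R"
proof -
  have eq: "(\<lambda>x. a + L (pnt x, 0)) = (\<lambda>x. a + x *\<^sub>R u + (c * x\<^sup>2) *\<^sub>R v)"
    unfolding lift_pnt by simp
  have "V \<subseteq> range (\<lambda>x. a + x *\<^sub>R u + (c * x\<^sup>2) *\<^sub>R v)"
    using V(1) by (auto simp: parabola_def)
  then show ?thesis unfolding eq R_def by blast
qed

lemma inj_lift_pnt: "inj (\<lambda>x. a + L (pnt x, 0))"
  using inj_pnt by (simp add: inj_def L_eq_iff)

lemma finite_R: "finite R" and card_R: "card R = card V"
proof -
  have inj: "inj_on (\<lambda>x. a + L (pnt x, 0)) R" using inj_lift_pnt by (rule inj_on_subset) simp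
  have "finite ((\<lambda>x. a + L (pnt x, 0)) ` R)"
    by (rule subst[where P = finite, OF V_eq V(2)])
  then show "finite R" unfolding finite_image_iff[OF inj] .
  have "card V = card ((\<lambda>x. a + L (pnt x, 0)) ` R)" by (rule arg_cong[OF V_eq])
  then show "card R = card V" unfolding card_image[OF inj] ..
qed

lemma polytope_Q: "polytope Q"
  unfolding Q_def using finite_R by (simp add: polytope_convex_hull)

lemma pnt_not_in_hull:
  assumes "x \<in> R"
  shows "pnt x \<notin> convex hull (pnt ` R - {pnt x})"
proof
  \<comment> \<open>The tangent at x: along the parabola e has the value (y - x)^2 up to a constant.
    Dividing by c treats both signs of c alike.\<close>
  define e :: "real^2" where "e = vector [- 2 * x, 1 / c]"
  have e: "e \<bullet> pnt y = (y - x)\<^sup>2 - x\<^sup>2" for y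
    using c by (simp add: e_def inner_vec_def sum_2 power2_eq_square algebra_simps)
  assume "pnt x \<in> convex hull (pnt ` R - {pnt x})"
  moreover have "convex hull (pnt ` R - {pnt x}) \<subseteq> {y. e \<bullet> y > - x\<^sup>2}"
    by (rule hull_minimal) (auto simp: e convex_halfspace_gt)
  ultimately have "e \<bullet> pnt x > - x\<^sup>2" by blast
  then show False using e[of x] by simp
qed

lemma extreme_Q: "y extreme_point_of Q \<longleftrightarrow> y \<in> pnt ` R"
  unfolding Q_def
  by (rule extreme_point_of_convex_hull_convex_independent)
    (use finite_R pnt_not_in_hull in \<open>auto intro: finite_imp_compact\<close>)

lemma pnt_in_Q: "x \<in> R \<Longrightarrow> pnt x \<in> Q"
  by (simp add: Q_def hull_inc)

text \<open>A line meets a parabola at most twice, and there are at least three points.\<close>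

lemma R_not_on_line:
  assumes "\<And>x. x \<in> R \<Longrightarrow> e \<bullet> pnt x = r"
  shows "e = 0"
proof -
  have "(e $ 2 * c) * x\<^sup>2 + e $ 1 * x = r" if "x \<in> R" for x
    using assms[OF that] by (simp add: inner_vec_def sum_2 algebra_simps)
  then have "e $ 2 * c = 0 \<and> e $ 1 = 0"
    by (rule quadratic_three_roots) (use card_V card_R in auto)
  then show ?thesis using c by (simp add: vec_eq_iff forall_2)
qed

lemma aff_dim_Q: "aff_dim Q = 2"
proof (rule ccontr)
  assume "aff_dim Q \<noteq> 2"
  then have "aff_dim Q < DIM(real^2)" using aff_dim_le_DIM[of Q] by simp
  then obtain e r where e: "e \<noteq> 0" "Q \<subseteq> {x. e \<bullet> x = r}"
    using aff_lowdim_subset_hyperplane by blast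
  then have "e = 0" using pnt_in_Q by (intro R_not_on_line[of e r]) auto
  then show False using e(1) by simp
qed

lemma aff_dim_product: "aff_dim (Q \<times> {0..1::real}) = 3"
proof (rule ccontr)
  assume "aff_dim (Q \<times> {0..1::real}) \<noteq> 3"
  then have "aff_dim (Q \<times> {0..1::real}) < DIM((real^2) \<times> real)"
    using aff_dim_le_DIM[of "Q \<times> {0..1::real}"] by simp
  then obtain e r where e: "e \<noteq> 0" "Q \<times> {0..1::real} \<subseteq> {x. e \<bullet> x = r}"
    using aff_lowdim_subset_hyperplane by blast
  obtain e1 e2 where e12: "e = (e1, e2)" by force
  have eq: "e1 \<bullet> pnt x + e2 * s = r" if "x \<in> R" "0 \<le> s" "s \<le> 1" for x s
  proof -
    have "(pnt x, s) \<in> Q \<times> {0..1}" using pnt_in_Q[OF that(1)] that(2,3) by simp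
    then have "(pnt x, s) \<in> {x. e \<bullet> x = r}" using e(2) by blast
    then show ?thesis by (simp add: e12)
  qed
  have "e1 = 0" using eq[of _ 0] by (intro R_not_on_line[of e1 r]) auto
  obtain x where "x \<in> R" using card_V card_R by fastforce
  then have "e2 = 0" using eq[of x 0] eq[of x 1] by simp
  then show False using e(1) \<open>e1 = 0\<close> e12 by (simp add: zero_prod_def)
qed

lemma lift_convex_hull: "lift (convex hull S) = convex hull (lift S)"
  by (simp add: convex_hull_linear_image[OF linear_L] flip: convex_hull_translation)

lemma lift_cap: "lift (Q \<times> {0}) = convex hull V"
proof -
  have "Q \<times> {0::real} = convex hull (pnt ` R \<times> {0})" by (simp add: Q_def convex_hull_Times)
  moreover have "pnt ` R \<times> {0::real} = (\<lambda>x. (pnt x, 0)) ` R" by auto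
  then have "lift (pnt ` R \<times> {0}) = (\<lambda>x. a + L (pnt x, 0)) ` R" by (simp add: image_image)
  then have "lift (pnt ` R \<times> {0}) = V" by (rule trans[OF _ V_eq[symmetric]])
  ultimately show ?thesis using lift_convex_hull by simp
qed

lemma L_shift: "L (y, s) = L (y, 0) + s *\<^sub>R w"
  by (simp add: L_def)

lemma lift_product: "lift (Q \<times> {0..1}) = product_with_segment (convex hull V) w"
proof -
  have "x \<in> lift (Q \<times> {0..1}) \<longleftrightarrow> x \<in> product_with_segment (lift (Q \<times> {0})) w" for x
  proof
    assume "x \<in> lift (Q \<times> {0..1})"
    then obtain y s where ys: "y \<in> Q" "0 \<le> s" "s \<le> 1" "x = a + L (y, s)" by auto
    have "x = (a + L (y, 0)) + s *\<^sub>R w" using ys(4) L_shift[of y s] by (simp add: add.assoc)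
    then show "x \<in> product_with_segment (lift (Q \<times> {0})) w"
      using ys unfolding product_with_segment_def by blast
  next
    assume "x \<in> product_with_segment (lift (Q \<times> {0})) w"
    then obtain y s where ys: "y \<in> Q" "0 \<le> s" "s \<le> 1" "x = (a + L (y, 0)) + s *\<^sub>R w"
      unfolding product_with_segment_def by auto
    then have "x = a + L (y, s)" using L_shift[of y s] by (simp add: add.assoc)
    then show "x \<in> lift (Q \<times> {0..1})" using ys by auto
  qed
  then show ?thesis unfolding lift_cap by blast
qed

lemma lift_top: "lift (Q \<times> {1}) = (+) w ` (convex hull V)"
proof -
  have "lift (Q \<times> {1}) = (+) w ` lift (Q \<times> {0})"
  proof -
    have "a + L (y, 1) = w + (a + L (y, 0))" for y using L_shift[of y 1] by simp
    then show ?thesis by (force simp: image_iff)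
  qed
  then show ?thesis unfolding lift_cap .
qed

abbreviation A :: "(real^3) set" where "A \<equiv> lift (Q \<times> {0..1})"
abbreviation C :: "(real^3) set" where "C \<equiv> lift (Q \<times> {0})"
abbreviation D :: "(real^3) set" where "D \<equiv> lift (Q \<times> {1})"

lemma polytope_product: "polytope (Q \<times> {0..1::real})"
  using polytope_Q polytope_interval[of 0 "1::real"] by (intro polytope_Times) auto

lemma polytope_A: "polytope A"
  using polytope_product by (simp add: polytope_linear_image[OF linear_L] polytope_translation_eq)

lemma aff_dim_lift: "aff_dim (lift S) = aff_dim S"
  by (simp add: aff_dim_translation_eq aff_dim_injective_linear_image[OF linear_L inj_L])

lemma prism_A: "prism (card V) A C D"
proof -
  have "card {v. v extreme_point_of Q} = card V"
    unfolding extreme_Q using card_image[OF inj_on_subset[OF inj_pnt], of R] card_R by simp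
  then show ?thesis
    unfolding prism_def
    using polytope_A aff_dim_lift aff_dim_product polytope_Q aff_dim_Q
      face_lattice_iso_affine_image[OF linear_L inj_L, of a "Q \<times> {0..1}"]
    by (intro conjI exI[of _ Q] exI[of _ lift]) auto
qed

lemma lift_face_iff: "lift G face_of lift S \<longleftrightarrow> G face_of S"
  by (simp add: face_of_linear_image[OF linear_L inj_L])

lemma face_A:
  assumes "E face_of A" "E \<noteq> {}"
  obtains F F' where "E = lift (F \<times> F')" "F face_of Q" "F' face_of {0..1::real}" "F \<noteq> {}" "F' \<noteq> {}"
proof -
  have "E \<subseteq> (\<lambda>x. a + L x) ` (Q \<times> {0..1})" using face_of_imp_subset[OF assms(1)] by (simp add: image_image)
  then obtain G where "E = (\<lambda>x. a + L x) ` G" by (auto simp: subset_image_iff)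
  then have G: "E = lift G" by (simp add: image_image)
  then have "G face_of (Q \<times> {0..1})" using assms(1) lift_face_iff by blast
  then obtain F F' where "G = F \<times> F'" "F face_of Q" "F' face_of {0..1::real}"
    unfolding face_of_Times_decomp by blast
  then show thesis using that G assms(2) by auto
qed

lemma lift_mem: "a + L x \<in> lift S \<longleftrightarrow> x \<in> S"
  by (auto simp: L_eq_iff)

text \<open>A face of the product that meets both caps has 0 and 1 in its second factor, so over
  each point of its first factor it contains two points that differ by w. An edge spans only the
  line through them.\<close>

lemma side_edge_line:
  assumes "side_edge A C D E"
  obtains p where "affine hull E = affine hull {p, p + w}"
proof -
  have E: "E face_of A" "aff_dim E = 1" and CD: "E \<inter> C \<noteq> {}" "E \<inter> D \<noteq> {}"
    using assms by (auto simp: side_edge_def edge_of_def)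
  then have ne: "E \<noteq> {}" by auto
  obtain F F' where F: "E = lift (F \<times> F')" "F face_of Q" "F' face_of {0..1::real}" "F \<noteq> {}" "F' \<noteq> {}"
    using face_A[OF E(1) ne] .
  have "0 \<in> F'" "1 \<in> F'" using CD unfolding F(1) by (auto simp: L_eq_iff)
  obtain y where y: "y \<in> F" using F(4) by blast
  define p where "p = a + L (y, 0)"
  have pw: "p + w = a + L (y, 1)" using L_shift[of y 1] by (simp add: p_def)
  have "p \<in> E" unfolding F(1) p_def lift_mem using y \<open>0 \<in> F'\<close> by simp
  moreover have "p + w \<in> E" unfolding pw F(1) lift_mem using y \<open>1 \<in> F'\<close> by simp
  ultimately have pE: "{p, p + w} \<subseteq> E" by simp
  have "w \<noteq> 0" using w span_zero by metis
  then have dim: "aff_dim {p, p + w} = 1" by (simp add: aff_dim_2)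
  have "affine hull {p, p + w} = affine hull E"
  proof (rule affine_dim_equal)
    show "affine hull {p, p + w} \<subseteq> affine hull E"
      using pE by (rule hull_mono)
  qed (use dim E(2) in auto)
  from this[symmetric] show thesis by (rule that)
qed

lemma side_edges_parallel_A: "side_edges_parallel A C D"
  unfolding side_edges_parallel_def
proof (intro allI impI)
  fix E E' assume "side_edge A C D E" "side_edge A C D E'"
  then obtain p p' where p: "affine hull E = affine hull {p, p + w}" "affine hull E' = affine hull {p', p' + w}"
    by (metis side_edge_line)
  have "{p', p' + w} = (+) (p' - p) ` {p, p + w}" by (auto simp: algebra_simps)
  then have "affine hull E' = (+) (p' - p) ` (affine hull E)"
    unfolding p by (simp only: affine_hull_translation)
  then show "parallel_sets E E'"
    unfolding parallel_sets_def affine_parallel_def by blast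
qed

lemma D_eq: "D = (+) w ` C"
  unfolding lift_top lift_cap ..

lemma parallel_caps: "parallel_sets C D"
  unfolding parallel_sets_def affine_parallel_def D_eq affine_hull_translation by blast

section \<open>The side facet over the widest chord and the projection along the axis\<close>

definition pmin :: real where "pmin = Min R"
definition pmax :: real where "pmax = Max R"

lemma R_ne: "R \<noteq> {}"
  using card_V card_R by auto

lemma pmin: "pmin \<in> R" "x \<in> R \<Longrightarrow> pmin \<le> x" and pmax: "pmax \<in> R" "x \<in> R \<Longrightarrow> x \<le> pmax"
  using finite_R R_ne by (simp_all add: pmin_def pmax_def)

lemma pmin_less_pmax: "pmin < pmax"
proof (rule ccontr)
  assume "\<not> pmin < pmax"
  then have "R \<subseteq> {pmin}" using pmin pmax by fastforce
  then show False using card_mono[of "{pmin}" R] card_V card_R by simp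
qed

definition base :: "(real^2) set" where "base = closed_segment (pnt pmin) (pnt pmax)"

lemma base_face: "base face_of Q"
proof -
  \<comment> \<open>The line through \<open>pnt pmin\<close> and \<open>pnt pmax\<close>; between
    these two points the parabola stays on one side of it.\<close>
  define e :: "real^2" where "e = vector [- (pmin + pmax), 1 / c]"
  have e: "e \<bullet> pnt y = (y - pmin) * (y - pmax) - pmin * pmax" for y
    using c by (simp add: e_def inner_vec_def sum_2 power2_eq_square algebra_simps)
  have "(y - pmin) * (y - pmax) \<le> 0" if "y \<in> R" for y
    using pmin(2)[OF that] pmax(2)[OF that] by (simp add: mult_nonneg_nonpos)
  then have "pnt ` R \<subseteq> {y. e \<bullet> y \<le> - (pmin * pmax)}" by (auto simp: e)
  then have sub: "Q \<subseteq> {y. e \<bullet> y \<le> - (pmin * pmax)}"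
    unfolding Q_def by (rule hull_minimal) (rule convex_halfspace_le)
  let ?F = "Q \<inter> {y. e \<bullet> y = - (pmin * pmax)}"
  have face: "?F face_of Q"
    using polytope_imp_convex[OF polytope_Q] sub by (intro face_of_Int_supporting_hyperplane_le) auto
  have "{y. y extreme_point_of ?F} = {pnt pmin, pnt pmax}"
  proof -
    have "y extreme_point_of ?F \<longleftrightarrow> y \<in> pnt ` R \<and> e \<bullet> y = - (pmin * pmax)" for y
      using extreme_point_of_face[OF face, of y] extreme_Q[of y] pnt_in_Q by auto
    moreover have "y \<in> pnt ` R \<and> e \<bullet> y = - (pmin * pmax) \<longleftrightarrow> y = pnt pmin \<or> y = pnt pmax" for y
    proof
      assume y: "y \<in> pnt ` R \<and> e \<bullet> y = - (pmin * pmax)"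
      then obtain x where x: "y = pnt x" by blast
      then have "(x - pmin) * (x - pmax) = 0" using e[of x] y by simp
      then show "y = pnt pmin \<or> y = pnt pmax" using x by auto
    next
      assume "y = pnt pmin \<or> y = pnt pmax"
      then show "y \<in> pnt ` R \<and> e \<bullet> y = - (pmin * pmax)"
        using pmin(1) pmax(1) e[of pmin] e[of pmax] by auto
    qed
    ultimately show ?thesis by blast
  qed
  then have "?F = base"
    using polytope_hull_extreme[OF face_of_polytope_polytope[OF polytope_Q face]]
    unfolding base_def segment_convex_hull by simp
  then show ?thesis using face by simp
qed

definition F :: "(real^3) set" where "F = lift (base \<times> {0..1})"

lemma F_face: "F face_of A"
  unfolding F_def lift_face_iff face_of_Times_eq using base_face by (auto intro: face_of_refl)

lemma ends_in_base: "pnt pmin \<in> base" "pnt pmax \<in> base"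
  by (simp_all add: base_def)

lemma F_mem: "a + L (pnt pmin, 0) \<in> F" "a + L (pnt pmax, 0) \<in> F" "a + L (pnt pmin, 1) \<in> F"
  unfolding F_def lift_mem using ends_in_base by auto

lemma base_neq_Q: "base \<noteq> Q"
proof
  assume "base = Q"
  then have "pnt ` R = {y. y extreme_point_of closed_segment (pnt pmin) (pnt pmax)}"
    using extreme_Q unfolding base_def by auto
  also have "\<dots> = {pnt pmin, pnt pmax}" by (auto simp: extreme_point_of_segment)
  finally have "card (pnt ` R) \<le> 2" by (simp add: card_insert_if)
  then show False using card_image[OF inj_on_subset[OF inj_pnt], of R] card_R card_V by simp
qed

lemma aff_dim_F: "aff_dim F = 2"
proof -
  have "F \<noteq> A"
  proof
    assume "F = A"
    then have "base \<times> {0..1::real} = Q \<times> {0..1}"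
      unfolding F_def by (metis (no_types, lifting) inj_L inj_image_eq_iff translation_assoc image_add_0 add.left_inverse)
    then show False using base_neq_Q by (simp add: times_eq_iff)
  qed
  then have "aff_dim F < 3"
    using face_of_aff_dim_lt[OF polytope_imp_convex[OF polytope_A] F_face] aff_dim_lift aff_dim_product by simp
  moreover have "\<not> aff_dim F \<le> 1"
  proof
    let ?S = "{(pnt pmin, 0), (pnt pmax, 0), (pnt pmin, 1 :: real)}"
    assume "aff_dim F \<le> 1"
    moreover have "aff_dim ?S \<le> aff_dim (base \<times> {0..1::real})"
      using ends_in_base by (intro aff_dim_subset) auto
    ultimately have "aff_dim ?S \<le> 1" unfolding F_def aff_dim_lift by simp
    then have "collinear ?S" by (simp add: collinear_aff_dim)
    then have "collinear {(pnt pmax, 0), (pnt pmin, 0), (pnt pmin, 1 :: real)}" by (simp add: insert_commute)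
    then have "collinear {0, (pnt pmax, 0) - (pnt pmin, 0), (pnt pmin, 1 :: real) - (pnt pmin, 0)}"
      by (subst (asm) collinear_3) auto
    then have "pnt pmax - pnt pmin = 0 \<or> (\<exists>r. 0 = r *\<^sub>R (pnt pmax - pnt pmin) \<and> 1 = r * (0::real))"
      unfolding collinear_lemma by (auto simp: zero_prod_def)
    then have "pnt pmax = pnt pmin" by auto
    then show False using pmin_less_pmax injD[OF inj_pnt] by fastforce
  qed
  ultimately show ?thesis by linarith
qed

lemma F_side_facet: "side_facet A C D F"
proof -
  have "F facet_of A" unfolding facet_of_def
    using F_face aff_dim_F aff_dim_lift aff_dim_product F_mem by auto
  moreover have "F \<noteq> C" using F_mem(3) lift_mem[of "(pnt pmin, 1)" "Q \<times> {0}"] by auto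
  moreover have "F \<noteq> D" using F_mem(1) lift_mem[of "(pnt pmin, 0)" "Q \<times> {1}"] by auto
  ultimately show ?thesis by (simp add: side_facet_def)
qed

text \<open>Otherwise the part of w orthogonal to u and v, which is a multiple of
  \<open>cross3 u v\<close>, would vanish and w would lie in their span.\<close>

lemma uv_cross_w: "cross3 u v \<bullet> w \<noteq> 0"
proof
  assume 0: "cross3 u v \<bullet> w = 0"
  define z where "z = w - (w \<bullet> u) *\<^sub>R u - (w \<bullet> v) *\<^sub>R v"
  have "z \<bullet> u = 0" "z \<bullet> v = 0" by (simp_all add: z_def inner_diff_left uv)
  then have "cross3 z (cross3 u v) = 0" by (simp add: Lagrange)
  then have "collinear {0, cross3 u v, z}" by (simp add: cross_eq_0 insert_commute)
  moreover have "cross3 u v \<noteq> 0"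
  proof
    assume "cross3 u v = 0"
    then have "cross3 u (cross3 u v) = 0" by simp
    then have "- v = 0" by (simp add: Lagrange uv)
    then show False using unit by simp
  qed
  ultimately obtain r where r: "z = r *\<^sub>R cross3 u v"
    unfolding collinear_lemma by (metis scaleR_zero_left)
  have "cross3 u v \<bullet> z = 0" using 0 by (simp add: z_def inner_diff_right dot_cross_self)
  then have "r = 0" using r \<open>cross3 u v \<noteq> 0\<close> by simp
  then have "w = (w \<bullet> u) *\<^sub>R u + (w \<bullet> v) *\<^sub>R v" using r by (simp add: z_def algebra_simps)
  also have "\<dots> \<in> span {u, v}" by (intro span_add span_scale span_base) auto
  finally show False using w by simp
qed

text \<open>The direction of \<open>base\<close> with first coordinate 1:
  \<open>c * (pmin + pmax)\<close> is the slope of the chord of the parabola between the extreme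
  parameters.\<close>

definition chord :: "real^3" where "chord = u + (c * (pmin + pmax)) *\<^sub>R v"
definition normal :: "real^3" where "normal = cross3 chord w"

lemma normal_v: "normal \<bullet> v \<noteq> 0"
proof -
  have "normal \<bullet> v = - (cross3 u v \<bullet> w)"
    unfolding normal_def chord_def
    by (simp add: cross3_simps forall_3 inner_vec_def sum_3 algebra_simps)
  then show ?thesis using uv_cross_w by simp
qed

lemma base_L: "y \<in> base \<Longrightarrow> \<exists>r. y = pnt pmin + r *\<^sub>R (pnt pmax - pnt pmin) \<and> 0 \<le> r \<and> r \<le> 1"
  unfolding base_def by (auto simp: in_segment algebra_simps)

lemma L_chord: "L (pnt pmax - pnt pmin, 0) = (pmax - pmin) *\<^sub>R chord"
  by (simp add: L_def chord_def power2_eq_square algebra_simps)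

lemma F_plane: "affine hull F = {x. normal \<bullet> x = normal \<bullet> (a + L (pnt pmin, 0))}"
proof -
  have "normal \<bullet> x = normal \<bullet> (a + L (pnt pmin, 0))" if x: "x \<in> F" for x
  proof -
    obtain y s where ys: "y \<in> base" "x = a + L (y, s)" using x unfolding F_def by auto
    obtain r where r: "y = pnt pmin + r *\<^sub>R (pnt pmax - pnt pmin)" using base_L[OF ys(1)] by blast
    have "(y, s) = (pnt pmin, 0) + r *\<^sub>R (pnt pmax - pnt pmin, 0) + s *\<^sub>R (0, 1)" by (simp add: r)
    then have "L (y, s) = L (pnt pmin, 0) + r *\<^sub>R L (pnt pmax - pnt pmin, 0) + s *\<^sub>R L (0, 1)"
      by (simp only: linear_add[OF linear_L] linear_scale[OF linear_L])
    then have "x = a + L (pnt pmin, 0) + (r * (pmax - pmin)) *\<^sub>R chord + s *\<^sub>R w"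
      unfolding ys(2) L_chord by (simp add: L_def)
    then show ?thesis by (simp add: inner_add_right normal_def dot_cross_self)
  qed
  then have "affine hull F \<subseteq> {x. normal \<bullet> x = normal \<bullet> (a + L (pnt pmin, 0))}"
    by (intro hull_minimal) (auto intro: affine_hyperplane)
  moreover have "normal \<noteq> 0" using normal_v by auto
  then have "aff_dim {x. normal \<bullet> x = normal \<bullet> (a + L (pnt pmin, 0))} = 2"
    by (simp add: aff_dim_hyperplane)
  ultimately show ?thesis
    using F_mem(1) aff_dim_F by (intro affine_dim_equal) (auto intro: affine_hyperplane)
qed

text \<open>The axis direction v is transversal to the plane of F by \<open>normal_v\<close>. The
  coefficient is the solution r of \<open>normal \<bullet> (x + r *\<^sub>R v) = normal \<bullet> (a
  + L (pnt pmin, 0))\<close>.\<close>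

definition proj :: "real^3 \<Rightarrow> real^3" where
  "proj x = x + ((normal \<bullet> (a + L (pnt pmin, 0)) - normal \<bullet> x) / (normal \<bullet> v)) *\<^sub>R v"

lemma proj_unique:
  assumes "x + r *\<^sub>R v \<in> affine hull F"
  shows "x + r *\<^sub>R v = proj x"
proof -
  have "normal \<bullet> x + r * (normal \<bullet> v) = normal \<bullet> (a + L (pnt pmin, 0))"
    using assms unfolding F_plane by (simp add: inner_add_right)
  then have "r = (normal \<bullet> (a + L (pnt pmin, 0)) - normal \<bullet> x) / (normal \<bullet> v)"
    using normal_v by (simp add: field_simps)
  then show ?thesis by (simp add: proj_def)
qed

lemma proj_in: "proj x \<in> affine hull F"
  unfolding F_plane proj_def using normal_v by (simp add: inner_add_right)

lemma proj_parallel: "parallel_projection v (affine hull F) proj"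
  unfolding parallel_projection_def
proof (intro allI equalityI subsetI)
  fix x y assume "y \<in> {x + r *\<^sub>R v | r. True} \<inter> affine hull F"
  then show "y \<in> {proj x}" using proj_unique by auto
next
  fix x y assume "y \<in> {proj x}"
  then show "y \<in> {x + r *\<^sub>R v | r. True} \<inter> affine hull F"
    using proj_in[of x] by (auto simp: proj_def)
qed

text \<open>Projection along v keeps the first coordinate, so this is the parameter of the image on
  \<open>base\<close>.\<close>

definition ratio :: "real^2 \<Rightarrow> real" where "ratio y = (y $ 1 - pmin) / (pmax - pmin)"

lemma proj_L:
  "proj (a + L (y, s)) = a + L (pnt pmin + ratio y *\<^sub>R (pnt pmax - pnt pmin), s)"
proof -
  let ?y = "pnt pmin + ratio y *\<^sub>R (pnt pmax - pnt pmin)"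
  define r where "r = ?y $ 2 - y $ 2"
  have "ratio y * (pmax - pmin) = y $ 1 - pmin" using pmin_less_pmax by (simp add: ratio_def)
  then have y1: "?y $ 1 = y $ 1" by simp
  have eq: "a + L (?y, s) = (a + L (y, s)) + r *\<^sub>R v"
    unfolding L_def prod.case y1 r_def by (simp add: algebra_simps)
  have "a + L (?y, s) = a + L (pnt pmin, 0) + (ratio y * (pmax - pmin)) *\<^sub>R chord + s *\<^sub>R w"
  proof -
    have "(?y, s) = (pnt pmin, 0) + ratio y *\<^sub>R (pnt pmax - pnt pmin, 0) + s *\<^sub>R (0, 1)" by simp
    then have "L (?y, s) = L (pnt pmin, 0) + ratio y *\<^sub>R L (pnt pmax - pnt pmin, 0) + s *\<^sub>R L (0, 1)"
      by (simp only: linear_add[OF linear_L] linear_scale[OF linear_L])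
    then show ?thesis unfolding L_chord by (simp add: L_def)
  qed
  then have "a + L (?y, s) \<in> affine hull F"
    unfolding F_plane by (simp add: inner_add_right normal_def dot_cross_self)
  then show ?thesis using proj_unique[of "a + L (y, s)" r] unfolding eq by simp
qed

lemma projects: "projects_onto proj A F"
  unfolding projects_onto_def
proof (intro conjI exI equalityI subsetI)
  show "parallel_projection v (affine hull F) proj" by (rule proj_parallel)
next
  fix z assume "z \<in> proj ` A"
  then obtain y s where ys: "y \<in> Q" "0 \<le> s" "s \<le> 1" "z = proj (a + L (y, s))" by auto
  have "pnt ` R \<subseteq> {y. axis 1 1 \<bullet> y \<ge> pmin} \<inter> {y. axis 1 1 \<bullet> y \<le> pmax}"
    using pmin pmax by (auto simp: inner_axis' )
  then have "Q \<subseteq> {y. axis 1 1 \<bullet> y \<ge> pmin} \<inter> {y. axis 1 1 \<bullet> y \<le> pmax}"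
    unfolding Q_def by (rule hull_minimal) (intro convex_Int convex_halfspace_ge convex_halfspace_le)
  then have "pmin \<le> y $ 1" "y $ 1 \<le> pmax" using ys(1) by (auto simp: inner_axis')
  then have r: "0 \<le> ratio y" "ratio y \<le> 1" using pmin_less_pmax by (simp_all add: ratio_def)
  have "pnt pmin + ratio y *\<^sub>R (pnt pmax - pnt pmin) \<in> base"
    unfolding base_def in_segment using r by (auto intro!: exI[of _ "ratio y"] simp: algebra_simps)
  then show "z \<in> F" unfolding ys(4) proj_L F_def lift_mem using ys by auto
next
  fix z assume z: "z \<in> F"
  then have "z + 0 *\<^sub>R v \<in> affine hull F" by (simp add: hull_inc)
  then have "z = proj z" using proj_unique[of z 0] by simp
  moreover have "z \<in> A" using z face_of_imp_subset[OF F_face] by blast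
  ultimately show "z \<in> proj ` A" by blast
qed

text \<open>Points of the parabola are determined by their first coordinate, which the projection
  along v preserves together with the level. So no other vertex falls on the corner over
  \<open>pmin\<close> at level 0.\<close>

lemma nondegenerate: "nondegenerate_projection proj A F"
  unfolding nondegenerate_projection_def
proof (intro exI conjI allI impI)
  let ?p = "a + L (pnt pmin, 0)"
  have ext: "{a + L x} face_of A \<longleftrightarrow> {x} face_of Q \<times> {0..1}" for x
    using lift_face_iff[of "{x}" "Q \<times> {0..1}"] by simp
  have "?p extreme_point_of A"
    unfolding face_of_singleton[symmetric] ext
    unfolding face_of_singleton extreme_point_prod_unit_interval using extreme_Q pmin(1) by simp
  then show "?p extreme_point_of F" using extreme_point_of_face[OF F_face] F_mem(1) by blast
  fix z assume z: "z extreme_point_of A \<and> proj z = ?p"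
  then have "z \<in> A" by (simp add: extreme_point_of_def)
  then obtain y s where ys: "z = a + L (y, s)" by auto
  have "{a + L (y, s)} face_of A" using z unfolding ys face_of_singleton by (rule conjunct1)
  then have "y extreme_point_of Q"
    unfolding ext unfolding face_of_singleton extreme_point_prod_unit_interval by simp
  then obtain x where x: "y = pnt x" unfolding extreme_Q by (rule imageE)
  have "(pnt pmin + ratio y *\<^sub>R (pnt pmax - pnt pmin), s) = (pnt pmin, 0)"
    using z unfolding ys proj_L by (simp add: L_eq_iff)
  then have "s = 0" "ratio y *\<^sub>R (pnt pmax - pnt pmin) = 0" by auto
  then have "(ratio y *\<^sub>R (pnt pmax - pnt pmin)) $ 1 = 0" by (simp only: zero_index)
  then have "ratio y = 0" using pmin_less_pmax by simp
  then have "x = pmin" using pmin_less_pmax by (simp add: ratio_def x)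
  then show "z = ?p" using ys x \<open>s = 0\<close> by simp
qed

end

theorem proposition4p4:
  fixes m :: nat
  assumes "m \<ge> 3"
  shows
    "(\<forall>A C D. prism m A C D \<and> side_edges_parallel A C D \<longrightarrow>
        (\<lceil>((real m)\<^sup>2 + 6 * real m - 16) / 4\<rceil> \<le> int (max_triangulation_size A) \<and>
         real (max_triangulation_size A) \<le> ((real m)\<^sup>2 + real m - 6) / 2) \<and>
        (parallel_sets C D \<and> (\<exists>F \<pi>. side_facet A C D F \<and> projects_onto \<pi> A F \<and>
            nondegenerate_projection \<pi> A F) \<longrightarrow>
         real (max_triangulation_size A) = ((real m)\<^sup>2 + real m - 6) / 2)) \<and>
     (\<forall>a u v w c V C A.
        norm u = 1 \<and> norm v = 1 \<and> u \<bullet> v = 0 \<and> c \<noteq> 0 \<and> w \<notin> span {u, v} \<and>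
        V \<subseteq> parabola a u v c \<and> finite V \<and> card V = m \<and>
        C = convex hull V \<and> A = product_with_segment C w \<longrightarrow>
        prism m A C ((+) w ` C) \<and>
        side_edges_parallel A C ((+) w ` C) \<and>
        parallel_sets C ((+) w ` C) \<and>
        (\<exists>F \<pi>. side_facet A C ((+) w ` C) F \<and> projects_onto \<pi> A F \<and>
            nondegenerate_projection \<pi> A F) \<and>
        real (max_triangulation_size A) = ((real m)\<^sup>2 + real m - 6) / 2)"
proof (intro conjI allI impI)
  fix A C D assume pr: "prism m A C D \<and> side_edges_parallel A C D"
  then obtain I :: "(real^2) set" and a b w n d0 \<nu> p0 where
    par: "parallel_prism I a b w n d0 \<nu> p0 A" and m: "card I = m"
    using prism_parallel_side_edges assms by metis
  obtain X Y k c s t l where fr: "prism_frame I X Y k c s t l a b w A"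
    by (rule parallel_prism.frame[OF par])
  show "\<lceil>((real m)\<^sup>2 + 6 * real m - 16) / 4\<rceil> \<le> int (max_triangulation_size A)"
    by (rule triangulation_count_range(1)[OF fr m])
  show "real (max_triangulation_size A) \<le> ((real m)\<^sup>2 + real m - 6) / 2"
    by (rule triangulation_count_range(2)[OF fr m])
  assume "parallel_sets C D \<and> (\<exists>F \<pi>. side_facet A C D F \<and> projects_onto \<pi> A F \<and>
    nondegenerate_projection \<pi> A F)"
  then show "real (max_triangulation_size A) = ((real m)\<^sup>2 + real m - 6) / 2"
    using prism_projecting pr assms by blast
next
  fix a u v w :: "real^3" and c :: real and V C A
  assume h: "norm u = 1 \<and> norm v = 1 \<and> u \<bullet> v = 0 \<and> c \<noteq> 0 \<and> w \<notin> span {u, v} \<and>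
    V \<subseteq> parabola a u v c \<and> finite V \<and> card V = m \<and>
    C = convex hull V \<and> A = product_with_segment C w"
  interpret P: parabola_prism a u v w c V
    using h assms by unfold_locales auto
  have m: "card V = m" and C: "P.C = C" and A: "P.A = A" and D: "P.D = (+) w ` C"
    using h P.lift_cap P.lift_product P.lift_top by simp_all
  note facts = P.prism_A P.side_edges_parallel_A P.parallel_caps P.F_side_facet P.projects P.nondegenerate
  show "prism m A C ((+) w ` C)" using facts(1) unfolding m A C D .
  show "side_edges_parallel A C ((+) w ` C)" using facts(2) unfolding A C D .
  show "parallel_sets C ((+) w ` C)" using facts(3) unfolding C D .
  show "\<exists>F \<pi>. side_facet A C ((+) w ` C) F \<and> projects_onto \<pi> A F \<and> nondegenerate_projection \<pi> A F"
    using facts(4-6) unfolding A C D by blast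
  show "real (max_triangulation_size A) = ((real m)\<^sup>2 + real m - 6) / 2"
    using prism_projecting[OF facts(1,2) P.card_V facts(3-6)] unfolding m A .
qed

end
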